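(* Let $X$ be an infinite dimensional complex Banach space. The following conditions are equivalent. (i) $G_a(X)=1$. (ii) $X$ does not have finite cotype, i.e. $X$ does not have cotype $p$ for any $2\le p<\infty$. (iii) $X$ contains $\ell_\infty^n$'s $\lambda$-uniformly for some (and then all) $\lambda>1$. (iv) The identity operator $\operatorname{Id}_X$ is not $(p,1)$-summing for any $2\le p<+\infty$. (v) $\ell_\infty$ is finitely representable in $X$.
   Context: Cotype: for $2\le p<\infty$ a Banach space $Y$ has cotype $p$ if there is a constant $C>0$ such that for each choice of finitely many $x_1,\dots,x_N\in Y$ one has $\big(\sum_{n=1}^N\|x_n\|^p\big)^{1/p}\le C\big(\int_0^1\big\|\sum_{n=1}^N r_n(t)x_n\big\|^2dt\big)^{1/2}$, where $r_n$ is the $n$-th Rademacher function on $[0,1]$. $X$ contains $\ell_\infty^n$'s $\lambda$-uniformly if for every $n\in\mathbb{N}$ there are an $n$-dimensional subspace $E_n$ of $X$ and a linear isomorphism $v_n:\ell_\infty^n\to E_n$ with $\|v_n\|\,\|v_n^{-1}\|\le\lambda$. An operator $T:X\to Y$ between Banach spaces is $(p,1)$-summing ($1\le p<\infty$) if there is $c>0$ such that for each choice of finitely many $x_1,\dots,x_n\in X$ one has $(\sum_i\|Tx_i\|^p)^{1/p}\le c\,\sup_{\|x^*\|\le1}\sum_i|x^*(x_i)|$, the supremum being over $x^*$ in the unit ball of $X'$. A Banach space $Z$ is finitely representable in $X$ if for every finite dimensional subspace $E$ of $Z$ and every $\varepsilon>0$ there are a finite dimensional subspace $F$ of $X$ and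 a linear isomorphism $T:E\to F$ with $\|T\|\,\|T^{-1}\|<1+\varepsilon$. $X'$ denotes the topological dual of $X$. For a Dirichlet series $D=\sum_n a_n\frac1{n^s}$ with coefficients in a complex Banach space $X$ (variable $s\in\mathbb{C}$), set $\sigma_c(D):=\inf\{r\in\mathbb{R}:\sum_n a_n\frac1{n^s}\text{ converges in }X\text{ for all } s \text{ with }\operatorname{Re}s>r\}$ and $\sigma_a(D):=\inf\{r\in\mathbb{R}:\sum_n \|a_n\|\,|n^{-s}|<+\infty\text{ for all } s \text{ with }\operatorname{Re}s>r\}$, infima being taken in the extended real line. For $x'\in X'$, $x'(D):=\sum_n x'(a_n)\frac1{n^s}$ is a scalar Dirichlet series, and $\sigma_a^w(D):=\sup_{x'\in X'}\sigma_a(x'(D))$. The gap for absolute convergence of Dirichlet series in $X$ is $G_a(X):=\sup_D(\sigma_a(D)-\sigma_a^w(D))$, the supremum being over all Dirichlet series $D$ with coefficients in $X$ such that $\sigma_c(D)<+\infty$ (convention: the difference is taken to be $0$ when both abscissas are $-\infty$). *)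

theory Defs
  imports "HOL-Analysis.Analysis"
begin

section \<open>Complex Banach spaces\<close>

class complex_normed_vector = real_normed_vector +
  fixes scaleC :: "complex \<Rightarrow> 'a \<Rightarrow> 'a"  (infixr \<open>*\<^sub>C\<close> 75)
  assumes scaleC_add_right: "c *\<^sub>C (x + y) = c *\<^sub>C x + c *\<^sub>C y"
    and scaleC_add_left: "(c + d) *\<^sub>C x = c *\<^sub>C x + d *\<^sub>C x"
    and scaleC_scaleC: "c *\<^sub>C d *\<^sub>C x = (c * d) *\<^sub>C x"
    and scaleR_scaleC: "r *\<^sub>R x = complex_of_real r *\<^sub>C x"
    and norm_scaleC: "norm (c *\<^sub>C x) = cmod c * norm x"
begin

lemma scaleC_one: "1 *\<^sub>C x = x"
  using scaleR_scaleC[of 1 x, symmetric] by (simp only: of_real_1 scaleR_one)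

end

class complex_banach = complex_normed_vector + complete_space

subclass (in complex_banach) banach ..

interpretation cvec: vector_space "scaleC :: complex \<Rightarrow> 'a \<Rightarrow> 'a::complex_normed_vector"
  by unfold_locales
    (simp_all add: scaleC_add_right scaleC_add_left scaleC_scaleC scaleC_one)

instantiation complex :: complex_banach
begin

definition scaleC_complex :: "complex \<Rightarrow> complex \<Rightarrow> complex" where
  "scaleC_complex c x = c * x"

instance
  by standard (auto simp: scaleC_complex_def algebra_simps norm_mult scaleR_conv_of_real)

end

lemma bounded_linear_scaleC: "bounded_linear (\<lambda>x::'a::complex_normed_vector. c *\<^sub>C x)"
proof (rule bounded_linear_intro[where K = "cmod c"])
  show "c *\<^sub>C (r *\<^sub>R x) = r *\<^sub>R (c *\<^sub>C x)" for r and x :: 'a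
    by (simp add: scaleR_scaleC scaleC_scaleC mult.commute)
qed (simp_all add: scaleC_add_right norm_scaleC)

lemma bcontfun_scaleC:
  assumes "f \<in> bcontfun"
  shows "(\<lambda>x. c *\<^sub>C (f x :: 'b::complex_normed_vector)) \<in> bcontfun"
proof -
  have "bounded ((\<lambda>x. c *\<^sub>C x) ` range f)"
    using assms bounded_linear_image[OF _ bounded_linear_scaleC] by (auto simp: bcontfun_def)
  then show ?thesis
    using assms bounded_linear.continuous_on[OF bounded_linear_scaleC]
    by (auto simp: bcontfun_def image_image)
qed

instantiation bcontfun :: (topological_space, complex_normed_vector) complex_normed_vector
begin

definition scaleC_bcontfun :: "complex \<Rightarrow> ('a \<Rightarrow>\<^sub>C 'b) \<Rightarrow> 'a \<Rightarrow>\<^sub>C 'b" where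
  "scaleC_bcontfun c f = Bcontfun (\<lambda>x. c *\<^sub>C apply_bcontfun f x)"

lemma apply_bcontfun_scaleC:
  "apply_bcontfun (c *\<^sub>C f) x = c *\<^sub>C apply_bcontfun f x" for f :: "'a \<Rightarrow>\<^sub>C 'b"
  unfolding scaleC_bcontfun_def
  by (subst Bcontfun_inverse) (simp_all add: bcontfun_scaleC apply_bcontfun)

instance
proof
  fix c d :: complex and r :: real and f g :: "'a \<Rightarrow>\<^sub>C 'b"
  show "c *\<^sub>C (f + g) = c *\<^sub>C f + c *\<^sub>C g"
    by (rule bcontfun_eqI) (simp add: apply_bcontfun_scaleC plus_bcontfun.rep_eq scaleC_add_right)
  show "(c + d) *\<^sub>C f = c *\<^sub>C f + d *\<^sub>C f"
    by (rule bcontfun_eqI) (simp add: apply_bcontfun_scaleC plus_bcontfun.rep_eq scaleC_add_left)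
  show "c *\<^sub>C d *\<^sub>C f = (c * d) *\<^sub>C f"
    by (rule bcontfun_eqI) (simp add: apply_bcontfun_scaleC scaleC_scaleC)
  show "r *\<^sub>R f = complex_of_real r *\<^sub>C f"
    by (rule bcontfun_eqI) (simp add: apply_bcontfun_scaleC scaleR_bcontfun.rep_eq scaleR_scaleC)
  have le: "norm (k *\<^sub>C h) \<le> cmod k * norm h" for k and h :: "'a \<Rightarrow>\<^sub>C 'b"
    by (rule norm_bound)
      (simp add: apply_bcontfun_scaleC norm_scaleC mult_left_mono norm_bounded)
  show "norm (c *\<^sub>C f) = cmod c * norm f"
  proof (cases "c = 0")
    case True
    then show ?thesis using le[of 0 f] by simp
  next
    case False
    have "inverse c *\<^sub>C c *\<^sub>C f = f"
      using False by (intro bcontfun_eqI) (simp add: apply_bcontfun_scaleC scaleC_scaleC scaleC_one)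
    then have "norm f \<le> cmod (inverse c) * norm (c *\<^sub>C f)"
      using le[of "inverse c" "c *\<^sub>C f"] by simp
    then have "cmod c * norm f \<le> norm (c *\<^sub>C f)"
      using False by (simp add: norm_inverse norm_divide field_simps)
    with le[of c f] show ?thesis by simp
  qed
qed

end

section \<open>Subspaces and operators\<close>

definition fin_dim_subspace :: "'a::complex_normed_vector set \<Rightarrow> bool" where
  "fin_dim_subspace E \<longleftrightarrow> (\<exists>B. finite B \<and> cvec.span B = E)"

definition bounded_clinear :: "('a::complex_normed_vector \<Rightarrow> 'b::complex_normed_vector) \<Rightarrow> bool" where
  "bounded_clinear T \<longleftrightarrow> bounded_linear T \<and> (\<forall>c x. T (c *\<^sub>C x) = c *\<^sub>C T x)"

definition dual :: "('a::complex_normed_vector \<Rightarrow> complex) set" where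
  "dual = {f. bounded_clinear f}"

definition lin_iso_on ::
  "'a::complex_normed_vector set \<Rightarrow> 'b::complex_normed_vector set \<Rightarrow> ('a \<Rightarrow> 'b) \<Rightarrow> bool" where
  "lin_iso_on E F T \<longleftrightarrow>
     (\<forall>x\<in>E. \<forall>y\<in>E. T (x + y) = T x + T y) \<and>
     (\<forall>c. \<forall>x\<in>E. T (c *\<^sub>C x) = c *\<^sub>C T x) \<and>
     bij_betw T E F"

text \<open>Operator norm of a map defined on a subspace \<open>E\<close>. It is a real supremum, hence
  meaningful for bounded maps only; below it is used on finite dimensional subspaces.\<close>

definition onorm_on :: "'a::complex_normed_vector set \<Rightarrow> ('a \<Rightarrow> 'b::complex_normed_vector) \<Rightarrow> real" where
  "onorm_on E T = (SUP x\<in>{x\<in>E. norm x \<le> 1}. norm (T x))"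

definition distortion_on :: "'a::complex_normed_vector set \<Rightarrow> 'b::complex_normed_vector set \<Rightarrow> ('a \<Rightarrow> 'b) \<Rightarrow> real" where
  "distortion_on E F T = onorm_on E T * onorm_on F (inv_into E T)"

text \<open>Since \<open>nat\<close> carries the discrete topology, \<open>nat \<Rightarrow>\<^sub>C complex\<close> is the
  space of all bounded complex sequences with the supremum norm. The space of \<open>n\<close>-tuples with
  the maximum norm is identified with the sequences supported in \<open>{..<n}\<close>.\<close>

type_synonym linfty = "nat \<Rightarrow>\<^sub>C complex"

definition linfty_n :: "nat \<Rightarrow> linfty set" where
  "linfty_n n = {x. \<forall>i\<ge>n. apply_bcontfun x i = 0}"

section \<open>Geometric properties of a Banach space\<close>

text \<open>Indexed so that \<open>n = 1, 2, \<dots>\<close> gives the Rademacher functions.\<close>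

definition rademacher :: "nat \<Rightarrow> real \<Rightarrow> real" where
  "rademacher n t = sgn (sin (2 ^ n * pi * t))"

definition has_cotype :: "real \<Rightarrow> 'a::complex_banach itself \<Rightarrow> bool" where
  "has_cotype p _ \<longleftrightarrow>
     (\<exists>C>0. \<forall>N. \<forall>x::nat \<Rightarrow> 'a.
        (\<Sum>n=1..N. norm (x n) powr p) powr (1 / p)
        \<le> C * sqrt (LINT t:{0..1}|lborel. (norm (\<Sum>n=1..N. rademacher n t *\<^sub>R x n))\<^sup>2))"

definition contains_linfty_n_uniformly :: "real \<Rightarrow> 'a::complex_banach itself \<Rightarrow> bool" where
  "contains_linfty_n_uniformly K _ \<longleftrightarrow>
     (\<forall>n. \<exists>(E::'a set) v. fin_dim_subspace E \<and> cvec.dim E = n \<and>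
        lin_iso_on (linfty_n n) E v \<and> distortion_on (linfty_n n) E v \<le> K)"

definition p1_summing :: "real \<Rightarrow> ('a::complex_banach \<Rightarrow> 'b::complex_banach) \<Rightarrow> bool" where
  "p1_summing p T \<longleftrightarrow> bounded_clinear T \<and>
     (\<exists>c>0. \<forall>n. \<forall>x::nat \<Rightarrow> 'a.
        (\<Sum>i=1..n. norm (T (x i)) powr p) powr (1 / p)
        \<le> c * (SUP f\<in>{f\<in>dual. onorm f \<le> 1}. \<Sum>i=1..n. cmod (f (x i))))"

definition finitely_representable ::
  "'z::complex_normed_vector itself \<Rightarrow> 'a::complex_banach itself \<Rightarrow> bool" where
  "finitely_representable _ _ \<longleftrightarrow>
     (\<forall>E::'z set. fin_dim_subspace E \<longrightarrow>
        (\<forall>\<epsilon>>0. \<exists>(F::'a set) T. fin_dim_subspace F \<and> lin_iso_on E F T \<and>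
           distortion_on E F T < 1 + \<epsilon>))"

section \<open>Dirichlet series\<close>

text \<open>A Dirichlet series is given by its coefficients \<open>a 1, a 2, \<dots>\<close>; the value \<open>a 0\<close> is never used.\<close>

definition abscissa_conv :: "(nat \<Rightarrow> 'a::complex_banach) \<Rightarrow> ereal" where
  "abscissa_conv a = Inf (ereal ` {r. \<forall>s. Re s > r \<longrightarrow>
     summable (\<lambda>n. (1 / of_nat (Suc n) powr s) *\<^sub>C a (Suc n))})"

definition abscissa_abs_conv :: "(nat \<Rightarrow> 'a::complex_banach) \<Rightarrow> ereal" where
  "abscissa_abs_conv a = Inf (ereal ` {r. \<forall>s. Re s > r \<longrightarrow>
     summable (\<lambda>n. norm (a (Suc n)) * cmod (1 / of_nat (Suc n) powr s))})"

definition weak_abscissa_abs_conv :: "(nat \<Rightarrow> 'a::complex_banach) \<Rightarrow> ereal" where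
  "weak_abscissa_abs_conv a = (SUP f\<in>dual. abscissa_abs_conv (\<lambda>n. f (a n)))"

text \<open>The case distinction is needed because \<open>- \<infinity> - (- \<infinity>) = \<infinity>\<close> in \<open>ereal\<close>.\<close>

definition abs_conv_gap_of :: "(nat \<Rightarrow> 'a::complex_banach) \<Rightarrow> ereal" where
  "abs_conv_gap_of a =
     (if abscissa_abs_conv a = - \<infinity> \<and> weak_abscissa_abs_conv a = - \<infinity> then 0
      else abscissa_abs_conv a - weak_abscissa_abs_conv a)"

definition abs_conv_gap :: "'a::complex_banach itself \<Rightarrow> ereal" where
  "abs_conv_gap _ = (SUP a\<in>{a::nat \<Rightarrow> 'a. abscissa_conv a < \<infinity>}. abs_conv_gap_of a)"

end

theory Submission
  imports Defs
begin

text \<open>The heart of the matter is that failure of finite cotype produces almost isometric copies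
  of the finite dimensional sup norm spaces. Average over independent uniformly distributed
  \<open>m\<close>-th roots of unity \<open>\<omega>\<close> (with \<open>m\<close> even) and consider, for fixed \<open>n\<close>, the
  best constant \<open>c\<close> for which the mean of \<open>(norm (y i))\<^sup>2\<close> over \<open>i < n\<close> is at most \<open>c\<^sup>2\<close> times the
  average of \<open>(norm (\<Sum>i<n. \<omega> i *\<^sub>C y i))\<^sup>2\<close>. Always \<open>c \<le> 1\<close>, and the constants are
  submultiplicative in \<open>n\<close>. If \<open>c < 1\<close> for some \<open>n\<close>, iteration bounds the number of large
  vectors by a power of \<open>n\<close> and gives cotype \<open>p\<close> for large \<open>p\<close>. If \<open>c = 1\<close> for all \<open>n\<close>, then
  normalised near-extremal vectors have norm almost \<open>1\<close>, and the norm of \<open>\<Sum>i<n. \<omega> i *\<^sub>C y i\<close> has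
  almost no variance, so it is almost \<open>1\<close> for every choice of \<open>\<omega>\<close>; letting \<open>m\<close> grow, convexity
  gives the upper estimate for arbitrary coefficients, and flipping signs gives the lower one.
  This makes James' distortion argument unnecessary.

  Conversely, copies of sup norm spaces rule out \<open>(p,1)\<close>-summability of the identity, which is
  implied by cotype \<open>p\<close>. A weakly absolutely summable sequence is uniformly so on the dual unit
  ball; hence the gap is at most \<open>1\<close>, and by Young's inequality at most \<open>1 - 1/p\<close> if the
  identity is \<open>(p,1)\<close>-summing. Placing sup norm bases on the dyadic blocks of a Dirichlet
  series attains gap \<open>1\<close>.\<close>

section \<open>The Hahn-Banach theorem\<close>

definition sublinear :: "('a::real_vector \<Rightarrow> real) \<Rightarrow> bool" where
  "sublinear q \<longleftrightarrow> (\<forall>x y. q (x + y) \<le> q x + q y) \<and> (\<forall>t>0. \<forall>x. q (t *\<^sub>R x) = t * q x)"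

lemma sublinear_add: "sublinear q \<Longrightarrow> q (x + y) \<le> q x + q y"
  and sublinear_scale: "sublinear q \<Longrightarrow> t > 0 \<Longrightarrow> q (t *\<^sub>R x) = t * q x"
  by (auto simp: sublinear_def)

lemma sublinear_zero:
  assumes "sublinear q"
  shows "q 0 = 0"
  using sublinear_scale[OF assms, of 2 0] by simp

lemma sublinear_minus:
  assumes "sublinear q"
  shows "- q (- x) \<le> q x"
  using sublinear_add[OF assms, of x "- x"] sublinear_zero[OF assms] by simp

lemma sublinear_norm: "sublinear (norm :: 'a::real_normed_vector \<Rightarrow> real)"
  by (auto simp: sublinear_def norm_triangle_ineq)

text \<open>A minimal sublinear functional \<open>m\<close> equals all its relaxations, so
  \<open>m x \<le> m (x + y) - m y\<close>, which makes it additive.\<close>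

definition relax :: "('a::real_vector \<Rightarrow> real) \<Rightarrow> 'a \<Rightarrow> 'a \<Rightarrow> real" where
  "relax q y x = (INF t\<in>{0..}. q (x + t *\<^sub>R y) - t * q y)"

text \<open>An infimum of reals is meaningful only over a set that is bounded below. Writing
  \<open>t *\<^sub>R y\<close> as \<open>(x + t *\<^sub>R y) + (- x)\<close> and using subadditivity
  gives a bound independent of \<open>t\<close>.\<close>

lemma relax_bdd_below:
  assumes "sublinear q"
  shows "bdd_below ((\<lambda>t. q (x + t *\<^sub>R y) - t * q y) ` {0..})"
proof (rule bdd_belowI2[where m = "- q (- x)"])
  fix t :: real assume "t \<in> {0..}"
  then have "t * q y = q (t *\<^sub>R y)"
    using sublinear_scale[OF assms, of t y] sublinear_zero[OF assms] by (cases "t = 0") auto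
  moreover have "q (t *\<^sub>R y) \<le> q (x + t *\<^sub>R y) + q (- x)"
    using sublinear_add[OF assms, of "x + t *\<^sub>R y" "- x"] by simp
  ultimately show "- q (- x) \<le> q (x + t *\<^sub>R y) - t * q y" by simp
qed

lemma relax_le:
  assumes "sublinear q" "t \<ge> 0"
  shows "relax q y x \<le> q (x + t *\<^sub>R y) - t * q y"
  unfolding relax_def using assms by (intro cINF_lower relax_bdd_below) auto

lemma relax_greatest:
  assumes "\<And>t. t \<ge> 0 \<Longrightarrow> c \<le> q (x + t *\<^sub>R y) - t * q y"
  shows "c \<le> relax q y x"
  unfolding relax_def using assms by (intro cINF_greatest) auto

text \<open>Parameters \<open>s\<close> and \<open>t\<close> that are good for \<open>x\<close> and
  \<open>z\<close> give the parameter \<open>s + t\<close> for \<open>x + z\<close>, and scaling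
  \<open>x\<close> by \<open>c\<close> scales the parameter by \<open>c\<close>. The reverse
  inequality for scaling is the same one applied with \<open>1 / c\<close>.\<close>

lemma sublinear_relax:
  assumes "sublinear q"
  shows "sublinear (relax q y)"
proof -
  have "relax q y (x + z) \<le> relax q y x + relax q y z" for x z
  proof -
    have "relax q y (x + z) - (q (z + t *\<^sub>R y) - t * q y) \<le> relax q y x" if "t \<ge> 0" for t
    proof (rule relax_greatest)
      fix s :: real assume "s \<ge> 0"
      with that have "relax q y (x + z) \<le> q ((x + z) + (s + t) *\<^sub>R y) - (s + t) * q y"
        by (intro relax_le assms) auto
      also have "(x + z) + (s + t) *\<^sub>R y = (x + s *\<^sub>R y) + (z + t *\<^sub>R y)"
        by (simp add: algebra_simps)
      also have "q \<dots> \<le> q (x + s *\<^sub>R y) + q (z + t *\<^sub>R y)"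
        by (rule sublinear_add[OF assms])
      finally show "relax q y (x + z) - (q (z + t *\<^sub>R y) - t * q y) \<le> q (x + s *\<^sub>R y) - s * q y"
        by (simp add: algebra_simps)
    qed
    then have "relax q y (x + z) - relax q y x \<le> relax q y z"
      by (intro relax_greatest) (simp add: algebra_simps)
    then show ?thesis by simp
  qed
  moreover have *: "relax q y (c *\<^sub>R x) \<le> c * relax q y x" if "c > 0" for c x
  proof -
    have "relax q y (c *\<^sub>R x) / c \<le> relax q y x"
    proof (rule relax_greatest)
      fix t :: real assume "t \<ge> 0"
      with that have "relax q y (c *\<^sub>R x) \<le> q (c *\<^sub>R x + (c * t) *\<^sub>R y) - (c * t) * q y"
        by (intro relax_le assms) auto
      also have "c *\<^sub>R x + (c * t) *\<^sub>R y = c *\<^sub>R (x + t *\<^sub>R y)"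
        by (simp add: algebra_simps)
      finally show "relax q y (c *\<^sub>R x) / c \<le> q (x + t *\<^sub>R y) - t * q y"
        using that unfolding sublinear_scale[OF assms that] by (simp add: field_simps)
    qed
    then show ?thesis using that by (simp add: field_simps)
  qed
  moreover have "c * relax q y x \<le> relax q y (c *\<^sub>R x)" if "c > 0" for c x
    using *[of "1 / c" "c *\<^sub>R x"] that by (simp add: field_simps)
  ultimately show ?thesis
    unfolding sublinear_def by (meson antisym)
qed

text \<open>Zorn's lemma for the reversed pointwise order: the pointwise infimum of a nonempty chain
  is a lower bound, finite because every member dominates \<open>- p (- x)\<close>.\<close>

lemma exists_minimal_sublinear:
  fixes p :: "'a::real_vector \<Rightarrow> real"
  assumes p: "sublinear p"
  shows "\<exists>m. sublinear m \<and> m \<le> p \<and> (\<forall>q. sublinear q \<longrightarrow> q \<le> m \<longrightarrow> q = m)"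
proof -
  let ?A = "{q. sublinear q \<and> q \<le> p}"
  let ?P = "\<lambda>a b :: 'a \<Rightarrow> real. b \<le> a"
  have "\<exists>m\<in>?A. \<forall>a\<in>?A. ?P m a \<longrightarrow> a = m"
  proof (rule predicate_Zorn)
    show "partial_order_on ?A (relation_of ?P ?A)"
      by (rule partial_order_on_relation_ofI) auto
  next
    fix C assume C: "C \<in> Chains (relation_of ?P ?A)"
    then have CA: "C \<subseteq> ?A" and tot: "\<And>a b. a \<in> C \<Longrightarrow> b \<in> C \<Longrightarrow> a \<le> b \<or> b \<le> a"
      unfolding Chains_def relation_of_def by auto
    show "\<exists>u\<in>?A. \<forall>a\<in>C. ?P a u"
    proof (cases "C = {}")
      case True
      then show ?thesis using p by auto
    next
      case False
      define u where "u x = (INF q\<in>C. q x)" for x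
      have "- p (- x) \<le> q x" if "q \<in> C" for q x
      proof -
        have "sublinear q" "q (- x) \<le> p (- x)" using that CA by (auto simp: le_fun_def)
        then show ?thesis using sublinear_minus[of q x] by linarith
      qed
      then have bdd: "bdd_below ((\<lambda>q. q x) ` C)" for x
        by (intro bdd_belowI2[where m = "- p (- x)"])
      have le: "u x \<le> q x" if "q \<in> C" for q x
        unfolding u_def using that bdd by (intro cINF_lower)
      have great: "c \<le> u x" if "\<And>q. q \<in> C \<Longrightarrow> c \<le> q x" for c x
        unfolding u_def using that False by (intro cINF_greatest)
      have sub: "sublinear q" if "q \<in> C" for q using CA that by auto
      have "u (x + y) \<le> u x + u y" for x y
      proof -
        \<comment> \<open>Of two members of a chain the smaller one serves for both summands;
          without comparability an infimum of sublinear maps need not be subadditive.\<close>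
        have "u (x + y) - q y \<le> r x" if "q \<in> C" "r \<in> C" for q r
          using tot[OF that]
        proof
          assume "q \<le> r"
          then have "q x \<le> r x" by (simp add: le_fun_def)
          then show ?thesis
            using le[OF that(1), of "x + y"] sublinear_add[OF sub[OF that(1)], of x y] by linarith
        next
          assume "r \<le> q"
          then have "r y \<le> q y" by (simp add: le_fun_def)
          then show ?thesis
            using le[OF that(2), of "x + y"] sublinear_add[OF sub[OF that(2)], of x y] by linarith
        qed
        then have "u (x + y) - q y \<le> u x" if "q \<in> C" for q
          using that by (intro great)
        then have "u (x + y) - u x \<le> u y"
          by (intro great) (simp add: algebra_simps)
        then show ?thesis by simp
      qed
      moreover have *: "t * u x \<le> u (t *\<^sub>R x)" if "t > 0" for t x
        using that by (intro great) (simp add: sublinear_scale[OF sub] le)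
      moreover have "u (t *\<^sub>R x) \<le> t * u x" if "t > 0" for t x
        using *[of "1 / t" "t *\<^sub>R x"] that by (simp add: field_simps)
      ultimately have "sublinear u"
        unfolding sublinear_def by (meson antisym)
      moreover obtain q where "q \<in> C" using False by auto
      then have "u \<le> q" "q \<le> p" using le CA by (auto simp: le_fun_def)
      then have "u \<le> p" by (rule order_trans)
      ultimately show ?thesis using le by (intro bexI[of _ u]) (auto simp: le_fun_def)
    qed
  qed
  then obtain m where m: "sublinear m" "m \<le> p"
      and min: "\<And>q. sublinear q \<Longrightarrow> q \<le> p \<Longrightarrow> q \<le> m \<Longrightarrow> q = m"
    by blast
  have "q = m" if "sublinear q" "q \<le> m" for q
    using min[OF that(1) order_trans[OF that(2) m(2)] that(2)] .
  with m show ?thesis by blast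
qed

lemma linear_minorant:
  fixes p :: "'a::real_vector \<Rightarrow> real"
  assumes p: "sublinear p"
  shows "\<exists>f. linear f \<and> f \<le> p"
proof -
  obtain m where m: "sublinear m" "m \<le> p" and min: "\<And>q. sublinear q \<Longrightarrow> q \<le> m \<Longrightarrow> q = m"
    using exists_minimal_sublinear[OF p] by blast
  have "relax m y = m" for y
  proof (rule min[OF sublinear_relax[OF m(1)]])
    show "relax m y \<le> m"
      using relax_le[OF m(1), of 0 y] by (simp add: le_fun_def)
  qed
  then have "m x \<le> m (x + y) - m y" for x y
    using relax_le[OF m(1), of 1 y x] by simp
  then have add: "m (x + y) = m x + m y" for x y
    using sublinear_add[OF m(1), of x y] by (smt (verit))
  have neg: "m (- x) = - m x" for x
    using add[of x "- x"] sublinear_zero[OF m(1)] by simp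
  have "m (t *\<^sub>R x) = t * m x" for t x
  proof (cases "t = 0")
    case True
    then show ?thesis by (simp add: sublinear_zero[OF m(1)])
  next
    case False
    then show ?thesis
      using sublinear_scale[OF m(1), of t x] sublinear_scale[OF m(1), of "- t" x] neg[of "t *\<^sub>R x"]
      by (cases "t > 0") auto
  qed
  then have "linear m" by (intro linearI) (auto simp: add)
  then show ?thesis using m by blast
qed

text \<open>The minorant is taken below \<open>relax norm a\<close> instead of \<open>norm\<close>:
  with parameter 1 the relaxation is at most \<open>- norm a\<close> at \<open>- a\<close>, which
  forces \<open>f a \<ge> norm a\<close>. No extension from a subspace is involved.\<close>

lemma real_hahn_banach:
  fixes a :: "'a::real_normed_vector"
  shows "\<exists>f. linear f \<and> (\<forall>x. f x \<le> norm x) \<and> f a = norm a"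
proof -
  obtain f where f: "linear f" "f \<le> relax norm a"
    using linear_minorant[OF sublinear_relax[OF sublinear_norm]] by blast
  have le: "f x \<le> norm x" for x
    using le_funD[OF f(2), of x] relax_le[OF sublinear_norm, of 0 a x] by simp
  have "f (- a) \<le> - norm a"
    using le_funD[OF f(2), of "- a"] relax_le[OF sublinear_norm, of 1 a "- a"] by simp
  then have "f a \<ge> norm a" by (simp add: linear_neg[OF f(1)])
  then show ?thesis using f(1) le[of a] le by (intro exI[of _ f]) auto
qed

section \<open>Complex functionals from real ones\<close>

lemma scaleC_minus_left: "(- c) *\<^sub>C x = - (c *\<^sub>C x :: 'a::complex_normed_vector)"
  by (rule cvec.scale_minus_left)

lemma scaleC_scaleR: "c *\<^sub>C (r *\<^sub>R x) = r *\<^sub>R (c *\<^sub>C x :: 'a::complex_normed_vector)"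
  by (simp add: scaleR_scaleC scaleC_scaleC mult.commute)

lemma scaleC_of_real: "complex_of_real r *\<^sub>C x = r *\<^sub>R (x :: 'a::complex_normed_vector)"
  by (simp add: scaleR_scaleC)

text \<open>For real linear \<open>f\<close> this is the unique complex linear functional with real
  part \<open>f\<close>.\<close>

definition complexify :: "('a::complex_normed_vector \<Rightarrow> real) \<Rightarrow> 'a \<Rightarrow> complex" where
  "complexify f x = Complex (f x) (- f (\<i> *\<^sub>C x))"

lemma complexify_scaleC:
  assumes "linear f"
  shows "complexify f (c *\<^sub>C x) = c * complexify f x"
proof -
  have split: "c *\<^sub>C x = Re c *\<^sub>R x + Im c *\<^sub>R (\<i> *\<^sub>C x)" for c and x :: 'a
  proof -
    have "c = complex_of_real (Re c) + complex_of_real (Im c) * \<i>"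
      by (simp add: complex_eq_iff)
    then have "c *\<^sub>C x = (complex_of_real (Re c) + complex_of_real (Im c) * \<i>) *\<^sub>C x"
      by (rule arg_cong)
    then show ?thesis
      unfolding scaleC_add_left scaleC_scaleC[symmetric] scaleC_of_real .
  qed
  have *: "f (c *\<^sub>C x) = Re c * f x + Im c * f (\<i> *\<^sub>C x)" for c x
    by (subst split) (simp add: linear_add[OF assms] linear_scale[OF assms])
  show ?thesis
    by (simp add: complexify_def complex_eq_iff scaleC_scaleC *[of c] *[of "\<i> * c"])
qed

lemma complexify_in_dual:
  fixes f :: "'a::complex_normed_vector \<Rightarrow> real"
  assumes f: "bounded_linear f"
  shows "complexify f \<in> dual"
proof -
  interpret bounded_linear f by fact
  obtain K where K: "\<And>x. norm (f x) \<le> norm x * K" using bounded by blast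
  have "bounded_linear (complexify f)"
  proof (rule bounded_linear_intro)
    show "complexify f (x + y) = complexify f x + complexify f y" for x y
      by (simp add: complexify_def complex_eq_iff scaleC_add_right add)
    show "complexify f (r *\<^sub>R x) = r *\<^sub>R complexify f x" for r x
      by (simp add: complexify_def complex_eq_iff scaleC_scaleR scale)
    fix x
    have "norm (complexify f x) \<le> \<bar>f x\<bar> + \<bar>f (\<i> *\<^sub>C x)\<bar>"
      using cmod_le[of "complexify f x"] by (simp add: complexify_def)
    also have "\<dots> \<le> norm x * K + norm x * K"
      using K[of x] K[of "\<i> *\<^sub>C x"] by (intro add_mono) (simp_all add: norm_scaleC)
    finally show "norm (complexify f x) \<le> norm x * (K + K)" by (simp add: algebra_simps)
  qed
  then show ?thesis
    using complexify_scaleC[OF linear]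
    by (auto simp: dual_def bounded_clinear_def scaleC_complex_def)
qed

lemma dualD:
  assumes "f \<in> dual"
  shows "bounded_linear f" "f (c *\<^sub>C x) = c * f x" "linear f"
  using assms by (auto simp: dual_def bounded_clinear_def scaleC_complex_def bounded_linear.linear)

lemma dual_unit_ball_le:
  assumes "f \<in> dual" "onorm f \<le> 1"
  shows "cmod (f x) \<le> norm x"
  using onorm[OF dualD(1)[OF assms(1)], of x] assms(2) mult_right_mono[of "onorm f" 1 "norm x"]
  by simp

text \<open>A real norming functional is complexified. At \<open>a\<close> its real part is already
  \<open>norm a\<close>, and its modulus cannot exceed \<open>norm a\<close>, so the imaginary part
  vanishes.\<close>

lemma hahn_banach:
  fixes a :: "'a::complex_normed_vector"
  shows "\<exists>f\<in>dual. onorm f \<le> 1 \<and> f a = complex_of_real (norm a)"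
proof -
  obtain f where f: "linear f" "\<And>x. f x \<le> norm x" "f a = norm a"
    using real_hahn_banach[of a] by blast
  have "\<bar>f x\<bar> \<le> norm x" for x
    using f(2)[of x] f(2)[of "- x"] linear_neg[OF f(1), of x] by simp
  then have "bounded_linear f"
    by (intro bounded_linear_intro[where K = 1]) (auto simp: linear_add[OF f(1)] linear_scale[OF f(1)])
  then have dual: "complexify f \<in> dual" by (rule complexify_in_dual)
  have le: "cmod (complexify f x) \<le> norm x" for x
  proof (cases "complexify f x = 0")
    case False
    \<comment> \<open>\<open>u\<close> rotates the value onto the positive real axis, where it
      equals its real part and is controlled by \<open>f\<close>.\<close>
    define u where "u = cnj (complexify f x) / cmod (complexify f x)"
    have "complex_of_real (cmod (complexify f x)) = complexify f (u *\<^sub>C x)"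
      using False unfolding complexify_scaleC[OF f(1)] u_def
      using complex_norm_square[of "complexify f x"] by (simp add: field_simps power2_eq_square)
    then have "cmod (complexify f x) = Re (complexify f (u *\<^sub>C x))"
      by (metis Re_complex_of_real)
    also have "\<dots> \<le> norm (u *\<^sub>C x)" by (simp add: complexify_def f)
    also have "\<dots> = norm x" using False by (simp add: norm_scaleC u_def norm_divide)
    finally show ?thesis .
  qed simp
  have "complexify f a = complex_of_real (norm a)"
  proof -
    have "Re (complexify f a) = norm a" by (simp add: complexify_def f)
    moreover have "Im (complexify f a) = 0"
    proof -
      have "(cmod (complexify f a))\<^sup>2 \<le> (norm a)\<^sup>2"
        using le[of a] by (intro power_mono) auto
      then have "(Im (complexify f a))\<^sup>2 \<le> 0"
        unfolding cmod_power2 calculation by simp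
      then show ?thesis by simp
    qed
    ultimately show ?thesis by (simp add: complex_eq_iff)
  qed
  moreover have "onorm (complexify f) \<le> 1"
    using le by (intro onorm_bound) auto
  ultimately show ?thesis using dual by blast
qed

section \<open>Uniform boundedness\<close>

text \<open>A Baire argument on the space of real bounded functionals, which is complete whether or
  not the space itself is: the sets of functionals whose sums are all at most \<open>M\<close> are
  closed and cover everything, so one of them contains a ball, and rescaling gives a uniform
  bound.\<close>

lemma uniform_boundedness_weakly_summable:
  fixes b :: "nat \<Rightarrow> 'a::complex_normed_vector"
  assumes sum: "\<And>f. f \<in> dual \<Longrightarrow> summable (\<lambda>n. cmod (f (b n)))"
  shows "\<exists>M. \<forall>f\<in>dual. onorm f \<le> 1 \<longrightarrow> (\<forall>N. (\<Sum>n<N. cmod (f (b n))) \<le> M)"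
proof -
  \<comment> \<open>The values at \<open>b n\<close> and \<open>\<i> *\<^sub>C b n\<close> are, up
    to sign, the real and imaginary parts of the complexified functional, so \<open>\<phi>\<close>
    is comparable to its sum of moduli.\<close>
  define \<phi> :: "nat \<Rightarrow> ('a \<Rightarrow>\<^sub>L real) \<Rightarrow> real" where
    "\<phi> N f = (\<Sum>n<N. \<bar>blinfun_apply f (b n)\<bar> + \<bar>blinfun_apply f (\<i> *\<^sub>C b n)\<bar>)" for N f
  have \<phi>_diff: "\<phi> N (f - g) \<le> \<phi> N f + \<phi> N g" for N f g
    unfolding \<phi>_def sum.distrib[symmetric] by (intro sum_mono) (simp add: blinfun.diff_left)
  have \<phi>_scale: "\<phi> N (r *\<^sub>R f) = \<bar>r\<bar> * \<phi> N f" for N f r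
    by (simp add: \<phi>_def blinfun.scaleR_left abs_mult sum_distrib_left algebra_simps)
  have ptw: "\<exists>M::nat. \<forall>N. \<phi> N f \<le> M" for f
  proof -
    define g where "g = complexify (blinfun_apply f)"
    have "summable (\<lambda>n. cmod (g (b n)))"
      unfolding g_def by (intro sum complexify_in_dual blinfun.bounded_linear_right)
    then have s: "summable (\<lambda>n. 2 * cmod (g (b n)))" by (rule summable_mult)
    have "\<phi> N f \<le> (\<Sum>n. 2 * cmod (g (b n)))" for N
    proof -
      have "\<phi> N f \<le> (\<Sum>n<N. 2 * cmod (g (b n)))"
        unfolding \<phi>_def
      proof (rule sum_mono)
        fix n
        show "\<bar>blinfun_apply f (b n)\<bar> + \<bar>blinfun_apply f (\<i> *\<^sub>C b n)\<bar> \<le> 2 * cmod (g (b n))"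
          using abs_Re_le_cmod[of "g (b n)"] abs_Im_le_cmod[of "g (b n)"]
          by (simp add: g_def complexify_def)
      qed
      also have "\<dots> \<le> (\<Sum>n. 2 * cmod (g (b n)))" by (rule sum_le_suminf[OF s]) auto
      finally show ?thesis .
    qed
    then show ?thesis by (meson order_trans real_arch_simple)
  qed
  define G where "G M = {f. \<forall>N. \<phi> N f \<le> real M}" for M :: nat
  have closed: "closed (G M)" for M
    unfolding G_def \<phi>_def
    by (intro closed_Collect_all closed_Collect_le continuous_intros)
  have "\<Union> (range G) = UNIV" using ptw by (auto simp: G_def)
  then have "euclidean interior_of \<Union> (range G) \<noteq> {}" by simp
  then have "\<exists>M. interior (G M) \<noteq> {}"
    using Baire_category_alt[of euclidean "range G"] closed
    by (force simp: completely_metrizable_space_euclidean)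
  then obtain M f0 e where e: "e > 0" "cball f0 e \<subseteq> G M"
    by (metis ex_in_conv mem_interior_cball)
  have "(\<Sum>n<N. cmod (g (b n))) \<le> 2 * real M / e" if g: "g \<in> dual" "onorm g \<le> 1" for g N
  proof -
    have "bounded_linear (\<lambda>x. Re (g x))"
      by (rule bounded_linear_compose[OF bounded_linear_Re dualD(1)[OF g(1)]])
    then have app: "blinfun_apply (Blinfun (\<lambda>x. Re (g x))) = (\<lambda>x. Re (g x))"
      by (rule bounded_linear_Blinfun_apply)
    define h where "h = Blinfun (\<lambda>x. Re (g x))"
    have "norm h \<le> 1"
    proof (rule norm_blinfun_bound)
      fix x
      show "norm (blinfun_apply h x) \<le> 1 * norm x"
        using abs_Re_le_cmod[of "g x"] dual_unit_ball_le[OF g, of x] by (simp add: h_def app)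
    qed simp
    \<comment> \<open>\<open>e *\<^sub>R h\<close> is the difference of these two points, each with
      sums at most \<open>M\<close>; hence the factor 2 in the bound.\<close>
    then have "f0 + e *\<^sub>R h \<in> cball f0 e" "f0 \<in> cball f0 e"
      using e(1) by (auto simp: dist_norm)
    then have "f0 + e *\<^sub>R h \<in> G M" "f0 \<in> G M" using e(2) by blast+
    then have "\<phi> N (f0 + e *\<^sub>R h) \<le> M" "\<phi> N f0 \<le> M" by (auto simp: G_def)
    then have "\<phi> N (e *\<^sub>R h) \<le> 2 * M"
      using \<phi>_diff[of N "f0 + e *\<^sub>R h" f0] by simp
    then have "\<phi> N h \<le> 2 * M / e" using e(1) by (simp add: \<phi>_scale field_simps)
    moreover have "(\<Sum>n<N. cmod (g (b n))) \<le> \<phi> N h"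
      unfolding \<phi>_def
    proof (rule sum_mono)
      fix n
      show "cmod (g (b n)) \<le> \<bar>blinfun_apply h (b n)\<bar> + \<bar>blinfun_apply h (\<i> *\<^sub>C b n)\<bar>"
        using cmod_le[of "g (b n)"] by (simp add: h_def app dualD(2)[OF g(1)])
    qed
    ultimately show ?thesis by linarith
  qed
  then show ?thesis by blast
qed

section \<open>Rademacher averages\<close>

text \<open>The mean of the squared norm of \<open>y\<close> plus the list entries with independent
  random signs. The offset \<open>y\<close> collects the entries whose signs are already fixed, so
  that inductions over the list go through.\<close>

fun ravg :: "'a::real_normed_vector list \<Rightarrow> 'a \<Rightarrow> real" where
  "ravg [] y = (norm y)\<^sup>2"
| "ravg (x # xs) y = (ravg xs (y + x) + ravg xs (y - x)) / 2"

lemma ravg_convex: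
  assumes "0 \<le> s" "s \<le> 1"
  shows "ravg xs ((1 - s) *\<^sub>R y + s *\<^sub>R z) \<le> (1 - s) * ravg xs y + s * ravg xs z"
proof (induction xs arbitrary: y z)
  case Nil
  have "norm ((1 - s) *\<^sub>R y + s *\<^sub>R z) \<le> (1 - s) * norm y + s * norm z"
    using norm_triangle_ineq[of "(1 - s) *\<^sub>R y" "s *\<^sub>R z"] assms by simp
  then have "(norm ((1 - s) *\<^sub>R y + s *\<^sub>R z))\<^sup>2 \<le> ((1 - s) * norm y + s * norm z)\<^sup>2"
    by (intro power_mono) auto
  also have "\<dots> = (1 - s) * (norm y)\<^sup>2 + s * (norm z)\<^sup>2 - s * (1 - s) * (norm y - norm z)\<^sup>2"
    by (simp add: power2_eq_square algebra_simps)
  also have "\<dots> \<le> (1 - s) * (norm y)\<^sup>2 + s * (norm z)\<^sup>2"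
    using assms by simp
  finally show ?case by simp
next
  case (Cons x xs)
  have "(1 - s) *\<^sub>R y + s *\<^sub>R z + x = (1 - s) *\<^sub>R (y + x) + s *\<^sub>R (z + x)"
       "(1 - s) *\<^sub>R y + s *\<^sub>R z - x = (1 - s) *\<^sub>R (y - x) + s *\<^sub>R (z - x)"
    by (simp_all add: algebra_simps)
  then have "2 * ravg (x # xs) ((1 - s) *\<^sub>R y + s *\<^sub>R z)
      \<le> ((1 - s) * ravg xs (y + x) + s * ravg xs (z + x)) + ((1 - s) * ravg xs (y - x) + s * ravg xs (z - x))"
    using Cons.IH[of "y + x" "z + x"] Cons.IH[of "y - x" "z - x"] by simp
  also have "\<dots> = 2 * ((1 - s) * ravg (x # xs) y + s * ravg (x # xs) z)"
    by (simp add: field_simps)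
  finally show ?case by simp
qed

text \<open>The contraction principle, one coefficient at a time: \<open>c n *\<^sub>R x n\<close>
  is a convex combination of \<open>x n\<close> and \<open>- x n\<close>. After adding the estimates
  for both signs, each of these two end points carries total weight 1.\<close>

lemma ravg_contraction:
  assumes "\<And>i. \<bar>c i\<bar> \<le> 1"
  shows "ravg (map (\<lambda>i. c i *\<^sub>R x i) ns) y \<le> ravg (map x ns) y"
proof (induction ns arbitrary: y)
  case (Cons n ns)
  let ?X = "ravg (map x ns)"
  define s where "s = (1 + c n) / 2"
  have s: "0 \<le> s" "s \<le> 1" using assms[of n] by (auto simp: s_def abs_le_iff)
  have c: "c n = 2 * s - 1" by (simp add: s_def field_simps)
  have eq: "y + c n *\<^sub>R x n = (1 - s) *\<^sub>R (y - x n) + s *\<^sub>R (y + x n)"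
       "y - c n *\<^sub>R x n = (1 - s) *\<^sub>R (y + x n) + s *\<^sub>R (y - x n)"
    by (simp_all add: c algebra_simps flip: scaleR_2)
  have "?X (y + c n *\<^sub>R x n) + ?X (y - c n *\<^sub>R x n)
      \<le> ((1 - s) * ?X (y - x n) + s * ?X (y + x n)) + ((1 - s) * ?X (y + x n) + s * ?X (y - x n))"
    unfolding eq by (intro add_mono ravg_convex s)
  also have "\<dots> = ?X (y + x n) + ?X (y - x n)" by (simp add: algebra_simps)
  finally have "?X (y + c n *\<^sub>R x n) + ?X (y - c n *\<^sub>R x n) \<le> ?X (y + x n) + ?X (y - x n)" .
  then show ?case
    using Cons.IH[of "y + c n *\<^sub>R x n"] Cons.IH[of "y - c n *\<^sub>R x n"] by simp
qed simp

lemma norm_add_square_le: "(norm (a + b))\<^sup>2 \<le> 2 * (norm a)\<^sup>2 + 2 * (norm b)\<^sup>2"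
proof -
  have "(norm (a + b))\<^sup>2 \<le> (norm a + norm b)\<^sup>2"
    by (intro power_mono norm_triangle_ineq) auto
  also have "\<dots> = 2 * (norm a)\<^sup>2 + 2 * (norm b)\<^sup>2 - (norm a - norm b)\<^sup>2"
    by (simp add: power2_eq_square algebra_simps)
  also have "\<dots> \<le> 2 * (norm a)\<^sup>2 + 2 * (norm b)\<^sup>2" by simp
  finally show ?thesis .
qed

lemma ravg_add:
  "ravg (map (\<lambda>i. f i + g i) ns) (y + z) \<le> 2 * ravg (map f ns) y + 2 * ravg (map g ns) z"
proof (induction ns arbitrary: y z)
  case Nil
  then show ?case using norm_add_square_le by simp
next
  case (Cons n ns)
  have eq: "y + z + (f n + g n) = (y + f n) + (z + g n)" "y + z - (f n + g n) = (y - f n) + (z - g n)"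
    by (simp_all add: algebra_simps)
  have arith: "a \<le> 2 * c + 2 * e \<Longrightarrow> b \<le> 2 * d + 2 * h \<Longrightarrow>
      (a + b) / 2 \<le> 2 * ((c + d) / 2) + 2 * ((e + h) / 2)" for a b c d e h :: real
    by (simp add: field_simps)
  show ?case
    unfolding list.map ravg.simps eq by (rule arith[OF Cons.IH Cons.IH])
qed

lemma ravg_scaleC_i:
  fixes g :: "'b \<Rightarrow> 'a::complex_normed_vector"
  shows "ravg (map (\<lambda>i. \<i> *\<^sub>C g i) ns) (\<i> *\<^sub>C z) = ravg (map g ns) z"
  by (induction ns arbitrary: z)
     (simp_all add: norm_scaleC flip: scaleC_add_right cvec.scale_right_diff_distrib)

text \<open>Splitting the coefficients into real and imaginary parts reduces this to the real
  contraction principle; separating the squared norms costs a factor 2 for each part, hence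
  4.\<close>

lemma complex_ravg_contraction:
  fixes x :: "'b \<Rightarrow> 'a::complex_normed_vector"
  assumes "\<And>i. cmod (c i) \<le> 1"
  shows "ravg (map (\<lambda>i. c i *\<^sub>C x i) ns) 0 \<le> 4 * ravg (map x ns) 0"
proof -
  have Re: "\<bar>Re (c i)\<bar> \<le> 1" and Im: "\<bar>Im (c i)\<bar> \<le> 1" for i
    using assms[of i] abs_Re_le_cmod[of "c i"] abs_Im_le_cmod[of "c i"] by linarith+
  have split: "c i *\<^sub>C x i = Re (c i) *\<^sub>R x i + \<i> *\<^sub>C (Im (c i) *\<^sub>R x i)" for i
  proof -
    have "c i = complex_of_real (Re (c i)) + \<i> * complex_of_real (Im (c i))"
      by (simp add: complex_eq_iff)
    then have "c i *\<^sub>C x i = (complex_of_real (Re (c i)) + \<i> * complex_of_real (Im (c i))) *\<^sub>C x i"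
      by (rule arg_cong)
    then show ?thesis
      unfolding scaleC_add_left scaleC_scaleC[symmetric] scaleC_of_real .
  qed
  have "ravg (map (\<lambda>i. Re (c i) *\<^sub>R x i + \<i> *\<^sub>C (Im (c i) *\<^sub>R x i)) ns) (0 + 0)
      \<le> 2 * ravg (map (\<lambda>i. Re (c i) *\<^sub>R x i) ns) 0 + 2 * ravg (map (\<lambda>i. \<i> *\<^sub>C (Im (c i) *\<^sub>R x i)) ns) 0"
    by (rule ravg_add)
  also have "ravg (map (\<lambda>i. \<i> *\<^sub>C (Im (c i) *\<^sub>R x i)) ns) 0 = ravg (map (\<lambda>i. Im (c i) *\<^sub>R x i) ns) 0"
    using ravg_scaleC_i[of "\<lambda>i. Im (c i) *\<^sub>R x i" ns 0] by simp
  finally show ?thesis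
    using ravg_contraction[of "\<lambda>i. Re (c i)" x ns 0, OF Re]
      ravg_contraction[of "\<lambda>i. Im (c i)" x ns 0, OF Im] by (simp flip: split)
qed

section \<open>Rademacher functions on the unit interval\<close>

lemma rademacher_double: "rademacher (Suc n) t = rademacher n (2 * t)"
  by (simp add: rademacher_def mult_ac)

lemma rademacher_periodic:
  assumes "n \<ge> 1"
  shows "rademacher n (t - 1) = rademacher n t"
proof -
  obtain k where n: "n = Suc k" using assms by (cases n) auto
  have "2 ^ n * pi * (t - 1) = 2 ^ n * pi * t - 2 * pi * of_int (2 ^ k)"
    by (simp add: n algebra_simps)
  then show ?thesis
    unfolding rademacher_def
    by (simp only: sin_diff sin_int_2pin cos_int_2pin mult_1_right mult_zero_right diff_zero)
qed

text \<open>Doubling the variable maps each half of the unit interval onto the whole one. Inside the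
  halves the first Rademacher function is \<open>1\<close> on the left and \<open>- 1\<close> on the
  right, and the later ones turn into the sequence from its start, which is the recursion of
  \<open>ravg\<close>.\<close>

lemma has_bochner_integral_rademacher:
  fixes x :: "nat \<Rightarrow> 'a::real_normed_vector"
  shows "has_bochner_integral lborel
    (\<lambda>t. indicator {0..1} t *\<^sub>R (norm (y + (\<Sum>n=1..N. rademacher n t *\<^sub>R x n)))\<^sup>2)
    (ravg (map x [1..<Suc N]) y)"
proof (induction N arbitrary: x y)
  case 0
  have "has_bochner_integral lborel (\<lambda>t. indicator {0..1::real} t *\<^sub>R (norm y)\<^sup>2)
    (measure lborel {0..1::real} *\<^sub>R (norm y)\<^sup>2)"
    by (intro has_bochner_integral_scaleR_left has_bochner_integral_real_indicator) auto
  then show ?case by simp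
next
  case (Suc N)
  define F where "F N x y t =
    indicator {0..1} t *\<^sub>R (norm (y + (\<Sum>n=1..N. rademacher n t *\<^sub>R x n)))\<^sup>2"
    for N and x :: "nat \<Rightarrow> 'a" and y t
  define x' where "x' n = x (Suc n)" for n
  have IH: "has_bochner_integral lborel (F N x' z) (ravg (map x' [1..<Suc N]) z)" for z
    unfolding F_def using Suc.IH[of z x'] by simp
  \<comment> \<open>The substitution contributes the factor 1/2 of the average in
    \<open>ravg\<close>; \<open>s = 0\<close> and \<open>s = - 1\<close> belong to the left and
    right halves.\<close>
  have scaled: "has_bochner_integral lborel (\<lambda>t. F N x' z (s + 2 * t)) (ravg (map x' [1..<Suc N]) z / 2)"
    for z s
    using IH[of z] lborel_has_bochner_integral_real_affine_iff[of 2 "F N x' z" _ s] by simp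
  have sum: "has_bochner_integral lborel
    (\<lambda>t. F N x' (y + x 1) (0 + 2 * t) + F N x' (y - x 1) (- 1 + 2 * t))
    (ravg (map x' [1..<Suc N]) (y + x 1) / 2 + ravg (map x' [1..<Suc N]) (y - x 1) / 2)"
    by (intro has_bochner_integral_add scaled)
  have map: "map x [1..<Suc (Suc N)] = x 1 # map x' [1..<Suc N]"
    by (simp add: upt_conv_Cons x'_def comp_def flip: map_Suc_upt del: upt_Suc)
  \<comment> \<open>At the three excluded points the first Rademacher function vanishes, and at
    \<open>1/2\<close> both shifted indicators are 1; the points form a null set.\<close>
  have eq: "F (Suc N) x y t = F N x' (y + x 1) (0 + 2 * t) + F N x' (y - x 1) (- 1 + 2 * t)"
    if t: "t \<notin> {0, 1/2, 1}" for t
  proof -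
    have s: "(\<Sum>n=1..Suc N. rademacher n t *\<^sub>R x n)
        = rademacher 1 t *\<^sub>R x 1 + (\<Sum>n=1..N. rademacher n (2 * t) *\<^sub>R x' n)"
      by (simp add: sum.atLeast_Suc_atMost sum.shift_bounds_cl_Suc_ivl rademacher_double x'_def
          del: sum.cl_ivl_Suc)
    have s': "(\<Sum>n=1..N. rademacher n (- 1 + 2 * t) *\<^sub>R x' n) = (\<Sum>n=1..N. rademacher n (2 * t) *\<^sub>R x' n)"
      using rademacher_periodic[of _ "2 * t"] by (intro sum.cong refl) (simp add: algebra_simps)
    consider "t < 0" | "0 < t" "t < 1/2" | "1/2 < t" "t < 1" | "1 < t"
      using t by fastforce
    then show ?thesis
    proof cases
      case 2
      then have "sin (2 * pi * t) > 0" by (intro sin_gt_zero) (auto simp: field_simps)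
      then have "rademacher 1 t = 1" by (simp add: rademacher_def)
      with 2 show ?thesis unfolding F_def s s' by (simp add: algebra_simps)
    next
      case 3
      have "sin (2 * pi * t) < 0"
        using 3 pi_gt_zero by (intro sin_lt_zero) (auto simp: field_simps)
      then have "rademacher 1 t = - 1" by (simp add: rademacher_def)
      with 3 show ?thesis unfolding F_def s s' by (simp add: algebra_simps)
    qed (auto simp: F_def)
  qed
  have "has_bochner_integral lborel (F (Suc N) x y)
      (ravg (map x' [1..<Suc N]) (y + x 1) / 2 + ravg (map x' [1..<Suc N]) (y - x 1) / 2)
    \<longleftrightarrow> has_bochner_integral lborel
      (\<lambda>t. F N x' (y + x 1) (0 + 2 * t) + F N x' (y - x 1) (- 1 + 2 * t))
      (ravg (map x' [1..<Suc N]) (y + x 1) / 2 + ravg (map x' [1..<Suc N]) (y - x 1) / 2)"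
    by (rule has_bochner_integral_discrete_difference[where X = "{0, 1/2, 1}"]) (use eq in auto)
  with sum show ?case
    unfolding map by (simp add: F_def[abs_def] add_divide_distrib del: sum.cl_ivl_Suc)
qed

lemma rademacher_integral:
  fixes x :: "nat \<Rightarrow> 'a::real_normed_vector"
  shows "(LINT t:{0..1}|lborel. (norm (\<Sum>n=1..N. rademacher n t *\<^sub>R x n))\<^sup>2) = ravg (map x [1..<Suc N]) 0"
  using has_bochner_integral_integral_eq[OF has_bochner_integral_rademacher[of 0 x N]]
  by (simp add: set_lebesgue_integral_def)

section \<open>Averages over roots of unity\<close>

definition unity_roots :: "nat \<Rightarrow> complex set" where
  "unity_roots m = {z. z ^ m = 1}"

text \<open>Roots of unity replace the full circle, so that every average is a finite sum over a
  finite group.\<close>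

definition uavg :: "nat \<Rightarrow> nat set \<Rightarrow> ((nat \<Rightarrow> complex) \<Rightarrow> real) \<Rightarrow> real" where
  "uavg m J g = (\<Sum>\<omega>\<in>PiE J (\<lambda>_. unity_roots m). g \<omega>) / card (PiE J (\<lambda>_. unity_roots m))"

lemma norm_unity_root: "m > 0 \<Longrightarrow> u \<in> unity_roots m \<Longrightarrow> cmod u = 1"
  using power_eq_1_iff[of u m] by (auto simp: unity_roots_def)

lemma unity_roots_mult: "u \<in> unity_roots m \<Longrightarrow> v \<in> unity_roots m \<Longrightarrow> u * v \<in> unity_roots m"
  by (auto simp: unity_roots_def power_mult_distrib)

lemma unity_roots_inverse: "u \<in> unity_roots m \<Longrightarrow> inverse u \<in> unity_roots m"
  by (auto simp: unity_roots_def power_inverse)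

lemma one_in_unity_roots [simp]: "1 \<in> unity_roots m"
  and minus_one_in_unity_roots [simp]: "even m \<Longrightarrow> - 1 \<in> unity_roots m"
  by (auto simp: unity_roots_def)

lemma finite_sign_space: "m > 0 \<Longrightarrow> finite J \<Longrightarrow> finite (PiE J (\<lambda>_. unity_roots m))"
  unfolding unity_roots_def by (intro finite_PiE finite_roots_unity) auto

lemma card_sign_space_pos: "m > 0 \<Longrightarrow> finite J \<Longrightarrow> card (PiE J (\<lambda>_. unity_roots m)) > 0"
  using finite_sign_space[of m J] by (auto simp: card_gt_0_iff PiE_eq_empty_iff intro: one_in_unity_roots)

lemma uavg_mono:
  assumes "\<And>\<omega>. \<omega> \<in> PiE J (\<lambda>_. unity_roots m) \<Longrightarrow> f \<omega> \<le> g \<omega>"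
  shows "uavg m J f \<le> uavg m J g"
  unfolding uavg_def by (intro divide_right_mono sum_mono assms) auto

lemma uavg_cong:
  assumes "\<And>\<omega>. \<omega> \<in> PiE J (\<lambda>_. unity_roots m) \<Longrightarrow> f \<omega> = g \<omega>"
  shows "uavg m J f = uavg m J g"
  unfolding uavg_def using assms by (auto intro: sum.cong)

lemma uavg_add: "uavg m J (\<lambda>\<omega>. f \<omega> + g \<omega>) = uavg m J f + uavg m J g"
  by (simp add: uavg_def sum.distrib add_divide_distrib)

lemma uavg_cmult: "uavg m J (\<lambda>\<omega>. c * f \<omega>) = c * uavg m J f"
  by (simp add: uavg_def sum_distrib_left)

lemma uavg_sum: "uavg m J (\<lambda>\<omega>. \<Sum>i\<in>A. f i \<omega>) = (\<Sum>i\<in>A. uavg m J (f i))"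
  by (simp add: uavg_def sum_divide_distrib sum.swap[of _ A])

lemma uavg_const: "m > 0 \<Longrightarrow> finite J \<Longrightarrow> uavg m J (\<lambda>_. c) = c"
  using card_sign_space_pos[of m J] by (simp add: uavg_def)

lemma uavg_swap: "uavg m J (\<lambda>\<omega>. uavg m K (f \<omega>)) = uavg m K (\<lambda>\<tau>. uavg m J (\<lambda>\<omega>. f \<omega> \<tau>))"
  unfolding uavg_def sum_divide_distrib[symmetric] by (subst sum.swap) (simp add: mult.commute)

lemma uavg_nonneg: "(\<And>\<omega>. f \<omega> \<ge> 0) \<Longrightarrow> uavg m J f \<ge> 0"
  unfolding uavg_def by (intro divide_nonneg_nonneg sum_nonneg) auto

text \<open>Multiplication by \<open>\<tau>\<close> permutes the finite group of sign patterns; this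
  is the invariance that Haar measure would provide.\<close>

lemma uavg_twist:
  assumes m: "m > 0" and \<tau>: "\<And>j. j \<in> J \<Longrightarrow> \<tau> j \<in> unity_roots m"
  shows "uavg m J (\<lambda>\<omega>. g (\<lambda>j\<in>J. \<tau> j * \<omega> j)) = uavg m J g"
proof -
  have ne: "\<tau> j \<noteq> 0" if "j \<in> J" for j using norm_unity_root[OF m \<tau>[OF that]] by auto
  have "bij_betw (\<lambda>\<omega>. \<lambda>j\<in>J. \<tau> j * \<omega> j) (PiE J (\<lambda>_. unity_roots m)) (PiE J (\<lambda>_. unity_roots m))"
  proof (rule bij_betwI[where g = "\<lambda>\<omega>. \<lambda>j\<in>J. inverse (\<tau> j) * \<omega> j"])
    show "(\<lambda>\<omega>. \<lambda>j\<in>J. \<tau> j * \<omega> j) \<in> PiE J (\<lambda>_. unity_roots m) \<rightarrow> PiE J (\<lambda>_. unity_roots m)"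
      using \<tau> by (auto intro!: unity_roots_mult)
    show "(\<lambda>\<omega>. \<lambda>j\<in>J. inverse (\<tau> j) * \<omega> j) \<in> PiE J (\<lambda>_. unity_roots m) \<rightarrow> PiE J (\<lambda>_. unity_roots m)"
      using \<tau> by (auto intro!: unity_roots_mult unity_roots_inverse)
  qed (use ne in \<open>auto simp: fun_eq_iff PiE_def extensional_def\<close>)
  then show ?thesis
    unfolding uavg_def by (subst sum.reindex_bij_betw[of _ _ _ g, symmetric]) auto
qed

abbreviation umean :: "nat \<Rightarrow> nat set \<Rightarrow> nat set \<Rightarrow> (nat \<Rightarrow> 'a::complex_normed_vector) \<Rightarrow> real" where
  "umean m J A x \<equiv> uavg m J (\<lambda>\<omega>. (norm (\<Sum>i\<in>A. \<omega> i *\<^sub>C x i))\<^sup>2)"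

lemma umean_twist:
  assumes "m > 0" "A \<subseteq> J" "\<And>j. j \<in> J \<Longrightarrow> \<tau> j \<in> unity_roots m"
  shows "uavg m J (\<lambda>\<omega>. (norm (\<Sum>i\<in>A. (\<tau> i * \<omega> i) *\<^sub>C x i))\<^sup>2) = umean m J A x"
proof -
  have "(\<Sum>i\<in>A. (\<tau> i * \<omega> i) *\<^sub>C x i) = (\<Sum>i\<in>A. (\<lambda>j\<in>J. \<tau> j * \<omega> j) i *\<^sub>C x i)" for \<omega>
    using assms(2) by (intro sum.cong) auto
  then show ?thesis
    using uavg_twist[OF assms(1,3), of J "\<lambda>j. j" "\<lambda>\<omega>. (norm (\<Sum>i\<in>A. \<omega> i *\<^sub>C x i))\<^sup>2"] assms(1,3)
    by (subst uavg_twist[of m J \<tau>, symmetric]) auto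
qed

text \<open>The sum over \<open>A\<close> is half the sum of \<open>?S\<close> and
  \<open>?T\<close>, where \<open>?T\<close> flips the signs outside \<open>A\<close>; both have the
  same mean. Evenness of \<open>m\<close> makes \<open>- 1\<close> a root of unity.\<close>

lemma umean_subset:
  assumes m: "m > 0" "even m" and A: "A \<subseteq> J" "finite J"
  shows "umean m J A x \<le> umean m J J x"
proof -
  define \<sigma> :: "nat \<Rightarrow> complex" where "\<sigma> i = (if i \<in> A then 1 else - 1)" for i
  let ?S = "\<lambda>\<omega>. \<Sum>i\<in>J. \<omega> i *\<^sub>C x i" and ?T = "\<lambda>\<omega>. \<Sum>i\<in>J. (\<sigma> i * \<omega> i) *\<^sub>C x i"
  have "(norm (\<Sum>i\<in>A. \<omega> i *\<^sub>C x i))\<^sup>2 \<le> 1/2 * (norm (?S \<omega>))\<^sup>2 + 1/2 * (norm (?T \<omega>))\<^sup>2" for \<omega>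
  proof -
    have "?S \<omega> + ?T \<omega> = (\<Sum>i\<in>J. if i \<in> A then 2 *\<^sub>R (\<omega> i *\<^sub>C x i) else 0)"
      unfolding sum.distrib[symmetric]
      by (intro sum.cong) (auto simp: \<sigma>_def scaleR_2 scaleC_minus_left)
    also have "\<dots> = 2 *\<^sub>R (\<Sum>i\<in>A. \<omega> i *\<^sub>C x i)"
      using A by (simp add: sum.If_cases scaleR_sum_right Int_absorb1)
    finally have "4 * (norm (\<Sum>i\<in>A. \<omega> i *\<^sub>C x i))\<^sup>2 = (norm (?S \<omega> + ?T \<omega>))\<^sup>2"
      by (simp add: power2_eq_square)
    also have "\<dots> \<le> 2 * (norm (?S \<omega>))\<^sup>2 + 2 * (norm (?T \<omega>))\<^sup>2"
      by (rule norm_add_square_le)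
    finally show ?thesis by simp
  qed
  then have "umean m J A x \<le> uavg m J (\<lambda>\<omega>. 1/2 * (norm (?S \<omega>))\<^sup>2 + 1/2 * (norm (?T \<omega>))\<^sup>2)"
    by (rule uavg_mono)
  also have "\<dots> = 1/2 * umean m J J x + 1/2 * uavg m J (\<lambda>\<omega>. (norm (?T \<omega>))\<^sup>2)"
    by (simp only: uavg_add uavg_cmult)
  also have "uavg m J (\<lambda>\<omega>. (norm (?T \<omega>))\<^sup>2) = umean m J J x"
    using m by (intro umean_twist) (auto simp: \<sigma>_def)
  finally show ?thesis by simp
qed

lemma umean_singleton:
  assumes "m > 0" "i \<in> J" "finite J"
  shows "umean m J {i} x = (norm (x i))\<^sup>2"
proof -
  have "umean m J {i} x = uavg m J (\<lambda>_. (norm (x i))\<^sup>2)"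
    using assms norm_unity_root[OF assms(1)]
    by (intro uavg_cong) (auto simp: norm_scaleC PiE_iff)
  then show ?thesis using assms by (simp add: uavg_const)
qed

lemma norm_le_umean:
  assumes "m > 0" "even m" "i \<in> J" "finite J"
  shows "(norm (x i))\<^sup>2 \<le> umean m J J x"
  using umean_subset[of m "{i}" J x] umean_singleton[of m i J x] assms by auto

text \<open>Means over roots of unity do not change under extra random signs. Introducing these and
  then fixing the roots leaves a Rademacher average with unimodular coefficients, which the
  contraction principle bounds.\<close>

lemma umean_le_ravg:
  fixes x :: "nat \<Rightarrow> 'a::complex_normed_vector"
  assumes m: "m > 0" "even m" and ns: "distinct ns"
  shows "umean m (set ns) (set ns) x \<le> 4 * ravg (map x ns) 0"
proof -
  let ?J = "set ns"
  \<comment> \<open>The coordinates in \<open>ks\<close> have received their extra signs; the others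
    still sit in the offset.\<close>
  have *: "uavg m ?J (\<lambda>\<omega>. ravg (map (\<lambda>i. \<omega> i *\<^sub>C x i) ks) (\<Sum>i\<in>?J - set ks. \<omega> i *\<^sub>C x i)) = umean m ?J ?J x"
    if "set ks \<subseteq> ?J" "distinct ks" for ks
    using that
  proof (induction ks)
    case (Cons k ks)
    define \<sigma> :: "nat \<Rightarrow> complex" where "\<sigma> i = (if i = k then - 1 else 1)" for i
    define y where "y \<omega> = (\<Sum>i\<in>?J - insert k (set ks). \<omega> i *\<^sub>C x i)" for \<omega>
    define g where "g \<omega> = ravg (map (\<lambda>i. \<omega> i *\<^sub>C x i) ks) (y \<omega> + \<omega> k *\<^sub>C x k)" for \<omega>
    have J: "?J - set ks = insert k (?J - insert k (set ks))" using Cons.prems by auto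
    have y: "(\<Sum>i\<in>?J - set ks. \<omega> i *\<^sub>C x i) = y \<omega> + \<omega> k *\<^sub>C x k" for \<omega>
      unfolding y_def by (subst J, subst sum.insert) (auto simp: add.commute)
    have gm: "ravg (map (\<lambda>i. \<omega> i *\<^sub>C x i) ks) (y \<omega> - \<omega> k *\<^sub>C x k) = g (\<lambda>j\<in>?J. \<sigma> j * \<omega> j)" for \<omega>
    proof -
      have mapeq: "map (\<lambda>i. (\<lambda>j\<in>?J. \<sigma> j * \<omega> j) i *\<^sub>C x i) ks = map (\<lambda>i. \<omega> i *\<^sub>C x i) ks"
        using Cons.prems by (auto simp: \<sigma>_def)
      have yeq: "y (\<lambda>j\<in>?J. \<sigma> j * \<omega> j) = y \<omega>"
        unfolding y_def by (intro sum.cong) (auto simp: \<sigma>_def)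
      show ?thesis
        using Cons.prems unfolding g_def mapeq yeq by (simp add: \<sigma>_def scaleC_minus_left)
    qed
    have "uavg m ?J (\<lambda>\<omega>. ravg (map (\<lambda>i. \<omega> i *\<^sub>C x i) (k # ks)) (\<Sum>i\<in>?J - set (k # ks). \<omega> i *\<^sub>C x i))
        = uavg m ?J (\<lambda>\<omega>. 1/2 * g \<omega> + 1/2 * g (\<lambda>j\<in>?J. \<sigma> j * \<omega> j))"
      using gm by (simp add: g_def y_def[symmetric] add_divide_distrib)
    also have "\<dots> = 1/2 * uavg m ?J g + 1/2 * uavg m ?J (\<lambda>\<omega>. g (\<lambda>j\<in>?J. \<sigma> j * \<omega> j))"
      by (simp only: uavg_add uavg_cmult)
    also have "uavg m ?J (\<lambda>\<omega>. g (\<lambda>j\<in>?J. \<sigma> j * \<omega> j)) = uavg m ?J g"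
      using m by (intro uavg_twist) (auto simp: \<sigma>_def)
    also have "1/2 * uavg m ?J g + 1/2 * uavg m ?J g = uavg m ?J g" by simp
    also have "\<dots> = umean m ?J ?J x"
      using Cons.IH Cons.prems by (simp add: g_def[abs_def] y)
    finally show ?case .
  qed simp
  have "umean m ?J ?J x = uavg m ?J (\<lambda>\<omega>. ravg (map (\<lambda>i. \<omega> i *\<^sub>C x i) ns) 0)"
    using *[of ns] ns by simp
  also have "\<dots> \<le> uavg m ?J (\<lambda>_. 4 * ravg (map x ns) 0)"
  proof (rule uavg_mono)
    fix \<omega> assume "\<omega> \<in> PiE ?J (\<lambda>_. unity_roots m)"
    \<comment> \<open>The cut-off makes the coefficients bounded at every index, since
      \<open>\<omega>\<close> is \<open>undefined\<close> outside \<open>?J\<close>.\<close>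
    then have "ravg (map (\<lambda>i. (if i \<in> ?J then \<omega> i else 0) *\<^sub>C x i) ns) 0 \<le> 4 * ravg (map x ns) 0"
      using norm_unity_root[OF m(1)] by (intro complex_ravg_contraction) (auto simp: PiE_iff)
    also have "map (\<lambda>i. (if i \<in> ?J then \<omega> i else 0) *\<^sub>C x i) ns = map (\<lambda>i. \<omega> i *\<^sub>C x i) ns"
      by simp
    finally show "ravg (map (\<lambda>i. \<omega> i *\<^sub>C x i) ns) 0 \<le> 4 * ravg (map x ns) 0" .
  qed
  also have "\<dots> = 4 * ravg (map x ns) 0" using m by (simp add: uavg_const)
  finally show ?thesis .
qed

section \<open>From a strict averaging inequality to cotype\<close>

definition mean_contraction :: "nat \<Rightarrow> nat \<Rightarrow> real \<Rightarrow> 'a::complex_normed_vector itself \<Rightarrow> bool" where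
  "mean_contraction m n c _ \<longleftrightarrow>
     (\<forall>y::nat \<Rightarrow> 'a. (\<Sum>b<n. (norm (y b))\<^sup>2) \<le> n * c\<^sup>2 * umean m {..<n} {..<n} y)"

lemma equal_partition:
  assumes "finite A" "card A = n * k" "k > 0"
  shows "\<exists>\<beta>. (\<forall>i\<in>A. \<beta> i < n) \<and> (\<forall>b<n. card {i \<in> A. \<beta> i = b} = k)"
proof -
  obtain h where h: "bij_betw h A {0..<n * k}"
    using ex_bij_betw_finite_nat[OF assms(1)] assms(2) by auto
  have "card {i \<in> A. h i div k = b} = k" if "b < n" for b
  proof -
    have "bij_betw h {i \<in> A. h i div k = b} {j \<in> {0..<n * k}. j div k = b}"
      using h by (rule bij_betw_Collect) auto
    moreover have "{j \<in> {0..<n * k}. j div k = b} = {b * k..<b * k + k}"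
    proof (intro equalityI subsetI)
      fix j assume "j \<in> {b * k..<b * k + k}"
      then have j: "b * k \<le> j" "j < b * k + k" by auto
      then have "j div k = b" by (intro div_nat_eqI) (simp_all add: mult.commute)
      moreover have "b * k + k \<le> n * k" using that by (metis Suc_leI add.commute mult_Suc mult_le_mono1)
      ultimately show "j \<in> {j \<in> {0..<n * k}. j div k = b}" using j by auto
    next
      fix j assume "j \<in> {j \<in> {0..<n * k}. j div k = b}"
      then have "j div k = b" by auto
      then show "j \<in> {b * k..<b * k + k}"
        using assms(3) dividend_less_div_times[of k j] by auto
    qed
    ultimately show ?thesis by (simp add: bij_betw_same_card)
  qed
  moreover have "h i div k < n" if "i \<in> A" for i
  proof -
    have "h i < n * k" using h that by (auto simp: bij_betw_def)
    then show ?thesis using assms(3) by (simp add: less_mult_imp_div_less)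
  qed
  ultimately show ?thesis by (intro exI[of _ "\<lambda>i. h i div k"]) auto
qed

text \<open>Induction by splitting \<open>A\<close> into \<open>n\<close> blocks of size
  \<open>n ^ k\<close>. The induction hypothesis bounds each block, and the contraction inequality
  is applied to the block sums, whose additional signs are absorbed by the twist invariance.\<close>

lemma mean_contraction_power:
  fixes x :: "nat \<Rightarrow> 'a::complex_normed_vector"
  assumes H: "mean_contraction m n c TYPE('a)" and m: "m > 0" and n: "n > 0"
    and J: "finite J" and A: "A \<subseteq> J" "card A = n ^ k"
  shows "(\<Sum>i\<in>A. (norm (x i))\<^sup>2) \<le> (n * c\<^sup>2) ^ k * umean m J A x"
  using A
proof (induction k arbitrary: A)
  case 0
  then obtain i where "A = {i}" "i \<in> J" by (auto simp: card_1_singleton_iff)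
  then show ?case using umean_singleton[of m i J x] m J by simp
next
  case (Suc k)
  let ?K = "(n * c\<^sup>2) ^ k"
  have fA: "finite A" using Suc.prems(1) J finite_subset by blast
  obtain \<beta> where \<beta>: "\<And>i. i \<in> A \<Longrightarrow> \<beta> i < n" "\<And>b. b < n \<Longrightarrow> card {i \<in> A. \<beta> i = b} = n ^ k"
    using equal_partition[OF fA, of n "n ^ k"] Suc.prems(2) n by auto
  define I where "I b = {i \<in> A. \<beta> i = b}" for b
  define y where "y b \<omega> = (\<Sum>i\<in>I b. \<omega> i *\<^sub>C x i)" for b \<omega>
  have group: "(\<Sum>b<n. \<Sum>i\<in>I b. g i) = (\<Sum>i\<in>A. g i)" for g :: "nat \<Rightarrow> 'b::comm_monoid_add"
    unfolding I_def using \<beta>(1) fA by (intro sum.group) auto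
  have inner: "uavg m J (\<lambda>\<omega>. (norm (\<Sum>b<n. \<tau> b *\<^sub>C y b \<omega>))\<^sup>2) = umean m J A x"
    if \<tau>: "\<tau> \<in> PiE {..<n} (\<lambda>_. unity_roots m)" for \<tau>
  proof -
    \<comment> \<open>One sign per block, spread over the indices of the block; the value 1 outside
      \<open>A\<close> is a placeholder root of unity.\<close>
    define \<sigma> where "\<sigma> i = (if i \<in> A then \<tau> (\<beta> i) else 1)" for i
    have "(\<Sum>b<n. \<tau> b *\<^sub>C y b \<omega>) = (\<Sum>i\<in>A. (\<sigma> i * \<omega> i) *\<^sub>C x i)" for \<omega>
    proof -
      have "(\<Sum>b<n. \<tau> b *\<^sub>C y b \<omega>) = (\<Sum>b<n. \<Sum>i\<in>I b. (\<sigma> i * \<omega> i) *\<^sub>C x i)"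
        unfolding y_def cvec.scale_sum_right
        by (intro sum.cong refl) (auto simp: I_def \<sigma>_def scaleC_scaleC)
      then show ?thesis by (simp add: group)
    qed
    moreover have "\<sigma> j \<in> unity_roots m" for j
      using \<tau> \<beta>(1) by (auto simp: \<sigma>_def PiE_iff)
    ultimately show ?thesis
      using umean_twist[of m A J \<sigma> x] m Suc.prems(1) by simp
  qed
  have "(\<Sum>i\<in>A. (norm (x i))\<^sup>2) = (\<Sum>b<n. \<Sum>i\<in>I b. (norm (x i))\<^sup>2)"
    by (simp add: group)
  also have "\<dots> \<le> (\<Sum>b<n. ?K * umean m J (I b) x)"
  proof (rule sum_mono)
    fix b assume "b \<in> {..<n}"
    then show "(\<Sum>i\<in>I b. (norm (x i))\<^sup>2) \<le> ?K * umean m J (I b) x"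
      using \<beta>(2)[of b] Suc.prems(1) by (intro Suc.IH) (auto simp: I_def)
  qed
  also have "\<dots> = ?K * uavg m J (\<lambda>\<omega>. \<Sum>b<n. (norm (y b \<omega>))\<^sup>2)"
    by (simp add: uavg_sum y_def sum_distrib_left)
  also have "\<dots> \<le> ?K * uavg m J (\<lambda>\<omega>. n * c\<^sup>2 * umean m {..<n} {..<n} (\<lambda>b. y b \<omega>))"
  proof (intro mult_left_mono uavg_mono)
    show "(\<Sum>b<n. (norm (y b \<omega>))\<^sup>2) \<le> n * c\<^sup>2 * umean m {..<n} {..<n} (\<lambda>b. y b \<omega>)" for \<omega>
      using H[unfolded mean_contraction_def, rule_format, of "\<lambda>b. y b \<omega>"] .
  qed simp
  also have "\<dots> = ?K * (n * c\<^sup>2) * uavg m J (\<lambda>\<omega>. umean m {..<n} {..<n} (\<lambda>b. y b \<omega>))"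
    by (simp only: uavg_cmult mult.assoc)
  also have "uavg m J (\<lambda>\<omega>. umean m {..<n} {..<n} (\<lambda>b. y b \<omega>))
      = uavg m {..<n} (\<lambda>\<tau>. uavg m J (\<lambda>\<omega>. (norm (\<Sum>b<n. \<tau> b *\<^sub>C y b \<omega>))\<^sup>2))"
    by (rule uavg_swap)
  also have "\<dots> = uavg m {..<n} (\<lambda>_. umean m J A x)"
    by (rule uavg_cong) (rule inner)
  also have "\<dots> = umean m J A x" using m by (simp add: uavg_const)
  finally show ?case by (simp add: mult.commute)
qed

text \<open>The squared norms of \<open>n ^ k\<close> vectors of norm above \<open>c ^ k\<close>
  would add up to more than \<open>(n * c\<^sup>2) ^ k\<close>, against the iterated
  inequality.\<close>

lemma card_large_less:
  fixes x :: "nat \<Rightarrow> 'a::complex_normed_vector"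
  assumes H: "mean_contraction m n c TYPE('a)" and m: "m > 0" "even m" and n: "n > 0" and c: "c > 0"
    and J: "finite J" and A: "A \<subseteq> J" and large: "\<And>i. i \<in> A \<Longrightarrow> c ^ k < norm (x i)"
    and mean: "umean m J J x \<le> 1"
  shows "card A < n ^ k"
proof (rule ccontr)
  assume "\<not> card A < n ^ k"
  then obtain B where B: "B \<subseteq> A" "card B = n ^ k"
    using obtain_subset_with_card_n[of "n ^ k" A] by (metis linorder_not_less)
  have fB: "finite B" using B(2) n by (simp add: card_ge_0_finite)
  have "(n * c\<^sup>2) ^ k = (\<Sum>i\<in>B. (c ^ k)\<^sup>2)"
    using B(2) by (simp add: power_mult_distrib power2_eq_square)
  also have "\<dots> < (\<Sum>i\<in>B. (norm (x i))\<^sup>2)"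
  proof (rule sum_strict_mono[OF fB])
    show "B \<noteq> {}" using B(2) n by auto
    show "(c ^ k)\<^sup>2 < (norm (x i))\<^sup>2" if "i \<in> B" for i
      using large[of i] that B(1) c by (intro power_strict_mono) auto
  qed
  also have "\<dots> \<le> (n * c\<^sup>2) ^ k * umean m J B x"
    using B A by (intro mean_contraction_power[OF H m(1) n J]) auto
  also have "\<dots> \<le> (n * c\<^sup>2) ^ k * 1"
  proof (intro mult_left_mono)
    show "umean m J B x \<le> 1"
      using umean_subset[OF m _ J, of B x] B A mean by (meson order_trans)
  qed simp
  finally show False by simp
qed

text \<open>The nonzero vectors are sorted by the powers of \<open>c\<close> between which their
  norms lie. Level \<open>k\<close> holds fewer than \<open>n ^ Suc k\<close> vectors, each
  contributing at most \<open>(c powr p) ^ k\<close>, so a geometric series of ratio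
  \<open>n * c powr p\<close> bounds the sum.\<close>

lemma sum_norm_powr_le:
  fixes x :: "nat \<Rightarrow> 'a::complex_normed_vector"
  assumes H: "mean_contraction m n c TYPE('a)" and m: "m > 0" "even m" and n: "n > 0"
    and c: "c > 0" "c < 1" and p: "p > 0" "n * c powr p < 1"
    and J: "finite J" and mean: "umean m J J x \<le> 1"
  shows "(\<Sum>i\<in>J. norm (x i) powr p) \<le> n / (1 - n * c powr p)"
proof -
  define P where "P = {i \<in> J. x i \<noteq> 0}"
  define lev where "lev i = (LEAST k. c ^ Suc k < norm (x i))" for i
  have fP: "finite P" using J by (simp add: P_def)
  have lower: "c ^ Suc (lev i) < norm (x i)" if "i \<in> P" for i
  proof -
    have "norm (x i) > 0" using that by (simp add: P_def)
    then obtain k where "c ^ k < norm (x i)"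
      using real_arch_pow_inv c(2) by blast
    moreover have "c ^ Suc k \<le> c ^ k" using c by (simp add: mult_le_cancel_right1)
    ultimately have "c ^ Suc k < norm (x i)" by linarith
    then show ?thesis unfolding lev_def by (rule LeastI)
  qed
  have upper: "norm (x i) \<le> c ^ lev i" if "i \<in> P" for i
  proof (cases "lev i")
    \<comment> \<open>Level 0 has no earlier level to compare with; here the normalised mean gives
      norm at most 1.\<close>
    case 0
    have "(norm (x i))\<^sup>2 \<le> 1\<^sup>2"
      using norm_le_umean[OF m, of i J x] mean that J by (simp add: P_def)
    then show ?thesis using 0 power2_le_imp_le[of "norm (x i)" 1] by simp
  next
    case (Suc k)
    then have "\<not> c ^ Suc k < norm (x i)"
      using not_less_Least[of k "\<lambda>k. c ^ Suc k < norm (x i)"] by (simp add: lev_def)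
    then show ?thesis using Suc by simp
  qed
  have card: "card {i \<in> P. lev i = k} \<le> n ^ Suc k" for k
  proof -
    have "card {i \<in> P. lev i = k} < n ^ Suc k"
    proof (rule card_large_less[OF H m n c(1) J _ _ mean])
      show "{i \<in> P. lev i = k} \<subseteq> J" by (auto simp: P_def)
      show "c ^ Suc k < norm (x i)" if "i \<in> {i \<in> P. lev i = k}" for i using lower[of i] that by auto
    qed
    then show ?thesis by simp
  qed
  let ?d = "c powr p"
  have "(\<Sum>i\<in>J. norm (x i) powr p) = (\<Sum>i\<in>P. norm (x i) powr p)"
    using J by (intro sum.mono_neutral_right) (auto simp: P_def)
  also have "\<dots> \<le> (\<Sum>i\<in>P. ?d ^ lev i)"
  proof (rule sum_mono)
    fix i assume "i \<in> P"
    then have "norm (x i) powr p \<le> (c ^ lev i) powr p"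
      using p upper[of i] by (intro powr_mono2) auto
    also have "\<dots> = ?d ^ lev i"
      using c by (simp add: powr_powr mult.commute flip: powr_realpow)
    finally show "norm (x i) powr p \<le> ?d ^ lev i" .
  qed
  also have "\<dots> = (\<Sum>k\<in>lev ` P. \<Sum>i | i \<in> P \<and> lev i = k. ?d ^ lev i)"
    by (rule sum.image_gen[OF fP])
  also have "\<dots> = (\<Sum>k\<in>lev ` P. card {i \<in> P. lev i = k} * ?d ^ k)"
    by (intro sum.cong refl) simp
  also have "\<dots> \<le> (\<Sum>k\<in>lev ` P. n * (n * ?d) ^ k)"
  proof (rule sum_mono)
    fix k
    have "real (card {i \<in> P. lev i = k}) \<le> real (n ^ Suc k)"
      using card[of k] of_nat_le_iff by blast
    then have "card {i \<in> P. lev i = k} * ?d ^ k \<le> real (n ^ Suc k) * ?d ^ k"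
      by (intro mult_right_mono) auto
    then show "card {i \<in> P. lev i = k} * ?d ^ k \<le> n * (n * ?d) ^ k"
      by (simp add: power_mult_distrib mult_ac)
  qed
  also have "\<dots> \<le> n * (1 / (1 - n * ?d))"
  proof -
    have s: "summable (\<lambda>k. (n * ?d) ^ k)" using p by (intro summable_geometric) simp
    have "(\<Sum>k\<in>lev ` P. (n * ?d) ^ k) \<le> (\<Sum>k. (n * ?d) ^ k)"
      using fP by (intro sum_le_suminf[OF s]) auto
    also have "\<dots> = 1 / (1 - n * ?d)" using p by (intro suminf_geometric) simp
    finally have "n * (\<Sum>k\<in>lev ` P. (n * ?d) ^ k) \<le> n * (1 / (1 - n * ?d))"
      by (rule mult_left_mono) simp
    then show ?thesis by (simp only: sum_distrib_left)
  qed
  finally show ?thesis by simp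
qed

text \<open>\<open>p\<close> is taken so large that \<open>n * c powr p < 1\<close>. By homogeneity
  the vectors may be scaled to mean 1, and means over roots of unity are then replaced by Rademacher
  averages.\<close>

lemma has_cotype_of_mean_contraction:
  assumes H: "mean_contraction m n c TYPE('a::complex_banach)"
    and m: "m > 0" "even m" and n: "n > 0" and c: "c > 0" "c < 1"
  shows "\<exists>p\<ge>2. has_cotype p TYPE('a)"
proof -
  obtain k where k: "c ^ k < 1 / n"
    using real_arch_pow_inv[of "1 / n" c] n c by auto
  \<comment> \<open>The summand 2 ensures \<open>p \<ge> 2\<close>; it can only make
    \<open>c powr p\<close> smaller.\<close>
  define p where "p = real (k + 2)"
  have "c powr p = c ^ (k + 2)" using c unfolding p_def by (intro powr_realpow)
  also have "\<dots> \<le> c ^ k" using c by (intro power_decreasing) auto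
  finally have "n * c powr p \<le> n * c ^ k" by (rule mult_left_mono) simp
  also have "\<dots> < 1" using k n by (simp add: field_simps)
  finally have q: "n * c powr p < 1" .
  have p: "p \<ge> 2" by (simp add: p_def)
  define B where "B = n / (1 - n * c powr p)"
  have B: "B > 0" using q n by (simp add: B_def)
  have main: "(\<Sum>i\<in>J. norm (x i) powr p) powr (1 / p) \<le> B powr (1 / p) * sqrt (umean m J J x)"
    if J: "finite J" for J and x :: "nat \<Rightarrow> 'a"
  proof -
    define E where "E = umean m J J x"
    have E0: "E \<ge> 0" unfolding E_def by (rule uavg_nonneg) simp
    have le: "(norm (x i))\<^sup>2 \<le> E" if "i \<in> J" for i
      unfolding E_def using that J by (intro norm_le_umean m)
    show ?thesis
    proof (cases "E = 0")
      case True
      then have "norm (x i) = 0" if "i \<in> J" for i using le[OF that] by simp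
      then have "(\<Sum>i\<in>J. norm (x i) powr p) = 0" by (intro sum.neutral) auto
      then show ?thesis using E0 by (simp add: E_def)
    next
      case False
      define r where "r = 1 / sqrt E"
      have r: "r > 0" "r\<^sup>2 * E = 1" using False E0 by (auto simp: r_def power_divide)
      have "umean m J J (\<lambda>i. r *\<^sub>R x i) = uavg m J (\<lambda>\<omega>. r\<^sup>2 * (norm (\<Sum>i\<in>J. \<omega> i *\<^sub>C x i))\<^sup>2)"
        by (simp add: scaleC_scaleR power_mult_distrib flip: scaleR_sum_right)
      also have "\<dots> = 1" using r by (simp add: uavg_cmult E_def)
      finally have "(\<Sum>i\<in>J. norm (r *\<^sub>R x i) powr p) \<le> B"
        unfolding B_def using p J by (intro sum_norm_powr_le[OF H m n c _ q]) auto
      then have "r powr p * (\<Sum>i\<in>J. norm (x i) powr p) \<le> B"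
        using r by (simp add: powr_mult sum_distrib_left)
      then have "(r powr p * (\<Sum>i\<in>J. norm (x i) powr p)) powr (1 / p) \<le> B powr (1 / p)"
        using p by (intro powr_mono2) (auto intro!: mult_nonneg_nonneg sum_nonneg)
      then have "r * (\<Sum>i\<in>J. norm (x i) powr p) powr (1 / p) \<le> B powr (1 / p)"
        using r p by (simp add: powr_mult powr_powr sum_nonneg)
      then show ?thesis using False E0 by (simp add: r_def field_simps flip: E_def)
    qed
  qed
  \<comment> \<open>The factor 2 is the square root of the factor 4 in
    \<open>umean_le_ravg\<close>.\<close>
  have "(\<Sum>i=1..N. norm (x i) powr p) powr (1 / p)
      \<le> 2 * B powr (1 / p) * sqrt (LINT t:{0..1}|lborel. (norm (\<Sum>i=1..N. rademacher i t *\<^sub>R x i))\<^sup>2)"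
    for N and x :: "nat \<Rightarrow> 'a"
  proof -
    have set: "set [1..<Suc N] = {1..N}" by (simp add: atLeastLessThanSuc_atLeastAtMost del: upt_Suc)
    have "umean m {1..N} {1..N} x \<le> 4 * ravg (map x [1..<Suc N]) 0"
      using umean_le_ravg[OF m, of "[1..<Suc N]" x] unfolding set by simp
    then have "sqrt (umean m {1..N} {1..N} x) \<le> sqrt (4 * ravg (map x [1..<Suc N]) 0)"
      by (rule real_sqrt_le_mono)
    also have "\<dots> = 2 * sqrt (ravg (map x [1..<Suc N]) 0)" by (simp add: real_sqrt_mult)
    finally have "B powr (1 / p) * sqrt (umean m {1..N} {1..N} x)
        \<le> B powr (1 / p) * (2 * sqrt (ravg (map x [1..<Suc N]) 0))"
      by (intro mult_left_mono) auto
    then show ?thesis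
      using main[of "{1..N}" x] unfolding rademacher_integral by simp
  qed
  then have "has_cotype p TYPE('a)"
    unfolding has_cotype_def using B by (intro exI[of _ "2 * B powr (1 / p)"]) auto
  then show ?thesis using p by auto
qed

section \<open>Almost isometric copies of finite dimensional sup norm spaces\<close>

text \<open>The two clauses say that mapping \<open>z\<close> to
  \<open>\<Sum>i<n. z i *\<^sub>C y i\<close> has norm at most \<open>K\<close> on the
  \<open>n\<close>-dimensional sup norm space and that its inverse has norm at most 1; all the loss
  is put into the upper bound.\<close>

definition linf_family :: "real \<Rightarrow> nat \<Rightarrow> (nat \<Rightarrow> 'a::complex_normed_vector) \<Rightarrow> bool" where
  "linf_family K n y \<longleftrightarrow>
     (\<forall>z. (\<forall>i<n. cmod (z i) \<le> 1) \<longrightarrow> norm (\<Sum>i<n. z i *\<^sub>C y i) \<le> K) \<and>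
     (\<forall>z. \<forall>i<n. cmod (z i) \<le> norm (\<Sum>j<n. z j *\<^sub>C y j))"

text \<open>With second moment normalised to 1 and first moment at least
  \<open>1 - n * \<delta>\<close>, the variable \<open>S\<close> deviates from 1 by at most
  \<open>2 * (n * \<delta>)\<close> in mean square. Each of the \<open>M\<close> sign patterns has
  weight \<open>1 / M\<close>, so a small enough \<open>\<delta>\<close> turns this into a bound at
  every pattern.\<close>

lemma almost_extremal_family:
  assumes H: "\<And>c. 0 < c \<Longrightarrow> c < 1 \<Longrightarrow> \<not> mean_contraction m n c TYPE('a::complex_normed_vector)"
    and m: "m > 0" "even m" and n: "n > 0" and \<eta>: "0 < \<eta>" "\<eta> \<le> 1"
  shows "\<exists>y::nat \<Rightarrow> 'a.
    (\<forall>\<tau>\<in>PiE {..<n} (\<lambda>_. unity_roots m). norm (\<Sum>b<n. \<tau> b *\<^sub>C y b) \<le> 1 + \<eta>) \<and>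
    (\<forall>b<n. norm (y b) \<ge> 1 - \<eta>)"
proof -
  let ?\<Omega> = "PiE {..<n} (\<lambda>_. unity_roots m)"
  define M where "M = real (card ?\<Omega>)"
  have M: "M \<ge> 1" using card_sign_space_pos[OF m(1), of "{..<n}"] by (simp add: M_def)
  \<comment> \<open>Chosen so that \<open>2 * n * \<delta>\<close> is
    \<open>\<eta>\<^sup>2 / M\<close>, the mean square deviation that is still tolerable at a single
    pattern.\<close>
  define \<delta> where "\<delta> = \<eta>\<^sup>2 / (2 * n * M)"
  have \<eta>2: "\<eta>\<^sup>2 \<le> \<eta>" using \<eta> by (simp add: power2_eq_square mult_left_le)
  have n\<delta>: "n * \<delta> = \<eta>\<^sup>2 / (2 * M)" using n by (simp add: \<delta>_def)
  have n\<delta>_le: "n * \<delta> \<le> \<eta> / 2"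
  proof -
    have "\<eta>\<^sup>2 / (2 * M) \<le> \<eta>\<^sup>2 / 2" using M by (intro divide_left_mono) auto
    then show ?thesis using \<eta>2 n\<delta> by linarith
  qed
  have \<delta>0: "\<delta> > 0" using \<eta> n M by (simp add: \<delta>_def)
  have "\<delta> \<le> n * \<delta>" using n \<delta>0 by simp
  then have \<delta>1: "\<delta> < 1" using n\<delta>_le \<eta> by linarith
  define c where "c = sqrt (1 - \<delta>)"
  have c: "0 < c" "c < 1" "c\<^sup>2 = 1 - \<delta>" using \<delta>0 \<delta>1 by (auto simp: c_def)
  obtain y0 :: "nat \<Rightarrow> 'a"
    where y0: "n * c\<^sup>2 * umean m {..<n} {..<n} y0 < (\<Sum>b<n. (norm (y0 b))\<^sup>2)"
    using H[OF c(1,2)] by (auto simp: mean_contraction_def not_le)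
  define E where "E = umean m {..<n} {..<n} y0"
  have E0: "E \<ge> 0" unfolding E_def by (rule uavg_nonneg) simp
  have le0: "(norm (y0 b))\<^sup>2 \<le> E" if "b < n" for b
    unfolding E_def using that by (intro norm_le_umean m) auto
  have "E \<noteq> 0"
  proof
    assume "E = 0"
    then have "(\<Sum>b<n. (norm (y0 b))\<^sup>2) \<le> 0" using le0 by (intro sum_nonpos) auto
    then show False using y0 \<open>E = 0\<close> by (simp add: E_def)
  qed
  define r where "r = 1 / sqrt E"
  have r: "r > 0" "r\<^sup>2 * E = 1" using \<open>E \<noteq> 0\<close> E0 by (auto simp: r_def power_divide)
  define y where "y b = r *\<^sub>R y0 b" for b
  have ny: "(norm (y b))\<^sup>2 = r\<^sup>2 * (norm (y0 b))\<^sup>2" for b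
    by (simp add: y_def power_mult_distrib)
  have le1: "(norm (y b))\<^sup>2 \<le> 1" if "b < n" for b
  proof -
    have "r\<^sup>2 * (norm (y0 b))\<^sup>2 \<le> r\<^sup>2 * E" using le0[OF that] by (intro mult_left_mono) auto
    then show ?thesis using r(2) ny by simp
  qed
  define S where "S \<tau> = norm (\<Sum>b<n. \<tau> b *\<^sub>C y b)" for \<tau>
  have S: "S \<tau> = r * norm (\<Sum>b<n. \<tau> b *\<^sub>C y0 b)" for \<tau>
    using r(1) by (simp add: S_def y_def scaleC_scaleR flip: scaleR_sum_right)
  have ES2: "uavg m {..<n} (\<lambda>\<tau>. (S \<tau>)\<^sup>2) = 1"
    using r(2) unfolding S power_mult_distrib uavg_cmult by (simp add: E_def)
  have "r\<^sup>2 * (n * c\<^sup>2 * E) < r\<^sup>2 * (\<Sum>b<n. (norm (y0 b))\<^sup>2)"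
    using y0 r(1) by (simp add: E_def)
  moreover have "r\<^sup>2 * (n * c\<^sup>2 * E) = n * (1 - \<delta>) * (r\<^sup>2 * E)" by (simp add: c(3))
  ultimately have sum: "n * (1 - \<delta>) < (\<Sum>b<n. (norm (y b))\<^sup>2)"
    using r(2) by (simp add: ny sum_distrib_left)
  \<comment> \<open>All squared norms are at most 1 while their sum exceeds
    \<open>n * (1 - \<delta>)\<close>, so none can fall short of 1 by more than
    \<open>n * \<delta>\<close>.\<close>
  have lower: "1 - n * \<delta> \<le> norm (y k)" if k: "k < n" for k
  proof -
    have "(\<Sum>b<n. (norm (y b))\<^sup>2) = (norm (y k))\<^sup>2 + (\<Sum>b\<in>{..<n} - {k}. (norm (y b))\<^sup>2)"
      using k by (intro sum.remove) auto
    also have "(\<Sum>b\<in>{..<n} - {k}. (norm (y b))\<^sup>2) \<le> (\<Sum>b\<in>{..<n} - {k}. 1)"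
      using le1 by (intro sum_mono) auto
    also have "\<dots> = n - 1" using k by (simp add: of_nat_diff)
    finally have "1 - n * \<delta> \<le> (norm (y k))\<^sup>2" using sum n by (simp add: algebra_simps of_nat_diff)
    also have "(norm (y k))\<^sup>2 \<le> norm (y k)"
      using le1[OF k] power2_le_imp_le[of "norm (y k)" 1]
      by (simp add: power2_eq_square mult_left_le)
    finally show ?thesis .
  qed
  have ES: "1 - n * \<delta> \<le> uavg m {..<n} S"
  proof -
    \<comment> \<open>Flipping all signs but the first leaves the mean of \<open>S\<close>
      unchanged, while the two sums add up to twice the first term, whose norm is at least
      \<open>1 - n * \<delta>\<close>.\<close>
    define \<sigma> :: "nat \<Rightarrow> complex" where "\<sigma> b = (if b = 0 then 1 else - 1)" for b
    have tw: "uavg m {..<n} (\<lambda>\<tau>. S (\<lambda>j\<in>{..<n}. \<sigma> j * \<tau> j)) = uavg m {..<n} S"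
      using m by (intro uavg_twist) (auto simp: \<sigma>_def)
    have "2 * (1 - n * \<delta>) \<le> S \<tau> + S (\<lambda>j\<in>{..<n}. \<sigma> j * \<tau> j)" if \<tau>: "\<tau> \<in> ?\<Omega>" for \<tau>
    proof -
      have "(\<Sum>b<n. \<tau> b *\<^sub>C y b) + (\<Sum>b<n. (\<lambda>j\<in>{..<n}. \<sigma> j * \<tau> j) b *\<^sub>C y b)
          = (\<Sum>b<n. if b = 0 then 2 *\<^sub>R (\<tau> 0 *\<^sub>C y 0) else 0)"
        unfolding sum.distrib[symmetric]
        by (intro sum.cong) (auto simp: \<sigma>_def scaleR_2 scaleC_minus_left)
      also have "\<dots> = 2 *\<^sub>R (\<tau> 0 *\<^sub>C y 0)" using n by simp
      finally have "norm (2 *\<^sub>R (\<tau> 0 *\<^sub>C y 0)) \<le> S \<tau> + S (\<lambda>j\<in>{..<n}. \<sigma> j * \<tau> j)"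
        unfolding S_def using norm_triangle_ineq by metis
      moreover have "cmod (\<tau> 0) = 1" using \<tau> n norm_unity_root[OF m(1)] by (auto simp: PiE_iff)
      ultimately show ?thesis using lower[OF n] by (simp add: norm_scaleC)
    qed
    then have "uavg m {..<n} (\<lambda>_. 2 * (1 - n * \<delta>))
        \<le> uavg m {..<n} (\<lambda>\<tau>. S \<tau> + S (\<lambda>j\<in>{..<n}. \<sigma> j * \<tau> j))"
      by (rule uavg_mono)
    then show ?thesis using m by (simp add: uavg_const uavg_add tw)
  qed
  have var: "uavg m {..<n} (\<lambda>\<tau>. (S \<tau> - 1)\<^sup>2) \<le> \<eta>\<^sup>2 / M"
  proof -
    have "uavg m {..<n} (\<lambda>\<tau>. (S \<tau> - 1)\<^sup>2) = uavg m {..<n} (\<lambda>\<tau>. (S \<tau>)\<^sup>2 + ((- 2) * S \<tau> + 1))"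
      by (intro uavg_cong) (simp add: power2_eq_square algebra_simps)
    also have "\<dots> = 1 + ((- 2) * uavg m {..<n} S + 1)"
      unfolding uavg_add uavg_cmult ES2 using m by (simp add: uavg_const)
    also have "\<dots> \<le> 2 * (n * \<delta>)" using ES by simp
    also have "\<dots> = \<eta>\<^sup>2 / M" unfolding n\<delta> by simp
    finally show ?thesis .
  qed
  have "norm (\<Sum>b<n. \<tau> b *\<^sub>C y b) \<le> 1 + \<eta>" if \<tau>: "\<tau> \<in> ?\<Omega>" for \<tau>
  proof -
    have "(S \<tau> - 1)\<^sup>2 \<le> (\<Sum>\<tau>\<in>?\<Omega>. (S \<tau> - 1)\<^sup>2)"
      using \<tau> finite_sign_space[OF m(1), of "{..<n}"] by (intro member_le_sum) auto
    also have "\<dots> = M * uavg m {..<n} (\<lambda>\<tau>. (S \<tau> - 1)\<^sup>2)"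
      using M unfolding uavg_def M_def by simp
    also have "\<dots> \<le> M * (\<eta>\<^sup>2 / M)" using var M by (intro mult_left_mono) auto
    also have "\<dots> = \<eta>\<^sup>2" using M by simp
    finally have "S \<tau> - 1 \<le> \<eta>" using \<eta>(1) power2_le_imp_le[of "S \<tau> - 1" \<eta>] by linarith
    then show ?thesis by (simp add: S_def)
  qed
  moreover have "1 - \<eta> \<le> norm (y b)" if "b < n" for b
    using lower[OF that] n\<delta>_le \<eta> by linarith
  ultimately show ?thesis by blast
qed

section \<open>From roots of unity to arbitrary coefficients\<close>

lemma unity_roots_dense:
  assumes \<epsilon>: "\<epsilon> > 0"
  shows "\<exists>m>0. even m \<and> (\<forall>w. \<exists>u\<in>unity_roots m. Re (u * w) \<ge> (1 - \<epsilon>) * cmod w)"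
proof -
  have "isCont cos (0::real)" by simp
  then obtain d where d: "d > 0" "\<And>x::real. \<bar>x\<bar> < d \<Longrightarrow> \<bar>cos x - 1\<bar> < \<epsilon>"
    using \<epsilon> unfolding continuous_at_eps_delta by (auto simp: dist_real_def)
  obtain k :: nat where k: "2 * pi / d < real k" using reals_Archimedean2 by blast
  define m where "m = 2 * Suc k"
  have m: "m > 0" "even m" "2 * pi / m < d"
  proof -
    have "2 * pi < d * real k" using k d(1) by (simp add: field_simps)
    also have "\<dots> \<le> d * real m" using d(1) by (simp add: m_def)
    finally show "2 * pi / m < d" by (simp add: m_def field_simps)
  qed (auto simp: m_def)
  have "\<exists>u\<in>unity_roots m. Re (u * w) \<ge> (1 - \<epsilon>) * cmod w" for w
  proof -
    \<comment> \<open>Rounding down to a multiple of the angle \<open>2 * pi / m\<close> leaves the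
      argument \<open>x\<close> of the product between \<open>- 2 * pi / m\<close> and 0, where the
      cosine is at least \<open>1 - \<epsilon>\<close>.\<close>
    define j where "j = \<lfloor>- Arg w * m / (2 * pi)\<rfloor>"
    define x where "x = 2 * pi * of_int j / m + Arg w"
    have "of_int j \<le> - Arg w * m / (2 * pi)" "- Arg w * m / (2 * pi) < of_int j + 1"
      unfolding j_def by linarith+
    moreover have "- Arg w * m / (2 * pi) = of_int j - x * (m / (2 * pi))"
      using m(1) by (simp add: x_def field_simps)
    moreover have "m / (2 * pi) > 0" using m(1) by simp
    ultimately have "x * (m / (2 * pi)) \<le> 0" "- (x * (m / (2 * pi))) < 1" "m / (2 * pi) > 0"
      by linarith+
    then have "x \<le> 0" "- x < 2 * pi / m"
      using m(1) by (simp_all only: mult_le_0_iff) (auto simp: field_simps)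
    then have x: "cos x \<ge> 1 - \<epsilon>" using m(3) d(2)[of x] by linarith
    have "cis (2 * pi * of_int j / m) ^ m = cis (2 * pi * of_int j)"
      using m(1) by (simp add: Complex.DeMoivre)
    also have "\<dots> = 1" by (simp add: complex_eq_iff)
    finally have "cis (2 * pi * of_int j / m) \<in> unity_roots m"
      by (simp add: unity_roots_def)
    moreover have "cis (2 * pi * of_int j / m) * w = cmod w * cis x"
    proof -
      have "w = cmod w * cis (Arg w)" using rcis_cmod_Arg[of w] by (simp add: rcis_def)
      then have "cis (2 * pi * of_int j / m) * w
          = cmod w * (cis (2 * pi * of_int j / m) * cis (Arg w))"
        by (metis mult.left_commute)
      then show ?thesis by (simp only: cis_mult x_def)
    qed
    then have "Re (cis (2 * pi * of_int j / m) * w) = cmod w * cos x" by simp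
    moreover have "(1 - \<epsilon>) * cmod w \<le> cmod w * cos x"
      using x by (simp add: mult.commute mult_left_mono)
    ultimately show ?thesis by (metis (no_types))
  qed
  then show ?thesis using m by blast
qed

text \<open>A norming functional \<open>f\<close> reduces the norm to the moduli of the values
  \<open>f (y i)\<close>. Roots of unity that almost align these values bound the sum of the moduli
  by \<open>B / (1 - \<epsilon>)\<close>, whatever the coefficients.\<close>

lemma norm_sum_le_of_unity_roots:
  fixes y :: "nat \<Rightarrow> 'a::complex_normed_vector"
  assumes \<epsilon>: "\<epsilon> < 1" and dense: "\<And>w. \<exists>u\<in>unity_roots m. Re (u * w) \<ge> (1 - \<epsilon>) * cmod w"
    and B: "\<And>\<tau>. \<tau> \<in> PiE {..<n} (\<lambda>_. unity_roots m) \<Longrightarrow> norm (\<Sum>b<n. \<tau> b *\<^sub>C y b) \<le> B"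
    and A: "A \<ge> 0" and z: "\<And>i. i < n \<Longrightarrow> cmod (z i) \<le> A"
  shows "norm (\<Sum>i<n. z i *\<^sub>C y i) \<le> A * (B / (1 - \<epsilon>))"
proof -
  obtain f where f: "f \<in> dual" "onorm f \<le> 1"
      "f (\<Sum>i<n. z i *\<^sub>C y i) = norm (\<Sum>i<n. z i *\<^sub>C y i)"
    using hahn_banach by blast
  obtain u where u: "\<And>w. u w \<in> unity_roots m" "\<And>w. Re (u w * w) \<ge> (1 - \<epsilon>) * cmod w"
    using dense by metis
  define \<tau> where "\<tau> = (\<lambda>i\<in>{..<n}. u (f (y i)))"
  have lin: "f (\<Sum>i<n. v i *\<^sub>C y i) = (\<Sum>i<n. v i * f (y i))" for v
    by (simp add: linear_sum[OF dualD(3)[OF f(1)]] dualD(2)[OF f(1)])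
  have "(1 - \<epsilon>) * (\<Sum>i<n. cmod (f (y i))) \<le> (\<Sum>i<n. Re (\<tau> i * f (y i)))"
    unfolding sum_distrib_left using u(2) by (intro sum_mono) (simp add: \<tau>_def)
  also have "\<dots> = Re (f (\<Sum>i<n. \<tau> i *\<^sub>C y i))" by (simp add: lin)
  also have "\<dots> \<le> norm (\<Sum>i<n. \<tau> i *\<^sub>C y i)"
    using complex_Re_le_cmod dual_unit_ball_le[OF f(1,2)] order_trans by blast
  also have "\<dots> \<le> B" using u(1) unfolding \<tau>_def by (intro B restrict_PiE_iff[THEN iffD2]) simp
  finally have *: "(\<Sum>i<n. cmod (f (y i))) \<le> B / (1 - \<epsilon>)" using \<epsilon> by (simp add: field_simps)
  have "norm (\<Sum>i<n. z i *\<^sub>C y i) = cmod (\<Sum>i<n. z i * f (y i))"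
    using f(3) unfolding lin by (metis abs_norm_cancel norm_of_real)
  also have "\<dots> \<le> (\<Sum>i<n. cmod (z i) * cmod (f (y i)))"
    by (rule order_trans[OF norm_sum]) (simp add: norm_mult)
  also have "\<dots> \<le> (\<Sum>i<n. A * cmod (f (y i)))"
    using z by (intro sum_mono mult_right_mono) auto
  also have "\<dots> \<le> A * (B / (1 - \<epsilon>))"
    unfolding sum_distrib_left[symmetric] using * A by (rule mult_left_mono)
  finally show ?thesis .
qed

text \<open>Let \<open>k\<close> be an index of largest coefficient. Adding the combination with all
  other signs flipped leaves twice the \<open>k\<close>-th term. The flipped combination is at most
  \<open>cmod (z k) * M\<close>, so the original one is at least
  \<open>cmod (z k) * (2 * l - M)\<close>; dividing by \<open>2 * l - M\<close> makes the lower
  constant 1.\<close>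

lemma linf_family_of_flip:
  fixes y :: "nat \<Rightarrow> 'a::complex_normed_vector"
  assumes upper: "\<And>z A. (\<And>i. i < n \<Longrightarrow> cmod (z i) \<le> A) \<Longrightarrow> 0 \<le> A \<Longrightarrow> norm (\<Sum>i<n. z i *\<^sub>C y i) \<le> A * M"
    and lower: "\<And>i. i < n \<Longrightarrow> norm (y i) \<ge> l"
    and g: "2 * l - M > 0" and K: "M / (2 * l - M) \<le> K"
  shows "linf_family K n (\<lambda>i. (1 / (2 * l - M)) *\<^sub>R y i)"
proof -
  let ?g = "2 * l - M"
  have eq: "(\<Sum>i<n. z i *\<^sub>C (1 / ?g) *\<^sub>R y i) = (1 / ?g) *\<^sub>R (\<Sum>i<n. z i *\<^sub>C y i)" for z
    by (simp add: scaleC_scaleR flip: scaleR_sum_right)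
  have "norm (\<Sum>i<n. z i *\<^sub>C (1 / ?g) *\<^sub>R y i) \<le> K" if "\<And>i. i < n \<Longrightarrow> cmod (z i) \<le> 1" for z
  proof -
    have "norm (\<Sum>i<n. z i *\<^sub>C y i) \<le> 1 * M" using that by (intro upper) auto
    then have "(1 / ?g) * norm (\<Sum>i<n. z i *\<^sub>C y i) \<le> (1 / ?g) * M"
      using g by (intro mult_left_mono) auto
    then show ?thesis using g K unfolding eq by simp
  qed
  moreover have "cmod (z i) \<le> norm (\<Sum>j<n. z j *\<^sub>C (1 / ?g) *\<^sub>R y j)" if i: "i < n" for z i
  proof -
    have "Max ((\<lambda>i. cmod (z i)) ` {..<n}) \<in> (\<lambda>i. cmod (z i)) ` {..<n}"
      using i by (intro Max_in) auto
    then obtain k where k: "k < n" "cmod (z k) = Max ((\<lambda>i. cmod (z i)) ` {..<n})" by auto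
    then have max: "cmod (z j) \<le> cmod (z k)" if "j < n" for j using that by simp
    define w where "w j = (if j = k then z j else - z j)" for j
    have "(\<Sum>j<n. z j *\<^sub>C y j) + (\<Sum>j<n. w j *\<^sub>C y j) = (\<Sum>j<n. if j = k then 2 *\<^sub>R (z k *\<^sub>C y k) else 0)"
      unfolding sum.distrib[symmetric]
      by (intro sum.cong) (auto simp: w_def scaleR_2 scaleC_minus_left)
    also have "\<dots> = 2 *\<^sub>R (z k *\<^sub>C y k)" using k by simp
    finally have "norm (2 *\<^sub>R (z k *\<^sub>C y k)) \<le> norm (\<Sum>j<n. z j *\<^sub>C y j) + norm (\<Sum>j<n. w j *\<^sub>C y j)"
      using norm_triangle_ineq by metis
    moreover have "norm (\<Sum>j<n. w j *\<^sub>C y j) \<le> cmod (z k) * M"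
      using max by (intro upper) (auto simp: w_def)
    moreover have "cmod (z k) * l \<le> cmod (z k) * norm (y k)"
      using lower[OF k(1)] by (intro mult_left_mono) auto
    ultimately have "cmod (z k) * ?g \<le> norm (\<Sum>j<n. z j *\<^sub>C y j)"
      by (simp add: norm_scaleC algebra_simps)
    then have "cmod (z k) \<le> norm (\<Sum>j<n. z j *\<^sub>C (1 / ?g) *\<^sub>R y j)"
      using g unfolding eq by (simp add: field_simps)
    then show ?thesis using max[OF i] by linarith
  qed
  ultimately show ?thesis unfolding linf_family_def by blast
qed

lemma linf_family_subset:
  assumes "linf_family K N y" "n \<le> N"
  shows "linf_family K n y"
proof -
  have eq: "(\<Sum>i<n. z i *\<^sub>C y i) = (\<Sum>i<N. (if i < n then z i else 0) *\<^sub>C y i)" for z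
    using assms(2) by (intro sum.mono_neutral_cong_left) auto
  show ?thesis
    unfolding linf_family_def
  proof (intro conjI allI impI)
    fix z :: "nat \<Rightarrow> complex" assume "\<forall>i<n. cmod (z i) \<le> 1"
    then show "norm (\<Sum>i<n. z i *\<^sub>C y i) \<le> K"
      unfolding eq using assms(1)[unfolded linf_family_def, THEN conjunct1, rule_format,
          of "\<lambda>i. if i < n then z i else 0"] by auto
  next
    fix z :: "nat \<Rightarrow> complex" and i assume "i < n"
    then show "cmod (z i) \<le> norm (\<Sum>j<n. z j *\<^sub>C y j)"
      unfolding eq using assms(2) assms(1)[unfolded linf_family_def, THEN conjunct2, rule_format,
          of i "\<lambda>i. if i < n then z i else 0"] by auto
  qed
qed

lemma exists_linf_family:
  assumes no_cotype: "\<forall>p\<ge>2. \<not> has_cotype p TYPE('a::complex_banach)" and K: "K > 1"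
  shows "\<exists>y::nat \<Rightarrow> 'a. linf_family K n y"
proof -
  \<comment> \<open>\<open>?M \<epsilon>\<close> is the upper bound for families built with
    tolerance \<open>\<epsilon>\<close>, and \<open>1 - \<epsilon>\<close> the lower bound for
    single vectors. As \<open>\<epsilon>\<close> tends to 0, both
    \<open>2 * (1 - \<epsilon>) - ?M \<epsilon>\<close> and the resulting distortion tend to
    1.\<close>
  let ?M = "\<lambda>\<epsilon>::real. (1 + \<epsilon>) / (1 - \<epsilon>)"
  have lim: "((\<lambda>\<epsilon>. 2 * (1 - \<epsilon>) - ?M \<epsilon>) \<longlongrightarrow> 2 * (1 - 0) - ?M 0) (at_right 0)"
    and lim2: "((\<lambda>\<epsilon>. ?M \<epsilon> / (2 * (1 - \<epsilon>) - ?M \<epsilon>)) \<longlongrightarrow> ?M 0 / (2 * (1 - 0) - ?M 0)) (at_right 0)"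
    by (intro tendsto_intros; simp)+
  have "eventually (\<lambda>\<epsilon>. 2 * (1 - \<epsilon>) - ?M \<epsilon> > 0) (at_right 0)"
    by (rule order_tendstoD(1)[OF lim]) simp
  moreover have "eventually (\<lambda>\<epsilon>. ?M \<epsilon> / (2 * (1 - \<epsilon>) - ?M \<epsilon>) < K) (at_right 0)"
    by (rule order_tendstoD(2)[OF lim2]) (use K in simp)
  moreover have "eventually (\<lambda>\<epsilon>::real. 0 < \<epsilon> \<and> \<epsilon> < 1) (at_right 0)"
    using eventually_at_right_real[of 0 1] by simp
  ultimately have "eventually (\<lambda>\<epsilon>. 0 < \<epsilon> \<and> \<epsilon> < 1 \<and> 2 * (1 - \<epsilon>) - ?M \<epsilon> > 0 \<and>
      ?M \<epsilon> / (2 * (1 - \<epsilon>) - ?M \<epsilon>) < K) (at_right 0)"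
    by eventually_elim simp
  then obtain \<epsilon> where \<epsilon>: "0 < \<epsilon>" "\<epsilon> < 1" "2 * (1 - \<epsilon>) - ?M \<epsilon> > 0" "?M \<epsilon> / (2 * (1 - \<epsilon>) - ?M \<epsilon>) < K"
    using eventually_happens'[of "at_right (0::real)"] by auto
  obtain m where m: "m > 0" "even m"
      and dense: "\<And>w. \<exists>u\<in>unity_roots m. Re (u * w) \<ge> (1 - \<epsilon>) * cmod w"
    using unity_roots_dense[OF \<epsilon>(1)] by blast
  \<comment> \<open>One vector more than requested, since the averaging results ask for a positive
    number; it is discarded at the end.\<close>
  have "\<not> mean_contraction m (Suc n) c TYPE('a)" if "0 < c" "c < 1" for c
    using has_cotype_of_mean_contraction[OF _ m _ that, of "Suc n"] no_cotype by blast
  then obtain y :: "nat \<Rightarrow> 'a" where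
      y: "\<And>\<tau>. \<tau> \<in> PiE {..<Suc n} (\<lambda>_. unity_roots m) \<Longrightarrow> norm (\<Sum>b<Suc n. \<tau> b *\<^sub>C y b) \<le> 1 + \<epsilon>"
      "\<And>b. b < Suc n \<Longrightarrow> norm (y b) \<ge> 1 - \<epsilon>"
    using almost_extremal_family[of m "Suc n" \<epsilon>] m \<epsilon> by (metis less_imp_le zero_less_Suc)
  have "linf_family K (Suc n) (\<lambda>i. (1 / (2 * (1 - \<epsilon>) - ?M \<epsilon>)) *\<^sub>R y i)"
    using \<epsilon> y(2) norm_sum_le_of_unity_roots[OF \<epsilon>(2) dense y(1)]
    by (intro linf_family_of_flip) auto
  then have "linf_family K n (\<lambda>i. (1 / (2 * (1 - \<epsilon>) - ?M \<epsilon>)) *\<^sub>R y i)"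
    by (rule linf_family_subset) simp
  then show ?thesis by blast
qed

section \<open>Finite dimensional subspaces\<close>

lemma bounded_linear_scaleC_left: "bounded_linear (\<lambda>c. c *\<^sub>C (y :: 'a::complex_normed_vector))"
proof (rule bounded_linear_intro[where K = "norm y"])
  show "(r *\<^sub>R c) *\<^sub>C y = r *\<^sub>R (c *\<^sub>C y)" for r c
    by (simp only: scaleR_conv_of_real scaleC_scaleC[symmetric] scaleC_of_real)
qed (simp_all add: scaleC_add_left norm_scaleC)

lemma continuous_on_lincomb:
  fixes y :: "nat \<Rightarrow> 'a::complex_normed_vector"
  shows "continuous_on S (\<lambda>z. \<Sum>i<n. z i *\<^sub>C y i)"
  by (intro continuous_on_sum bounded_linear.continuous_on[OF bounded_linear_scaleC_left]
      continuous_on_product_then_coordinatewise[OF continuous_on_id])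

text \<open>Sequences that vanish from \<open>n\<close> on stand for \<open>n\<close>-tuples;
  pinning those coordinates to 0 lets Tychonoff's theorem give compactness in the space of all
  sequences.\<close>

lemma compact_box: "compact (PiE UNIV (\<lambda>i. if i < n then cball (0::complex) r else {0}))"
proof -
  have "compactin (product_topology (\<lambda>_. euclidean) UNIV) (PiE UNIV (\<lambda>i. if i < n then cball (0::complex) r else {0}))"
    unfolding compactin_PiE by auto
  then show ?thesis by (simp add: euclidean_product_topology)
qed

text \<open>On the compact unit sphere of the sup norm the norm of the combination attains its
  minimum, positive by independence; scaling by the largest coordinate does the rest.\<close>

lemma independent_family_bound:
  fixes y :: "nat \<Rightarrow> 'a::complex_normed_vector"
  assumes ind: "\<And>z. (\<Sum>i<n. z i *\<^sub>C y i) = 0 \<Longrightarrow> \<forall>i<n. z i = 0"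
  shows "\<exists>c>0. \<forall>z. \<forall>i<n. c * cmod (z i) \<le> norm (\<Sum>j<n. z j *\<^sub>C y j)"
proof (cases "n = 0")
  case True
  then show ?thesis by (intro exI[of _ 1]) auto
next
  case False
  let ?box = "PiE UNIV (\<lambda>i. if i < n then cball (0::complex) 1 else {0})"
  define S where "S = ?box \<inter> (\<Union>i<n. {z. cmod (z i) = 1})"
  have S: "compact S"
    unfolding S_def
  proof (intro compact_Int_closed compact_box closed_UN ballI)
    show "closed {z :: nat \<Rightarrow> complex. cmod (z i) = 1}" for i
      by (intro closed_Collect_eq continuous_intros continuous_on_product_then_coordinatewise[OF continuous_on_id])
  qed auto
  have "(\<lambda>i. if i = 0 then 1 else 0) \<in> S" using False by (auto simp: S_def)
  then have "S \<noteq> {}" by blast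
  then obtain z0 where z0: "z0 \<in> S"
      "\<And>z. z \<in> S \<Longrightarrow> norm (\<Sum>i<n. z0 i *\<^sub>C y i) \<le> norm (\<Sum>i<n. z i *\<^sub>C y i)"
    using continuous_attains_inf[OF S _ continuous_on_norm[OF continuous_on_lincomb]] by metis
  define c where "c = norm (\<Sum>i<n. z0 i *\<^sub>C y i)"
  have "c \<noteq> 0"
  proof
    assume "c = 0"
    then have "\<forall>i<n. z0 i = 0" using ind[of z0] by (simp add: c_def)
    then show False using z0(1) by (auto simp: S_def)
  qed
  then have c: "c > 0" by (simp add: c_def)
  have "c * cmod (z i) \<le> norm (\<Sum>j<n. z j *\<^sub>C y j)" if i: "i < n" for z i
  proof -
    have "Max ((\<lambda>i. cmod (z i)) ` {..<n}) \<in> (\<lambda>i. cmod (z i)) ` {..<n}"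
      using i by (intro Max_in) auto
    then obtain k where k: "k < n" "cmod (z k) = Max ((\<lambda>i. cmod (z i)) ` {..<n})" by auto
    then have max: "cmod (z j) \<le> cmod (z k)" if "j < n" for j using that by simp
    show ?thesis
    proof (cases "z k = 0")
      case True
      then show ?thesis using max[OF i] by simp
    next
      case False
      define w where "w j = (if j < n then complex_of_real (1 / cmod (z k)) * z j else 0)" for j
      have "w \<in> S" using max False k(1) by (auto simp: S_def w_def norm_mult norm_divide divide_simps)
      then have "c \<le> norm (\<Sum>j<n. w j *\<^sub>C y j)" unfolding c_def by (rule z0(2))
      also have "(\<Sum>j<n. w j *\<^sub>C y j) = complex_of_real (1 / cmod (z k)) *\<^sub>C (\<Sum>j<n. z j *\<^sub>C y j)"
        unfolding cvec.scale_sum_right by (intro sum.cong) (auto simp: w_def scaleC_scaleC)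
      finally have "c * cmod (z k) \<le> norm (\<Sum>j<n. z j *\<^sub>C y j)"
        using False by (simp add: norm_scaleC norm_divide field_simps)
      moreover have "c * cmod (z i) \<le> c * cmod (z k)" using max[OF i] c by simp
      ultimately show ?thesis by linarith
    qed
  qed
  then show ?thesis using c by blast
qed

lemma span_family: "cvec.span (y ` {..<n}) = range (\<lambda>z. \<Sum>i<n::nat. z i *\<^sub>C (y i :: 'a::complex_normed_vector))"
  (is "_ = range ?L")
proof
  have "cvec.subspace (range ?L)"
    unfolding cvec.subspace_def
  proof (intro conjI ballI allI)
    show "0 \<in> range ?L" by (intro image_eqI[of _ _ "\<lambda>_. 0"]) auto
    fix x x' c assume "x \<in> range ?L" "x' \<in> range ?L"
    then obtain z z' where z: "x = ?L z" "x' = ?L z'" by auto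
    show "x + x' \<in> range ?L"
      unfolding z by (intro image_eqI[of _ _ "\<lambda>i. z i + z' i"]) (auto simp: scaleC_add_left sum.distrib)
  next
    fix x c assume "x \<in> range ?L"
    then obtain z where z: "x = ?L z" by auto
    show "c *\<^sub>C x \<in> range ?L"
      unfolding z by (intro image_eqI[of _ _ "\<lambda>i. c * z i"]) (auto simp: scaleC_scaleC cvec.scale_sum_right)
  qed
  moreover have "y ` {..<n} \<subseteq> range ?L"
  proof
    fix x assume "x \<in> y ` {..<n}"
    then obtain k where k: "k < n" "x = y k" by auto
    have "?L (\<lambda>i. if i = k then 1 else 0) = (\<Sum>i<n. if i = k then y k else 0)"
      by (intro sum.cong) (auto simp: scaleC_one)
    then have "x = ?L (\<lambda>i. if i = k then 1 else 0)" using k by simp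
    then show "x \<in> range ?L" by (intro image_eqI[of x ?L "\<lambda>i. if i = k then 1 else 0"]) simp_all
  qed
  ultimately show "cvec.span (y ` {..<n}) \<subseteq> range ?L" by (intro cvec.span_minimal)
  show "range ?L \<subseteq> cvec.span (y ` {..<n})"
  proof
    fix x assume "x \<in> range ?L"
    then obtain z where "x = ?L z" by blast
    then show "x \<in> cvec.span (y ` {..<n})"
      by (simp only:) (intro cvec.span_sum cvec.span_scale cvec.span_base imageI)
  qed
qed

lemma fin_dim_subspace_family: "fin_dim_subspace (range (\<lambda>z. \<Sum>i<n::nat. z i *\<^sub>C (y i :: 'a::complex_normed_vector)))"
  unfolding fin_dim_subspace_def by (intro exI[of _ "y ` {..<n}"]) (simp add: span_family)

lemma fin_dim_subspace_subspace: "fin_dim_subspace E \<Longrightarrow> cvec.subspace E"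
  by (auto simp: fin_dim_subspace_def cvec.subspace_span)

lemma fin_dim_basis:
  fixes E :: "'a::complex_normed_vector set"
  assumes "fin_dim_subspace E"
  shows "\<exists>n (y::nat \<Rightarrow> 'a). E = range (\<lambda>z. \<Sum>i<n. z i *\<^sub>C y i) \<and>
    (\<forall>z. (\<Sum>i<n. z i *\<^sub>C y i) = 0 \<longrightarrow> (\<forall>i<n. z i = 0))"
proof -
  obtain B where B: "finite B" "cvec.span B = E" using assms by (auto simp: fin_dim_subspace_def)
  obtain B0 where B0: "B0 \<subseteq> B" "\<not> cvec.dependent B0" "B \<subseteq> cvec.span B0"
    using cvec.maximal_independent_subset by blast
  have fB0: "finite B0" using B0(1) B(1) finite_subset by blast
  obtain y where y: "bij_betw y {0..<card B0} B0" using ex_bij_betw_nat_finite[OF fB0] by blast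
  define n where "n = card B0"
  have img: "y ` {..<n} = B0" and inj: "inj_on y {..<n}"
    using y by (auto simp: bij_betw_def lessThan_atLeast0 n_def)
  have "E = cvec.span B0"
    using B(2) B0(1,3) cvec.span_mono[OF B0(1)] cvec.span_minimal[OF B0(3) cvec.subspace_span] by auto
  moreover have "z i = 0" if z: "(\<Sum>i<n. z i *\<^sub>C y i) = 0" and i: "i < n" for z i
  proof -
    define u where "u v = z (the_inv_into {..<n} y v)" for v
    have "(\<Sum>v\<in>B0. u v *\<^sub>C v) = (\<Sum>i<n. u (y i) *\<^sub>C y i)"
      unfolding img[symmetric] by (subst sum.reindex[OF inj]) (simp add: comp_def)
    also have "\<dots> = (\<Sum>i<n. z i *\<^sub>C y i)"
      by (intro sum.cong refl) (simp add: u_def the_inv_into_f_f[OF inj])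
    also note z
    finally have "(\<Sum>v\<in>B0. u v *\<^sub>C v) = 0" .
    moreover have "y i \<in> B0" unfolding img[symmetric] using i by simp
    moreover have "\<not> (\<exists>u. (\<exists>v\<in>B0. u v \<noteq> 0) \<and> (\<Sum>v\<in>B0. u v *\<^sub>C v) = 0)"
      using B0(2) unfolding cvec.dependent_finite[OF fB0] .
    ultimately have "u (y i) = 0" by metis
    then show ?thesis using i by (simp add: u_def the_inv_into_f_f[OF inj])
  qed
  ultimately show ?thesis
    using span_family[of y n] unfolding img by (intro exI[of _ n] exI[of _ y]) auto
qed

text \<open>Unit vectors of \<open>E\<close> have coordinates bounded by \<open>1 / c\<close>, so
  the sphere is a closed part of the continuous image of a compact box.\<close>

lemma compact_fin_dim_sphere:
  fixes E :: "'a::complex_normed_vector set"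
  assumes "fin_dim_subspace E"
  shows "compact {x \<in> E. norm x = 1}"
proof -
  obtain n and y :: "nat \<Rightarrow> 'a" where E: "E = range (\<lambda>z. \<Sum>i<n. z i *\<^sub>C y i)"
      and ind: "\<And>z. (\<Sum>i<n. z i *\<^sub>C y i) = 0 \<Longrightarrow> \<forall>i<n. z i = 0"
    using fin_dim_basis[OF assms] by blast
  obtain c where c: "c > 0" "\<And>z i. i < n \<Longrightarrow> c * cmod (z i) \<le> norm (\<Sum>j<n. z j *\<^sub>C y j)"
    using independent_family_bound[where n = n and y = y, OF ind] by blast
  let ?box = "PiE UNIV (\<lambda>i. if i < n then cball (0::complex) (1 / c) else {0})"
  have "compact ((\<lambda>z. \<Sum>i<n. z i *\<^sub>C y i) ` ?box \<inter> {x. norm x = 1})"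
    by (intro compact_Int_closed compact_continuous_image compact_box continuous_on_lincomb
        closed_Collect_eq continuous_intros)
  also have "(\<lambda>z. \<Sum>i<n. z i *\<^sub>C y i) ` ?box \<inter> {x. norm x = 1} = {x \<in> E. norm x = 1}"
  proof (intro equalityI subsetI)
    fix x assume "x \<in> {x \<in> E. norm x = 1}"
    then obtain z where z: "x = (\<Sum>i<n. z i *\<^sub>C y i)" "norm x = 1" by (auto simp: E)
    have "cmod (z i) \<le> 1 / c" if "i < n" for i
      using c(2)[OF that, of z] z c(1) by (simp add: field_simps)
    then have "(\<lambda>i. if i < n then z i else 0) \<in> ?box" by auto
    then have "x \<in> (\<lambda>z. \<Sum>i<n. z i *\<^sub>C y i) ` ?box"
      by (intro image_eqI[where x = "\<lambda>i. if i < n then z i else 0"]) (simp_all add: z)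
    then show "x \<in> (\<lambda>z. \<Sum>i<n. z i *\<^sub>C y i) ` ?box \<inter> {x. norm x = 1}" using z(2) by simp
  qed (auto simp: E)
  finally show ?thesis .
qed

section \<open>Norms of isomorphisms between subspaces\<close>

lemma onorm_on_bounds:
  assumes "0 \<in> E" "\<And>x. x \<in> E \<Longrightarrow> norm x \<le> 1 \<Longrightarrow> norm (T x) \<le> C"
  shows "0 \<le> onorm_on E T" "onorm_on E T \<le> C"
proof -
  have bdd: "bdd_above ((\<lambda>x. norm (T x)) ` {x \<in> E. norm x \<le> 1})"
    using assms(2) by (intro bdd_aboveI2[where M = C]) auto
  show "onorm_on E T \<le> C"
    unfolding onorm_on_def using assms by (intro cSUP_least) auto
  have "norm (T 0) \<le> onorm_on E T"
    unfolding onorm_on_def using assms(1) by (intro cSUP_upper bdd) auto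
  then show "0 \<le> onorm_on E T" using norm_ge_zero order_trans by blast
qed

text \<open>The lower estimate gives injectivity and also bounds the inverse, so two inequalities
  replace the computation of the operator norms.\<close>

lemma lin_iso_of_bounds:
  assumes E: "cvec.subspace E"
    and add: "\<And>x y. T (x + y) = T x + T y" and scale: "\<And>c x. T (c *\<^sub>C x) = c *\<^sub>C T x"
    and upper: "\<And>x. x \<in> E \<Longrightarrow> norm x \<le> 1 \<Longrightarrow> norm (T x) \<le> a"
    and lower: "\<And>x. x \<in> E \<Longrightarrow> norm x \<le> b * norm (T x)" and b: "b \<ge> 0"
  shows "lin_iso_on E (T ` E) T \<and> distortion_on E (T ` E) T \<le> a * b"
proof -
  have zero: "0 \<in> E" "T 0 = 0" using E scale[of 0 0] by (auto simp: cvec.subspace_def)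
  have inj: "inj_on T E"
  proof (rule inj_onI)
    fix x y assume xy: "x \<in> E" "y \<in> E" "T x = T y"
    have "T (x - y) + T y = T x" using add[of "x - y" y] by simp
    then have "T (x - y) = 0" using xy(3) by simp
    moreover have "x - y \<in> E" using E xy by (simp add: cvec.subspace_diff)
    ultimately show "x = y" using lower[of "x - y"] by simp
  qed
  then have iso: "lin_iso_on E (T ` E) T" by (auto simp: lin_iso_on_def add scale bij_betw_def)
  have F: "0 \<in> T ` E" using zero by (metis imageI)
  have inv: "norm (inv_into E T w) \<le> b" if w: "w \<in> T ` E" "norm w \<le> 1" for w
  proof -
    have "norm (inv_into E T w) \<le> b * norm w"
      using lower[of "inv_into E T w"] inv_into_into[OF w(1)] f_inv_into_f[OF w(1)] by simp
    also have "\<dots> \<le> b * 1" using w b by (intro mult_left_mono) auto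
    finally show ?thesis by simp
  qed
  have "0 \<le> a" using upper[OF zero(1)] by (simp add: zero)
  then have "distortion_on E (T ` E) T \<le> a * b"
    unfolding distortion_on_def
    using onorm_on_bounds[OF zero(1) upper] onorm_on_bounds[OF F inv] by (intro mult_mono) auto
  with iso show ?thesis by blast
qed

section \<open>Uniform copies and finite representability\<close>

lemma apply_bcontfun_sum:
  "apply_bcontfun (\<Sum>i\<in>A. f i) x = (\<Sum>i\<in>A. apply_bcontfun (f i :: 'a::topological_space \<Rightarrow>\<^sub>C 'b::real_normed_vector) x)"
  by (induction A rule: infinite_finite_induct) auto

definition lvec :: "nat \<Rightarrow> (nat \<Rightarrow> complex) \<Rightarrow> linfty" where
  "lvec n z = Bcontfun (\<lambda>i. if i < n then z i else 0)"

lemma apply_lvec [simp]: "apply_bcontfun (lvec n z) i = (if i < n then z i else 0)"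
proof -
  have "(\<lambda>i. if i < n then z i else 0) \<in> bcontfun"
    by (rule bcontfun_normI[where b = "\<Sum>i<n. cmod (z i)"])
       (auto intro!: member_le_sum sum_nonneg)
  then show ?thesis by (simp add: lvec_def Bcontfun_inverse)
qed

lemma lvec_in_linfty_n: "lvec n z \<in> linfty_n n"
  by (simp add: linfty_n_def)

lemma lvec_apply: "x \<in> linfty_n n \<Longrightarrow> lvec n (apply_bcontfun x) = x"
  by (rule bcontfun_eqI) (auto simp: linfty_n_def)

lemma norm_lvec_le: "(\<And>i. i < n \<Longrightarrow> cmod (z i) \<le> C) \<Longrightarrow> 0 \<le> C \<Longrightarrow> norm (lvec n z) \<le> C"
  by (rule norm_bound) auto

lemma lvec_lincomb: "lvec n z = (\<Sum>i<n. z i *\<^sub>C lvec n (\<lambda>j. if j = i then 1 else 0))"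
proof (rule bcontfun_eqI)
  fix k
  have "(\<Sum>i<n. z i * (if k < n then if k = i then 1 else 0 else 0)) = (\<Sum>i<n. if k = i then z k else 0)"
    by (intro sum.cong) auto
  then show "apply_bcontfun (lvec n z) k = apply_bcontfun (\<Sum>i<n. z i *\<^sub>C lvec n (\<lambda>j. if j = i then 1 else 0)) k"
    by (simp add: apply_bcontfun_sum apply_bcontfun_scaleC scaleC_complex_def cong: sum.cong)
qed

lemma linfty_n_eq_range: "linfty_n n = range (\<lambda>z. \<Sum>i<n. z i *\<^sub>C lvec n (\<lambda>j. if j = i then 1 else 0))"
proof -
  have "linfty_n n = range (lvec n)"
  proof (intro equalityI subsetI)
    fix x assume "x \<in> linfty_n n"
    then show "x \<in> range (lvec n)" by (intro range_eqI) (rule lvec_apply[symmetric])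
  qed (auto simp: lvec_in_linfty_n)
  also have "lvec n = (\<lambda>z. \<Sum>i<n. z i *\<^sub>C lvec n (\<lambda>j. if j = i then 1 else 0))"
    by (rule ext) (rule lvec_lincomb)
  finally show ?thesis .
qed

lemma fin_dim_linfty_n: "fin_dim_subspace (linfty_n n)"
  unfolding linfty_n_eq_range by (rule fin_dim_subspace_family)

text \<open>The family gives the embedding directly; the lower estimate also makes the vectors
  distinct and independent, which yields the exact dimension \<open>n\<close>.\<close>

lemma contains_linfty_n_of_families:
  assumes fam: "\<And>n. \<exists>y::nat \<Rightarrow> 'a::complex_banach. linf_family K n y"
  shows "contains_linfty_n_uniformly K TYPE('a)"
  unfolding contains_linfty_n_uniformly_def
proof
  fix n
  obtain y :: "nat \<Rightarrow> 'a" where y: "linf_family K n y" using fam by blast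
  then have up: "\<And>z. (\<And>i. i < n \<Longrightarrow> cmod (z i) \<le> 1) \<Longrightarrow> norm (\<Sum>i<n. z i *\<^sub>C y i) \<le> K"
    and low: "\<And>z i. i < n \<Longrightarrow> cmod (z i) \<le> norm (\<Sum>j<n. z j *\<^sub>C y j)"
    by (auto simp: linf_family_def)
  define v where "v x = (\<Sum>i<n. apply_bcontfun x i *\<^sub>C y i)" for x
  let ?E = "v ` linfty_n n"
  have iso: "lin_iso_on (linfty_n n) ?E v \<and> distortion_on (linfty_n n) ?E v \<le> K * 1"
  proof (rule lin_iso_of_bounds[where a = K and b = 1])
    show "cvec.subspace (linfty_n n)" by (rule fin_dim_subspace_subspace[OF fin_dim_linfty_n])
    show "v (x + x') = v x + v x'" for x x' by (simp add: v_def scaleC_add_left sum.distrib)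
    show "v (c *\<^sub>C x) = c *\<^sub>C v x" for c x
      by (simp add: v_def cvec.scale_sum_right scaleC_scaleC apply_bcontfun_scaleC scaleC_complex_def)
    show "norm (v x) \<le> K" if "norm x \<le> 1" for x
      unfolding v_def by (rule up) (rule order_trans[OF norm_bounded that])
    show "norm x \<le> 1 * norm (v x)" if "x \<in> linfty_n n" for x
    proof -
      have "norm (lvec n (apply_bcontfun x)) \<le> norm (v x)"
        unfolding v_def using low[of _ "apply_bcontfun x"] by (intro norm_lvec_le) auto
      then show ?thesis using lvec_apply[OF that] by simp
    qed
  qed simp
  have E: "?E = range (\<lambda>z. \<Sum>i<n. z i *\<^sub>C y i)"
  proof (intro equalityI subsetI)
    fix w assume "w \<in> range (\<lambda>z. \<Sum>i<n. z i *\<^sub>C y i)"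
    then obtain z where "w = (\<Sum>i<n. z i *\<^sub>C y i)" by auto
    then have "w = v (lvec n z)" by (simp add: v_def)
    then show "w \<in> ?E" using lvec_in_linfty_n by blast
  qed (auto simp: v_def)
  have zero: "z i = 0" if "(\<Sum>j<n. z j *\<^sub>C y j) = 0" "i < n" for z i
    using low[OF that(2), of z] that(1) by simp
  have inj: "inj_on y {..<n}"
  proof (rule inj_onI)
    fix i j assume ij: "i \<in> {..<n}" "j \<in> {..<n}" "y i = y j"
    show "i = j"
    proof (rule ccontr)
      assume "i \<noteq> j"
      let ?z = "\<lambda>k. if k = i then 1 else if k = j then - 1 else (0::complex)"
      have "(\<Sum>k<n. ?z k *\<^sub>C y k) = (\<Sum>k<n. (if k = i then y i else 0) + (if k = j then - y j else 0))"
        using \<open>i \<noteq> j\<close> by (intro sum.cong) (auto simp: scaleC_one scaleC_minus_left)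
      also have "\<dots> = 0" using ij by (simp add: sum.distrib)
      finally show False using zero[of ?z i] ij by auto
    qed
  qed
  have "\<not> cvec.dependent (y ` {..<n})"
  proof
    assume "cvec.dependent (y ` {..<n})"
    then obtain u k where u: "k < n" "u (y k) \<noteq> 0" "(\<Sum>v\<in>y ` {..<n}. u v *\<^sub>C v) = 0"
      using cvec.dependent_finite[of "y ` {..<n}"] by auto
    then have "(\<Sum>i<n. u (y i) *\<^sub>C y i) = 0" by (simp add: sum.reindex[OF inj] comp_def)
    then show False using zero[of "\<lambda>i. u (y i)" k] u by simp
  qed
  then have "cvec.dim ?E = n"
    unfolding E span_family[symmetric]
    by (simp add: cvec.dim_eq_card_independent card_image[OF inj])
  then show "\<exists>(E::'a set) v. fin_dim_subspace E \<and> cvec.dim E = n \<and>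
      lin_iso_on (linfty_n n) E v \<and> distortion_on (linfty_n n) E v \<le> K"
    using iso E fin_dim_subspace_family[of y n] by (intro exI[of _ ?E] exI[of _ v]) simp
qed

text \<open>Every vector of the compact unit sphere of \<open>E\<close> has a coordinate above
  \<open>r\<close> in modulus, an open condition. A finite subcover leaves finitely many
  coordinates, and homogeneity extends this to all of \<open>E\<close>.\<close>

lemma fin_dim_truncation:
  fixes E :: "linfty set"
  assumes E: "fin_dim_subspace E" and r: "r < 1"
  shows "\<exists>n. \<forall>x\<in>E. x \<noteq> 0 \<longrightarrow> (\<exists>i<n. r * norm x < cmod (apply_bcontfun x i))"
proof -
  define U where "U i = {x :: linfty. r < cmod (apply_bcontfun x i)}" for i
  have op: "open (U i)" for i
  proof -
    have "continuous_on UNIV (\<lambda>x :: linfty. apply_bcontfun x i)"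
      unfolding continuous_on_iff
      using le_less_trans[OF dist_bounded] by blast
    then show ?thesis unfolding U_def by (intro open_Collect_less continuous_intros) 
  qed
  have cover: "{x \<in> E. norm x = 1} \<subseteq> (\<Union>i\<in>UNIV. U i)"
  proof
    fix x assume x: "x \<in> {x \<in> E. norm x = 1}"
    have "\<exists>i. r < cmod (apply_bcontfun x i)"
    proof (rule ccontr)
      assume "\<not> ?thesis"
      then have "norm x \<le> r" by (intro norm_bound) (simp add: not_less)
      then show False using x r by simp
    qed
    then show "x \<in> (\<Union>i\<in>UNIV. U i)" by (simp add: U_def)
  qed
  obtain I where I: "finite I" "{x \<in> E. norm x = 1} \<subseteq> (\<Union>i\<in>I. U i)"
    using compactE_image[OF compact_fin_dim_sphere[OF E] _ cover] op by metis
  obtain n where n: "\<And>i. i \<in> I \<Longrightarrow> i < n"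
    using I(1) by (auto simp: finite_nat_set_iff_bounded)
  have "\<exists>i<n. r * norm x < cmod (apply_bcontfun x i)" if x: "x \<in> E" "x \<noteq> 0" for x
  proof -
    define s where "s = complex_of_real (1 / norm x)"
    have "s *\<^sub>C x \<in> E" using fin_dim_subspace_subspace[OF E] x by (simp add: cvec.subspace_def)
    moreover have "norm (s *\<^sub>C x) = 1" using x by (simp add: norm_scaleC s_def norm_divide)
    ultimately obtain i where i: "i \<in> I" "r < cmod (apply_bcontfun (s *\<^sub>C x) i)"
      using I(2) by (auto simp: U_def)
    then have "r * norm x < cmod (apply_bcontfun x i)"
      using x by (simp add: apply_bcontfun_scaleC scaleC_complex_def s_def norm_mult norm_divide field_simps)
    then show ?thesis using n i by blast
  qed
  then show ?thesis by blast
qed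

text \<open>Restricting vectors of \<open>E\<close> to finitely many coordinates loses at most a
  factor \<open>K\<close> of the norm, and the embedding of these coordinates costs another
  one.\<close>

lemma finitely_representable_of_families:
  assumes fam: "\<And>K n. K > 1 \<Longrightarrow> \<exists>y::nat \<Rightarrow> 'a::complex_banach. linf_family K n y"
  shows "finitely_representable TYPE(linfty) TYPE('a)"
  unfolding finitely_representable_def
proof (intro allI impI)
  fix E :: "linfty set" and \<epsilon> :: real assume E: "fin_dim_subspace E" and \<epsilon>: "\<epsilon> > 0"
  \<comment> \<open>The distortion must be strictly below \<open>1 + \<epsilon>\<close>, so
    \<open>K * K\<close> is placed at \<open>1 + \<epsilon> / 2\<close>.\<close>
  define K where "K = sqrt (1 + \<epsilon> / 2)"
  have K: "K > 1" "K * K < 1 + \<epsilon>" using \<epsilon> by (auto simp: K_def)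
  obtain n where n: "\<And>x. x \<in> E \<Longrightarrow> x \<noteq> 0 \<Longrightarrow> \<exists>i<n. 1 / K * norm x < cmod (apply_bcontfun x i)"
    using fin_dim_truncation[OF E, of "1 / K"] K by auto
  obtain y :: "nat \<Rightarrow> 'a" where y: "linf_family K n y" using fam[OF K(1)] by blast
  then have up: "\<And>z. (\<And>i. i < n \<Longrightarrow> cmod (z i) \<le> 1) \<Longrightarrow> norm (\<Sum>i<n. z i *\<^sub>C y i) \<le> K"
    and low: "\<And>z i. i < n \<Longrightarrow> cmod (z i) \<le> norm (\<Sum>j<n. z j *\<^sub>C y j)"
    by (auto simp: linf_family_def)
  define T where "T x = (\<Sum>i<n. apply_bcontfun x i *\<^sub>C y i)" for x
  have add: "T (x + x') = T x + T x'" for x x' by (simp add: T_def scaleC_add_left sum.distrib)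
  have scale: "T (c *\<^sub>C x) = c *\<^sub>C T x" for c x
    by (simp add: T_def cvec.scale_sum_right scaleC_scaleC apply_bcontfun_scaleC scaleC_complex_def)
  have iso: "lin_iso_on E (T ` E) T \<and> distortion_on E (T ` E) T \<le> K * K"
  proof (rule lin_iso_of_bounds[where a = K and b = K])
    show "cvec.subspace E" by (rule fin_dim_subspace_subspace[OF E])
    show "norm (T x) \<le> K" if "norm x \<le> 1" for x
      unfolding T_def by (rule up) (rule order_trans[OF norm_bounded that])
    show "norm x \<le> K * norm (T x)" if x: "x \<in> E" for x
    proof (cases "x = 0")
      case False
      then obtain i where "i < n" "1 / K * norm x < cmod (apply_bcontfun x i)" using n x by blast
      then have "1 / K * norm x \<le> norm (T x)" unfolding T_def using low by (meson less_imp_le order_trans)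
      then show ?thesis using K by (simp add: field_simps)
    qed (use K in simp)
  qed (use K add scale in auto)
  obtain k and e :: "nat \<Rightarrow> linfty" where e: "E = range (\<lambda>z. \<Sum>i<k. z i *\<^sub>C e i)"
    using fin_dim_basis[OF E] by blast
  have T0: "T 0 = 0" using scale[of 0 0] by simp
  have "T (\<Sum>i\<in>A. z i *\<^sub>C e i) = (\<Sum>i\<in>A. z i *\<^sub>C T (e i))" for z and A :: "nat set"
    by (induction A rule: infinite_finite_induct) (auto simp: T0 add scale)
  then have "T ` E = range (\<lambda>z. \<Sum>i<k. z i *\<^sub>C T (e i))" by (simp add: e image_image)
  then have "fin_dim_subspace (T ` E)" by (simp add: fin_dim_subspace_family)
  then show "\<exists>(F::'a set) T. fin_dim_subspace F \<and> lin_iso_on E F T \<and> distortion_on E F T < 1 + \<epsilon>"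
    using iso K by (intro exI[of _ "T ` E"] exI[of _ T]) auto
qed

text \<open>Images of the unit vectors, rescaled by the norm \<open>b\<close> of the inverse, have
  norm at least 1, and their combinations are bounded by the distortion. As \<open>onorm_on\<close>
  is a real supremum, both suprema are first shown to be finite, by the triangle inequality for
  \<open>v\<close> and by independence for the inverse.\<close>

lemma unconditional_family_of_lin_iso:
  fixes v :: "linfty \<Rightarrow> 'a::complex_normed_vector"
  assumes iso: "lin_iso_on (linfty_n n) E v" and dist: "distortion_on (linfty_n n) E v \<le> K"
    and n: "n > 0"
  shows "\<exists>y::nat \<Rightarrow> 'a. (\<forall>i<n. norm (y i) \<ge> 1) \<and>
    (\<forall>z. (\<forall>i<n. cmod (z i) \<le> 1) \<longrightarrow> norm (\<Sum>i<n. z i *\<^sub>C y i) \<le> K)"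
proof -
  let ?L = "linfty_n n"
  have sub: "cvec.subspace ?L" by (rule fin_dim_subspace_subspace[OF fin_dim_linfty_n])
  have add: "\<And>x y. x \<in> ?L \<Longrightarrow> y \<in> ?L \<Longrightarrow> v (x + y) = v x + v y"
    and scale: "\<And>c x. x \<in> ?L \<Longrightarrow> v (c *\<^sub>C x) = c *\<^sub>C v x"
    and bij: "bij_betw v ?L E"
    using iso by (auto simp: lin_iso_on_def)
  have inj: "inj_on v ?L" and img: "v ` ?L = E" using bij by (auto simp: bij_betw_def)
  have zero: "0 \<in> ?L" "v 0 = 0" using sub scale[of 0 0] by (auto simp: cvec.subspace_def)
  define e where "e i = lvec n (\<lambda>j. if j = i then 1 else 0)" for i
  have eL: "e i \<in> ?L" for i by (simp add: e_def lvec_in_linfty_n)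
  have "v (\<Sum>i\<in>A. z i *\<^sub>C e i) = (\<Sum>i\<in>A. z i *\<^sub>C v (e i))" for z and A :: "nat set"
  proof (induction A rule: infinite_finite_induct)
    case (insert a A)
    have "z a *\<^sub>C e a \<in> ?L" "(\<Sum>i\<in>A. z i *\<^sub>C e i) \<in> ?L"
      using eL sub by (auto intro!: cvec.subspace_scale cvec.subspace_sum)
    then show ?case using insert by (simp add: add scale eL)
  qed (auto simp: zero)
  then have vl: "v (lvec n z) = (\<Sum>i<n. z i *\<^sub>C v (e i))" for z
    by (subst lvec_lincomb) (simp add: e_def)
  have x_le: "norm (v x) \<le> (\<Sum>i<n. norm (v (e i)))" if x: "x \<in> ?L" "norm x \<le> 1" for x
  proof -
    have "norm (v x) = norm (\<Sum>i<n. apply_bcontfun x i *\<^sub>C v (e i))"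
      using vl[of "apply_bcontfun x"] lvec_apply[OF x(1)] by simp
    also have "\<dots> \<le> (\<Sum>i<n. cmod (apply_bcontfun x i) * norm (v (e i)))"
      by (rule order_trans[OF norm_sum]) (simp add: norm_scaleC)
    also have "\<dots> \<le> (\<Sum>i<n. 1 * norm (v (e i)))"
      by (intro sum_mono mult_right_mono order_trans[OF norm_bounded x(2)]) auto
    finally show ?thesis by simp
  qed
  define a where "a = onorm_on ?L v"
  define b where "b = onorm_on E (inv_into ?L v)"
  have a: "norm (v x) \<le> a" if "x \<in> ?L" "norm x \<le> 1" for x
    unfolding a_def onorm_on_def using that x_le by (intro cSUP_upper bdd_aboveI2) auto
  have "\<forall>i<n. z i = 0" if "(\<Sum>i<n. z i *\<^sub>C v (e i)) = 0" for z
  proof -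
    have "v (lvec n z) = v 0" using that vl zero by simp
    then have "lvec n z = 0" using inj lvec_in_linfty_n zero(1) by (auto dest: inj_onD)
    then show ?thesis using apply_lvec[of n z] by (metis zero_bcontfun.rep_eq)
  qed
  then obtain c where c: "c > 0" "\<And>z i. i < n \<Longrightarrow> c * cmod (z i) \<le> norm (\<Sum>j<n. z j *\<^sub>C v (e j))"
    using independent_family_bound[where n = n and y = "\<lambda>i. v (e i)"] by blast
  have "norm (inv_into ?L v w) \<le> 1 / c" if w: "w \<in> E" "norm w \<le> 1" for w
  proof -
    define x where "x = inv_into ?L v w"
    have x: "x \<in> ?L" "v x = w"
      using w img by (auto simp: x_def inv_into_into f_inv_into_f)
    have "cmod (apply_bcontfun x i) \<le> 1 / c" if "i < n" for i
      using c(2)[OF that, of "apply_bcontfun x"] vl[of "apply_bcontfun x"] lvec_apply[OF x(1)] x(2) w(2) c(1)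
      by (simp add: field_simps)
    then have "norm (lvec n (apply_bcontfun x)) \<le> 1 / c" using c(1) by (intro norm_lvec_le) auto
    then show ?thesis using lvec_apply[OF x(1)] by (simp add: x_def)
  qed
  then have b: "norm (inv_into ?L v w) \<le> b" if "w \<in> E" "norm w \<le> 1" for w
    unfolding b_def onorm_on_def using that by (intro cSUP_upper bdd_aboveI2) auto
  have be: "1 \<le> b * norm (v (e i))" if i: "i < n" for i
  proof -
    have "apply_bcontfun (e i) i = 1" using i by (simp add: e_def)
    then have "e i \<noteq> 0" by auto
    have ne: "v (e i) \<noteq> 0"
    proof
      assume "v (e i) = 0"
      then have "e i = 0" using inj eL[of i] zero by (metis inj_onD)
      then show False using \<open>e i \<noteq> 0\<close> by simp
    qed
    define s where "s = complex_of_real (1 / norm (v (e i)))"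
    have sL: "s *\<^sub>C e i \<in> ?L" using eL sub by (intro cvec.subspace_scale)
    have "norm (v (s *\<^sub>C e i)) = 1" using ne by (simp add: scale eL norm_scaleC s_def norm_divide)
    then have "norm (inv_into ?L v (v (s *\<^sub>C e i))) \<le> b" using sL img by (intro b) auto
    then have "norm (s *\<^sub>C e i) \<le> b" by (simp add: inv_into_f_f[OF inj sL])
    moreover have "1 \<le> norm (e i)"
      using norm_bounded[of "e i" i] i by (simp add: e_def)
    ultimately have "1 / norm (v (e i)) \<le> b"
      using ne by (simp add: norm_scaleC s_def norm_divide)
         (meson divide_right_mono norm_ge_zero order_trans)
    then show ?thesis using ne by (simp add: field_simps)
  qed
  have b0: "b \<ge> 0" using b[of 0] zero img norm_ge_zero order_trans by (metis image_eqI norm_zero zero_le_one)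
  define y where "y i = b *\<^sub>R v (e i)" for i
  have "norm (\<Sum>i<n. z i *\<^sub>C y i) \<le> K" if "\<forall>i<n. cmod (z i) \<le> 1" for z
  proof -
    have "norm (\<Sum>i<n. z i *\<^sub>C y i) = b * norm (v (lvec n z))"
      using b0 by (simp add: y_def scaleC_scaleR vl flip: scaleR_sum_right)
    also have "\<dots> \<le> b * a"
      using that b0 by (intro mult_left_mono a lvec_in_linfty_n norm_lvec_le) auto
    also have "\<dots> \<le> K" using dist by (simp add: distortion_on_def a_def b_def mult.commute)
    finally show ?thesis .
  qed
  moreover have "1 \<le> norm (y i)" if "i < n" for i using be[OF that] b0 by (simp add: y_def)
  ultimately show ?thesis by blast
qed

section \<open>Cotype, summing operators and sup norm families\<close>

lemma bdd_above_dual_sums: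
  "bdd_above ((\<lambda>f. \<Sum>i\<in>A. cmod (f (x i))) ` {f\<in>dual. onorm f \<le> 1})"
  by (rule bdd_aboveI2[where M = "\<Sum>i\<in>A. norm (x i)"]) (auto intro!: sum_mono dual_unit_ball_le)

lemma zero_in_dual: "(\<lambda>_. 0) \<in> dual" "onorm (\<lambda>_::'a::complex_normed_vector. 0::complex) \<le> 1"
  by (auto simp: dual_def bounded_clinear_def scaleC_complex_def bounded_linear_zero onorm_zero)

lemma norm_rademacher_sum_le:
  fixes x :: "nat \<Rightarrow> 'a::complex_normed_vector"
  shows "norm (\<Sum>n\<in>A. rademacher n t *\<^sub>R x n) \<le> (SUP f\<in>{f\<in>dual. onorm f \<le> 1}. \<Sum>n\<in>A. cmod (f (x n)))"
proof -
  obtain f where f: "f \<in> dual" "onorm f \<le> 1"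
      "f (\<Sum>n\<in>A. rademacher n t *\<^sub>R x n) = norm (\<Sum>n\<in>A. rademacher n t *\<^sub>R x n)"
    using hahn_banach by blast
  note lin = dualD(3)[OF f(1)]
  have "norm (\<Sum>n\<in>A. rademacher n t *\<^sub>R x n) = cmod (\<Sum>n\<in>A. rademacher n t *\<^sub>R f (x n))"
    using f(3) unfolding linear_sum[OF lin] linear_scale[OF lin] by (metis abs_norm_cancel norm_of_real)
  also have "\<dots> \<le> (\<Sum>n\<in>A. \<bar>rademacher n t\<bar> * cmod (f (x n)))"
    by (rule order_trans[OF norm_sum]) simp
  also have "\<dots> \<le> (\<Sum>n\<in>A. 1 * cmod (f (x n)))"
    by (intro sum_mono mult_right_mono) (auto simp: rademacher_def sgn_if)
  also have "\<dots> \<le> (SUP f\<in>{f\<in>dual. onorm f \<le> 1}. \<Sum>n\<in>A. cmod (f (x n)))"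
    using f by (simp, intro cSUP_upper bdd_above_dual_sums) auto
  finally show ?thesis .
qed

text \<open>For each \<open>t\<close> the norm of the Rademacher sum is bounded by the weak sum of
  the vectors, hence so is the root of its mean square.\<close>

lemma p1_summing_of_cotype:
  assumes "has_cotype p TYPE('a::complex_banach)"
  shows "p1_summing p (id :: 'a \<Rightarrow> 'a)"
proof -
  obtain C where C: "C > 0" and cot: "\<And>N (x::nat \<Rightarrow> 'a).
      (\<Sum>n=1..N. norm (x n) powr p) powr (1 / p)
        \<le> C * sqrt (LINT t:{0..1}|lborel. (norm (\<Sum>n=1..N. rademacher n t *\<^sub>R x n))\<^sup>2)"
    using assms by (auto simp: has_cotype_def)
  have "(\<Sum>i=1..n. norm (id (x i)) powr p) powr (1 / p)
      \<le> C * (SUP f\<in>{f\<in>dual. onorm f \<le> 1}. \<Sum>i=1..n. cmod (f (x i)))" for n and x :: "nat \<Rightarrow> 'a"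
  proof -
    define S where "S = (SUP f\<in>{f\<in>dual. onorm f \<le> 1}. \<Sum>i=1..n. cmod (f (x i)))"
    have le: "norm (\<Sum>i=1..n. rademacher i t *\<^sub>R x i) \<le> S" for t
      unfolding S_def by (rule norm_rademacher_sum_le)
    have S: "S \<ge> 0" using le[of 0] norm_ge_zero order_trans by blast
    have "(LINT t:{0..1}|lborel. (norm (\<Sum>i=1..n. rademacher i t *\<^sub>R x i))\<^sup>2)
        \<le> (LINT t:{0..1::real}|lborel. S\<^sup>2)"
      unfolding set_lebesgue_integral_def
    proof (rule integral_mono')
      show "integrable lborel (\<lambda>t. indicator {0..1::real} t *\<^sub>R S\<^sup>2)"
        by (intro integrable_scaleR_left) auto
      show "indicator {0..1} t *\<^sub>R (norm (\<Sum>i=1..n. rademacher i t *\<^sub>R x i))\<^sup>2 \<le> indicator {0..1} t *\<^sub>R S\<^sup>2" for t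
        using le[of t] by (intro scaleR_left_mono power_mono) auto
    qed auto
    also have "\<dots> = S\<^sup>2" by (simp add: set_lebesgue_integral_def)
    finally have "sqrt (LINT t:{0..1}|lborel. (norm (\<Sum>i=1..n. rademacher i t *\<^sub>R x i))\<^sup>2) \<le> S"
      using S by (metis real_sqrt_le_mono real_sqrt_unique)
    then have "C * sqrt (LINT t:{0..1}|lborel. (norm (\<Sum>i=1..n. rademacher i t *\<^sub>R x i))\<^sup>2) \<le> C * S"
      using C by (intro mult_left_mono) auto
    from order_trans[OF cot this] show ?thesis unfolding S_def id_apply .
  qed
  moreover have "bounded_clinear (id :: 'a \<Rightarrow> 'a)"
    by (simp add: bounded_clinear_def id_def bounded_linear_ident)
  ultimately show ?thesis
    unfolding p1_summing_def using C by (intro conjI exI[of _ C] allI)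
qed

text \<open>Phases \<open>z i\<close> that make each \<open>z i * f (y i)\<close> nonnegative turn
  the sum of moduli into the value of \<open>f\<close> at one admissible combination.\<close>

lemma dual_sum_le:
  fixes y :: "nat \<Rightarrow> 'a::complex_normed_vector"
  assumes K: "\<And>z. (\<And>i. i < n \<Longrightarrow> cmod (z i) \<le> 1) \<Longrightarrow> norm (\<Sum>i<n. z i *\<^sub>C y i) \<le> K"
    and f: "f \<in> dual"
  shows "(\<Sum>i<n. cmod (f (y i))) \<le> onorm f * K"
proof -
  \<comment> \<open>For \<open>f (y i) = 0\<close> division by zero gives \<open>z i = 0\<close>,
    which is consistent with the required product.\<close>
  define z where "z i = cnj (f (y i)) / cmod (f (y i))" for i
  have z: "z i * f (y i) = cmod (f (y i))" for i
    using complex_norm_square[of "f (y i)"]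
    by (cases "f (y i) = 0") (simp_all add: z_def power2_eq_square field_simps)
  have eq: "complex_of_real (\<Sum>i<n. cmod (f (y i))) = f (\<Sum>i<n. z i *\<^sub>C y i)"
    by (simp add: linear_sum[OF dualD(3)[OF f]] dualD(2)[OF f] z)
  have "(\<Sum>i<n. cmod (f (y i))) = cmod (complex_of_real (\<Sum>i<n. cmod (f (y i))))"
    by (subst norm_of_real) (simp add: sum_nonneg)
  also have "\<dots> = cmod (f (\<Sum>i<n. z i *\<^sub>C y i))" unfolding eq ..
  also have "\<dots> \<le> onorm f * norm (\<Sum>i<n. z i *\<^sub>C y i)" by (rule onorm[OF dualD(1)[OF f]])
  also have "\<dots> \<le> onorm f * K"
  proof (intro mult_left_mono K)
    show "cmod (z i) \<le> 1" for i by (simp add: z_def norm_divide)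
    show "0 \<le> onorm f" by (rule onorm_pos_le[OF dualD(1)[OF f]])
  qed
  finally show ?thesis .
qed

text \<open>On such a family the strong sum is at least \<open>n powr (1 / p)\<close>, while the
  weak sum is at most \<open>K\<close>; a large \<open>n\<close> contradicts summability.\<close>

lemma not_p1_summing_of_families:
  assumes fam: "\<And>n. n > 0 \<Longrightarrow> \<exists>y::nat \<Rightarrow> 'a::complex_banach. (\<forall>i<n. norm (y i) \<ge> 1) \<and>
      (\<forall>z. (\<forall>i<n. cmod (z i) \<le> 1) \<longrightarrow> norm (\<Sum>i<n. z i *\<^sub>C y i) \<le> K)"
    and p: "p > 0"
  shows "\<not> p1_summing p (id :: 'a \<Rightarrow> 'a)"
proof
  assume "p1_summing p (id :: 'a \<Rightarrow> 'a)"
  then obtain c where c: "c > 0" and sm: "\<And>n (x::nat \<Rightarrow> 'a). (\<Sum>i=1..n. norm (x i) powr p) powr (1 / p)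
        \<le> c * (SUP f\<in>{f\<in>dual. onorm f \<le> 1}. \<Sum>i=1..n. cmod (f (x i)))"
    unfolding p1_summing_def by auto
  have K: "K \<ge> 0"
  proof -
    obtain y :: "nat \<Rightarrow> 'a" where
      "\<forall>z. (\<forall>i<1. cmod (z i) \<le> 1) \<longrightarrow> norm (\<Sum>i<1. z i *\<^sub>C y i) \<le> K"
      using fam[OF zero_less_one] by blast
    from this[rule_format, of "\<lambda>_. 0"] show ?thesis by simp
  qed
  obtain n where n: "(c * K) powr p < real n" using reals_Archimedean2 by blast
  have n0: "n > 0"
  proof (rule ccontr)
    assume "\<not> n > 0"
    then show False using n powr_ge_zero[of "c * K" p] by simp
  qed
  obtain y :: "nat \<Rightarrow> 'a" where y: "\<And>i. i < n \<Longrightarrow> norm (y i) \<ge> 1"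
      "\<And>z. (\<And>i. i < n \<Longrightarrow> cmod (z i) \<le> 1) \<Longrightarrow> norm (\<Sum>i<n. z i *\<^sub>C y i) \<le> K"
    using fam[OF n0] by blast
  \<comment> \<open>The family is indexed from 0 and the sums in \<open>p1_summing\<close> from
    1.\<close>
  define x where "x i = y (i - 1)" for i
  have shift: "(\<Sum>i=1..n. g (x i)) = (\<Sum>i<n. g (y i))" for g :: "'a \<Rightarrow> real"
    by (simp add: x_def sum.atLeast1_atMost_eq)
  have "real n = (\<Sum>i<n. 1)" by simp
  also have "\<dots> \<le> (\<Sum>i<n. norm (y i) powr p)"
    using y(1) p by (intro sum_mono) (simp add: ge_one_powr_ge_zero)
  finally have "real n powr (1 / p) \<le> (\<Sum>i=1..n. norm (x i) powr p) powr (1 / p)"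
    unfolding shift[of "\<lambda>v. norm v powr p"] using p by (intro powr_mono2) auto
  also have "\<dots> \<le> c * (SUP f\<in>{f\<in>dual. onorm f \<le> 1}. \<Sum>i=1..n. cmod (f (x i)))" by (rule sm)
  also have "\<dots> \<le> c * K"
  proof (intro mult_left_mono cSUP_least)
    show "{f\<in>dual. onorm f \<le> 1} \<noteq> ({} :: ('a \<Rightarrow> complex) set)" using zero_in_dual by blast
    fix f :: "'a \<Rightarrow> complex" assume f: "f \<in> {f\<in>dual. onorm f \<le> 1}"
    then have "(\<Sum>i<n. cmod (f (y i))) \<le> onorm f * K" using y(2) by (intro dual_sum_le) auto
    also have "\<dots> \<le> 1 * K" using f K by (intro mult_right_mono) auto
    finally show "(\<Sum>i=1..n. cmod (f (x i))) \<le> K" unfolding shift[of "\<lambda>v. cmod (f v)"] by simp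
  qed (use c in simp)
  finally have "(real n powr (1 / p)) powr p \<le> (c * K) powr p" using p by (intro powr_mono2) auto
  then show False using n n0 p by (simp add: powr_powr)
qed

section \<open>Gaps of Dirichlet series\<close>

lemma norm_inverse_powr: "cmod (1 / of_nat (Suc n) powr s) = real (Suc n) powr (- Re s)"
proof -
  have "cmod (of_nat (Suc n) powr s) = real (Suc n) powr Re s"
    by (subst norm_powr_real_powr) (auto simp del: of_nat_Suc)
  then show ?thesis by (simp only: norm_divide norm_one powr_minus_divide)
qed

lemma summable_Suc_powr_iff: "summable (\<lambda>n. real (Suc n) powr (- s)) \<longleftrightarrow> s > 1"
  using summable_Suc_iff[of "\<lambda>n. real n powr (- s)"] summable_real_powr_iff[of "- s"] by simp

lemma abscissa_abs_conv_le:
  assumes "\<And>s. s > r \<Longrightarrow> summable (\<lambda>n. norm (a (Suc n)) * real (Suc n) powr (- s))"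
  shows "abscissa_abs_conv a \<le> ereal r"
  unfolding abscissa_abs_conv_def
  by (rule Inf_lower) (use assms in \<open>auto simp only: norm_inverse_powr\<close>)

lemma summable_of_abscissa_less:
  assumes "abscissa_abs_conv a < ereal s"
  shows "summable (\<lambda>n. norm (a (Suc n)) * real (Suc n) powr (- s))"
proof -
  obtain r where r: "r < s" "\<And>s. Re s > r \<Longrightarrow> summable (\<lambda>n. norm (a (Suc n)) * cmod (1 / of_nat (Suc n) powr s))"
    using assms unfolding abscissa_abs_conv_def Inf_less_iff by auto
  show ?thesis using r(2)[of "complex_of_real s"] r(1) unfolding norm_inverse_powr by simp
qed

lemma abscissa_abs_conv_dual_le:
  assumes f: "f \<in> dual"
  shows "abscissa_abs_conv (\<lambda>n. f (a n)) \<le> abscissa_abs_conv a"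
  unfolding abscissa_abs_conv_def
proof (intro Inf_superset_mono image_mono subsetI CollectI allI impI)
  fix r s assume r: "r \<in> {r. \<forall>s. Re s > r \<longrightarrow> summable (\<lambda>n. norm (a (Suc n)) * cmod (1 / of_nat (Suc n) powr s))}"
    and s: "r < Re s"
  have "summable (\<lambda>n. onorm f * (norm (a (Suc n)) * cmod (1 / of_nat (Suc n) powr s)))"
    using r s by (intro summable_mult) auto
  then show "summable (\<lambda>n. cmod (f (a (Suc n))) * cmod (1 / of_nat (Suc n) powr s))"
  proof (rule summable_comparison_test')
    fix n
    have "cmod (f (a (Suc n))) * cmod (1 / of_nat (Suc n) powr s)
        \<le> (onorm f * norm (a (Suc n))) * cmod (1 / of_nat (Suc n) powr s)"
      by (intro mult_right_mono onorm[OF dualD(1)[OF f]]) auto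
    then show "norm (cmod (f (a (Suc n))) * cmod (1 / of_nat (Suc n) powr s))
        \<le> onorm f * (norm (a (Suc n)) * cmod (1 / of_nat (Suc n) powr s))"
      by (simp add: mult.assoc)
  qed
qed

lemma weak_abscissa_le: "weak_abscissa_abs_conv a \<le> abscissa_abs_conv a"
  unfolding weak_abscissa_abs_conv_def by (intro SUP_least abscissa_abs_conv_dual_le)

lemma summable_bounded_powr:
  assumes "\<And>n. norm (b n) \<le> M" "s > 1"
  shows "summable (\<lambda>n. norm (b n) * real (Suc n) powr (- s))"
proof (rule summable_comparison_test')
  show "summable (\<lambda>n. M * real (Suc n) powr (- s))"
    using assms(2) by (intro summable_mult) (simp only: summable_Suc_powr_iff)
  show "norm (norm (b n) * real (Suc n) powr (- s)) \<le> M * real (Suc n) powr (- s)" for n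
    using assms(1)[of n] by (simp add: mult_right_mono)
qed

text \<open>Terms of a convergent series are bounded, so raising the exponent by more than 1 gives
  absolute convergence.\<close>

lemma abscissa_abs_conv_finite:
  fixes a :: "nat \<Rightarrow> 'a::complex_banach"
  assumes "abscissa_conv a < \<infinity>"
  shows "abscissa_abs_conv a < \<infinity>"
proof -
  obtain r where r: "\<And>s. Re s > r \<Longrightarrow> summable (\<lambda>n. (1 / of_nat (Suc n) powr s) *\<^sub>C a (Suc n))"
    using assms unfolding abscissa_conv_def Inf_less_iff by auto
  define b where "b n = (1 / of_nat (Suc n) powr complex_of_real (r + 1)) *\<^sub>C a (Suc n)" for n
  have "summable b" unfolding b_def using r[of "complex_of_real (r + 1)"] by simp
  then have "Bseq b" using summable_LIMSEQ_zero convergentI convergent_imp_Bseq by blast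
  then obtain M where M: "\<And>n. norm (b n) \<le> M" by (auto simp: Bseq_def)
  have nb: "norm (b n) = real (Suc n) powr (- (r + 1)) * norm (a (Suc n))" for n
    unfolding b_def norm_scaleC norm_inverse_powr by simp
  have "abscissa_abs_conv a \<le> ereal (r + 2)"
  proof (rule abscissa_abs_conv_le)
    fix s assume "r + 2 < s"
    then have "summable (\<lambda>n. norm (b n) * real (Suc n) powr (- (s - (r + 1))))"
      by (intro summable_bounded_powr[OF M]) simp
    then show "summable (\<lambda>n. norm (a (Suc n)) * real (Suc n) powr (- s))"
      unfolding nb by (simp add: mult_ac flip: powr_add)
  qed
  then show ?thesis by (rule le_less_trans) simp
qed

text \<open>Multiplying the \<open>n\<close>-th coefficient by \<open>n powr (- \<sigma>)\<close>
  translates the abscissas. Hence it is enough to know which powers make a weakly absolutely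
  summable sequence absolutely summable.\<close>

lemma abs_conv_gap_le:
  assumes \<theta>: "\<theta> \<ge> 0"
    and key: "\<And>(b::nat \<Rightarrow> 'a::complex_banach) s. (\<And>f. f \<in> dual \<Longrightarrow> summable (\<lambda>n. cmod (f (b n)))) \<Longrightarrow> s > \<theta> \<Longrightarrow>
      summable (\<lambda>n. norm (b n) * real (Suc n) powr (- s))"
  shows "abs_conv_gap TYPE('a) \<le> ereal \<theta>"
  unfolding abs_conv_gap_def
proof (rule SUP_least)
  fix a :: "nat \<Rightarrow> 'a" assume "a \<in> {a. abscissa_conv a < \<infinity>}"
  then have fin: "abscissa_abs_conv a < \<infinity>" by (intro abscissa_abs_conv_finite) simp
  have step: "abscissa_abs_conv a \<le> ereal (\<sigma> + \<theta>)" if \<sigma>: "weak_abscissa_abs_conv a < ereal \<sigma>" for \<sigma>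
  proof (rule abscissa_abs_conv_le)
    fix s assume s: "\<sigma> + \<theta> < s"
    define b where "b n = real (Suc n) powr (- \<sigma>) *\<^sub>R a (Suc n)" for n
    have "summable (\<lambda>n. cmod (f (b n)))" if f: "f \<in> dual" for f
    proof -
      have "abscissa_abs_conv (\<lambda>n. f (a n)) \<le> weak_abscissa_abs_conv a"
        unfolding weak_abscissa_abs_conv_def by (rule SUP_upper[OF f])
      then have "abscissa_abs_conv (\<lambda>n. f (a n)) < ereal \<sigma>" using \<sigma> by (rule le_less_trans)
      from summable_of_abscissa_less[OF this]
      show ?thesis unfolding b_def by (simp add: linear_scale[OF dualD(3)[OF f]] mult.commute)
    qed
    then have "summable (\<lambda>n. norm (b n) * real (Suc n) powr (- (s - \<sigma>)))"
      using s by (intro key) auto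
    then show "summable (\<lambda>n. norm (a (Suc n)) * real (Suc n) powr (- s))"
      unfolding b_def by (simp add: mult_ac flip: powr_add)
  qed
  have le: "weak_abscissa_abs_conv a \<le> abscissa_abs_conv a" by (rule weak_abscissa_le)
  show "abs_conv_gap_of a \<le> ereal \<theta>"
  proof (cases "weak_abscissa_abs_conv a")
    case (real w)
    obtain A where A: "abscissa_abs_conv a = ereal A"
      using fin le real by (cases "abscissa_abs_conv a") auto
    have "A \<le> w + \<theta>"
    proof (rule field_le_epsilon)
      fix e :: real assume "e > 0"
      then show "A \<le> w + \<theta> + e" using step[of "w + e"] real A by (simp add: algebra_simps)
    qed
    then show ?thesis using real A by (simp add: abs_conv_gap_of_def)
  next
    case PInf
    then show ?thesis using fin le by simp
  next
    \<comment> \<open>Here \<open>step\<close> applies to every real \<open>\<sigma>\<close>, so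
      both abscissas are \<open>- \<infinity>\<close> and the convention gives 0.\<close>
    case MInf
    have "abscissa_abs_conv a = - \<infinity>"
    proof (rule ereal_bot)
      show "abscissa_abs_conv a \<le> ereal B" for B using step[of "B - \<theta>"] MInf by simp
    qed
    then show ?thesis using MInf \<theta> by (simp add: abs_conv_gap_of_def)
  qed
qed

section \<open>Upper estimates of the gap\<close>

lemma weakly_summable_bounded:
  fixes b :: "nat \<Rightarrow> 'a::complex_normed_vector"
  assumes "\<And>f. f \<in> dual \<Longrightarrow> summable (\<lambda>n. cmod (f (b n)))"
  shows "\<exists>M. \<forall>n. norm (b n) \<le> M"
proof -
  obtain M where M: "\<And>f N. f \<in> dual \<Longrightarrow> onorm f \<le> 1 \<Longrightarrow> (\<Sum>n<N. cmod (f (b n))) \<le> M"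
    using uniform_boundedness_weakly_summable[where b = b, OF assms] by blast
  have "norm (b n) \<le> M" for n
  proof -
    obtain f where f: "f \<in> dual" "onorm f \<le> 1" "f (b n) = norm (b n)" using hahn_banach by blast
    have "norm (b n) = cmod (f (b n))" using f(3) by simp
    also have "\<dots> \<le> (\<Sum>k<Suc n. cmod (f (b k)))" by (intro member_le_sum) auto
    finally show ?thesis using M[OF f(1,2), of "Suc n"] by linarith
  qed
  then show ?thesis by blast
qed

lemma abs_conv_gap_le_one: "abs_conv_gap TYPE('a::complex_banach) \<le> 1"
proof -
  have "abs_conv_gap TYPE('a) \<le> ereal 1"
  proof (rule abs_conv_gap_le)
    fix b :: "nat \<Rightarrow> 'a" and s :: real
    assume "\<And>f. f \<in> dual \<Longrightarrow> summable (\<lambda>n. cmod (f (b n)))" and s: "s > 1"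
    then obtain M where "\<And>n. norm (b n) \<le> M" using weakly_summable_bounded by blast
    then show "summable (\<lambda>n. norm (b n) * real (Suc n) powr (- s))"
      using s by (rule summable_bounded_powr)
  qed simp
  then show ?thesis by (simp add: one_ereal_def)
qed

lemma abs_conv_gap_le_p1_summing:
  assumes sm: "p1_summing p (id :: 'a::complex_banach \<Rightarrow> 'a)" and p: "p > 1"
  shows "abs_conv_gap TYPE('a) \<le> ereal (1 - 1 / p)"
proof (rule abs_conv_gap_le)
  show "0 \<le> 1 - 1 / p" using p by simp
  fix b :: "nat \<Rightarrow> 'a" and s :: real
  assume w: "\<And>f. f \<in> dual \<Longrightarrow> summable (\<lambda>n. cmod (f (b n)))" and s: "s > 1 - 1 / p"
  obtain c where c: "c > 0" and sm: "\<And>n (x::nat \<Rightarrow> 'a). (\<Sum>i=1..n. norm (x i) powr p) powr (1 / p)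
        \<le> c * (SUP f\<in>{f\<in>dual. onorm f \<le> 1}. \<Sum>i=1..n. cmod (f (x i)))"
    using sm unfolding p1_summing_def by auto
  obtain M where M: "\<And>f N. f \<in> dual \<Longrightarrow> onorm f \<le> 1 \<Longrightarrow> (\<Sum>n<N. cmod (f (b n))) \<le> M"
    using uniform_boundedness_weakly_summable[where b = b, OF w] by blast
  \<comment> \<open>Uniform boundedness controls the supremum over the dual ball, so the summing
    property makes the \<open>p\<close>-th powers of the norms summable.\<close>
  have sum_le: "(\<Sum>i<n. norm (b i) powr p) \<le> (c * M) powr p" for n
  proof -
    define x where "x i = b (i - 1)" for i
    have shift: "(\<Sum>i=1..n. g (x i)) = (\<Sum>i<n. g (b i))" for g :: "'a \<Rightarrow> real"
      by (simp add: x_def sum.atLeast1_atMost_eq)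
    have "(\<Sum>i=1..n. norm (x i) powr p) powr (1 / p)
        \<le> c * (SUP f\<in>{f\<in>dual. onorm f \<le> 1}. \<Sum>i=1..n. cmod (f (x i)))" by (rule sm)
    also have "\<dots> \<le> c * M"
    proof (intro mult_left_mono cSUP_least)
      show "{f\<in>dual. onorm f \<le> 1} \<noteq> ({} :: ('a \<Rightarrow> complex) set)" using zero_in_dual by blast
      fix f :: "'a \<Rightarrow> complex" assume "f \<in> {f\<in>dual. onorm f \<le> 1}"
      then show "(\<Sum>i=1..n. cmod (f (x i))) \<le> M" unfolding shift[of "\<lambda>v. cmod (f v)"] by (intro M) auto
    qed (use c in simp)
    finally have "((\<Sum>i=1..n. norm (x i) powr p) powr (1 / p)) powr p \<le> (c * M) powr p"
      using p by (intro powr_mono2) auto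
    then show ?thesis using p unfolding shift[of "\<lambda>v. norm v powr p"] by (simp add: powr_powr sum_nonneg)
  qed
  have sum1: "summable (\<lambda>n. norm (b n) powr p)"
    by (rule summableI_nonneg_bounded[OF _ sum_le]) simp
  \<comment> \<open>The conjugate exponent of \<open>p\<close>: as \<open>1 / q\<close> is
    \<open>1 - 1 / p\<close>, the bound \<open>s > 1 - 1 / p\<close> means \<open>s * q > 1\<close>,
    the range in which the second term of Young's inequality is summable.\<close>
  define q where "q = p / (p - 1)"
  have q: "q > 1" "1 / p + 1 / q = 1" using p by (auto simp: q_def field_simps)
  have "s * q > 1"
  proof -
    have "(1 - 1 / p) * q = 1" using p by (simp add: q_def field_simps)
    moreover have "(1 - 1 / p) * q < s * q" using s q by (intro mult_strict_right_mono) auto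
    ultimately show ?thesis by simp
  qed
  then have sum2: "summable (\<lambda>n. real (Suc n) powr (- (s * q)))" by (simp only: summable_Suc_powr_iff)
  show "summable (\<lambda>n. norm (b n) * real (Suc n) powr (- s))"
  proof (rule summable_comparison_test')
    show "summable (\<lambda>n. norm (b n) powr p / p + real (Suc n) powr (- (s * q)) / q)"
      by (intro summable_add summable_divide sum1 sum2)
    fix n
    have "norm (b n) * real (Suc n) powr (- s)
        \<le> norm (b n) powr p / p + (real (Suc n) powr (- s)) powr q / q"
      using p q by (intro Youngs_inequality) auto
    then show "norm (norm (b n) * real (Suc n) powr (- s))
        \<le> norm (b n) powr p / p + real (Suc n) powr (- (s * q)) / q"
      by (simp add: powr_powr)
  qed
qed

section \<open>Dyadic blocks and the lower estimate of the gap\<close>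

lemma sum_dyadic_blocks:
  "(\<Sum>j=1..<2 ^ K. g j) = (\<Sum>k<K. \<Sum>i<2 ^ k. g (2 ^ k + i :: nat) :: real)"
proof (induction K)
  case (Suc K)
  have "(\<Sum>j=1..<2 ^ Suc K. g j) = (\<Sum>j=1..<2 ^ K. g j) + (\<Sum>j=2 ^ K..<2 ^ K + 2 ^ K. g j)"
    by (subst sum.atLeastLessThan_concat) (auto simp: mult_2)
  also have "(\<Sum>j=2 ^ K..<2 ^ K + 2 ^ K. g j) = (\<Sum>i<2 ^ K. g (2 ^ K + i))"
    using sum.shift_bounds_nat_ivl[of g 0 "2 ^ K" "2 ^ K"]
    by (simp add: lessThan_atLeast0 add.commute)
  finally show ?case using Suc.IH by simp
qed simp

text \<open>For \<open>j \<ge> 1\<close> this is the integer part of the base 2 logarithm of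
  \<open>j\<close>.\<close>

definition dyadic_level :: "nat \<Rightarrow> nat" where
  "dyadic_level j = (LEAST k. j < 2 ^ Suc k)"

lemma dyadic_level_block:
  assumes "i < 2 ^ k"
  shows "dyadic_level (2 ^ k + i) = k"
  unfolding dyadic_level_def
proof (rule Least_equality)
  show "2 ^ k + i < 2 ^ Suc k" using assms by simp
  fix l :: nat assume "2 ^ k + i < 2 ^ Suc l"
  then have "(2::nat) ^ k < 2 ^ Suc l" by linarith
  then show "k \<le> l" by (simp only: power_strict_increasing_iff[of "2::nat"])
qed

lemma dyadic_level_bounds:
  assumes "j \<ge> 1"
  shows "2 ^ dyadic_level j \<le> j" "j < 2 ^ Suc (dyadic_level j)"
proof -
  have "j < 2 ^ Suc j" using less_exp[of "Suc j"] by linarith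
  then show "j < 2 ^ Suc (dyadic_level j)" unfolding dyadic_level_def by (rule LeastI)
  show "2 ^ dyadic_level j \<le> j"
  proof (cases "dyadic_level j")
    case 0
    then show ?thesis using assms by simp
  next
    case (Suc l)
    then show ?thesis
      using not_less_Least[of l "\<lambda>k. j < 2 ^ Suc k"] by (simp add: dyadic_level_def)
  qed
qed

text \<open>Block \<open>k\<close> carries a family of \<open>2 ^ k\<close> vectors. A functional
  sees at most \<open>onorm f * K\<close> in each block, so any positive exponent makes the scalar
  series converge absolutely; the norms are at least 1, so the exponent 1 still gives
  divergence.\<close>

lemma abs_conv_gap_ge_one:
  assumes fam: "\<And>n. \<exists>y::nat \<Rightarrow> 'a::complex_banach. linf_family K n y"
  shows "abs_conv_gap TYPE('a) \<ge> 1"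
proof -
  obtain Y :: "nat \<Rightarrow> nat \<Rightarrow> 'a" where Y: "\<And>n. linf_family K n (Y n)" using fam by metis
  have up: "norm (\<Sum>i<n. z i *\<^sub>C Y n i) \<le> K" if "\<And>i. i < n \<Longrightarrow> cmod (z i) \<le> 1" for z n
    using Y[of n] that by (auto simp: linf_family_def)
  have K: "K \<ge> 0" using up[of 0 "\<lambda>_. 0"] by simp
  have norms: "1 \<le> norm (Y n i)" "norm (Y n i) \<le> K" if i: "i < n" for n i
  proof -
    let ?z = "\<lambda>j. if j = i then 1 else (0::complex)"
    have "(\<Sum>j<n. ?z j *\<^sub>C Y n j) = (\<Sum>j<n. if j = i then Y n i else 0)"
      by (intro sum.cong) (auto simp: scaleC_one)
    also have "\<dots> = Y n i" using i by simp
    finally have eq: "(\<Sum>j<n. ?z j *\<^sub>C Y n j) = Y n i" .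
    show "norm (Y n i) \<le> K" using up[of n ?z] unfolding eq by simp
    have "cmod (?z i) \<le> norm (\<Sum>j<n. ?z j *\<^sub>C Y n j)"
      using Y[of n, unfolded linf_family_def, THEN conjunct2, rule_format, OF i, of ?z] .
    then show "1 \<le> norm (Y n i)" unfolding eq by simp
  qed
  \<comment> \<open>The index \<open>2 ^ k + i\<close> with \<open>i < 2 ^ k\<close> receives the
    \<open>i\<close>-th vector of the family of length \<open>2 ^ k\<close>.\<close>
  define a where "a j = Y (2 ^ dyadic_level j) (j - 2 ^ dyadic_level j)" for j
  have a_block: "a (2 ^ k + i) = Y (2 ^ k) i" if "i < 2 ^ k" for k i
    using dyadic_level_block[OF that] by (simp add: a_def)
  have idx: "Suc n - 2 ^ dyadic_level (Suc n) < 2 ^ dyadic_level (Suc n)" for n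
    using dyadic_level_bounds[of "Suc n"] by simp
  have a_norm: "1 \<le> norm (a (Suc n))" "norm (a (Suc n)) \<le> K" for n
    unfolding a_def using norms idx by blast+
  have conv: "abscissa_conv a < \<infinity>"
  proof -
    have "abscissa_conv a \<le> ereal 1"
      unfolding abscissa_conv_def
    proof (intro Inf_lower imageI CollectI allI impI)
      fix s :: complex assume "1 < Re s"
      then have "summable (\<lambda>n. norm (a (Suc n)) * real (Suc n) powr (- Re s))"
        by (intro summable_bounded_powr[of "\<lambda>n. a (Suc n)" K] a_norm)
      then have "summable (\<lambda>n. norm ((1 / of_nat (Suc n) powr s) *\<^sub>C a (Suc n)))"
        unfolding norm_scaleC norm_inverse_powr by (simp only: mult.commute)
      then show "summable (\<lambda>n. (1 / of_nat (Suc n) powr s) *\<^sub>C a (Suc n))"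
        by (rule summable_norm_cancel)
    qed
    then show ?thesis by (rule le_less_trans) simp
  qed
  have weak: "weak_abscissa_abs_conv a \<le> ereal 0"
    unfolding weak_abscissa_abs_conv_def
  proof (intro SUP_least abscissa_abs_conv_le)
    fix f :: "'a \<Rightarrow> complex" and s :: real assume f: "f \<in> dual" and s: "0 < s"
    let ?g = "\<lambda>j. cmod (f (a j)) * real j powr (- s)"
    \<comment> \<open>On block \<open>k\<close> the weights \<open>j powr (- s)\<close> are at most
      \<open>d ^ k\<close>.\<close>
    define d where "d = 2 powr (- s)"
    have d: "0 < d" "d < 1" using s by (auto simp: d_def powr_less_one)
    have f0: "0 \<le> onorm f" by (rule onorm_pos_le[OF dualD(1)[OF f]])
    have block: "(\<Sum>i<2 ^ k. ?g (2 ^ k + i)) \<le> (onorm f * K) * d ^ k" for k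
    proof -
      have "(\<Sum>i<2 ^ k. ?g (2 ^ k + i)) \<le> (\<Sum>i<2 ^ k. cmod (f (Y (2 ^ k) i)) * d ^ k)"
      proof (rule sum_mono)
        fix i :: nat assume i: "i \<in> {..<2 ^ k}"
        have "real (2 ^ k + i) powr (- s) \<le> (2 ^ k) powr (- s)"
          using s by (intro powr_mono2') auto
        also have "\<dots> = d ^ k"
          by (simp add: d_def powr_powr mult.commute flip: powr_realpow)
        finally show "?g (2 ^ k + i) \<le> cmod (f (Y (2 ^ k) i)) * d ^ k"
          using i by (simp only: a_block lessThan_iff) (intro mult_left_mono, auto)
      qed
      also have "\<dots> = (\<Sum>i<2 ^ k. cmod (f (Y (2 ^ k) i))) * d ^ k" by (simp add: sum_distrib_right)
      also have "\<dots> \<le> (onorm f * K) * d ^ k"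
        using d by (intro mult_right_mono dual_sum_le[OF _ f] up) auto
      finally show ?thesis .
    qed
    show "summable (\<lambda>n. norm (f (a (Suc n))) * real (Suc n) powr (- s))"
    proof (rule summableI_nonneg_bounded)
      fix N
      have "(\<Sum>n<N. ?g (Suc n)) = (\<Sum>j=1..<Suc N. ?g j)"
        using sum.shift_bounds_Suc_ivl[of ?g 0 N] by (simp add: lessThan_atLeast0)
      also have "\<dots> \<le> (\<Sum>j=1..<2 ^ N. ?g j)"
        using Suc_leI[OF less_exp[of N]] by (intro sum_mono2 ivl_subset[THEN iffD2]) auto
      also have "\<dots> = (\<Sum>k<N. \<Sum>i<2 ^ k. ?g (2 ^ k + i))" by (rule sum_dyadic_blocks)
      also have "\<dots> \<le> (\<Sum>k<N. (onorm f * K) * d ^ k)" by (intro sum_mono block)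
      also have "\<dots> = (onorm f * K) * (\<Sum>k<N. d ^ k)" by (simp add: sum_distrib_left)
      also have "\<dots> \<le> (onorm f * K) * (\<Sum>k. d ^ k)"
        using f0 K d by (intro mult_left_mono sum_le_suminf summable_geometric) auto
      finally show "(\<Sum>n<N. norm (f (a (Suc n))) * real (Suc n) powr (- s)) \<le> (onorm f * K) * (\<Sum>k. d ^ k)" .
    qed simp
  qed
  have strong: "ereal 1 \<le> abscissa_abs_conv a"
  proof (rule ccontr)
    assume "\<not> ereal 1 \<le> abscissa_abs_conv a"
    then have "summable (\<lambda>n. norm (a (Suc n)) * real (Suc n) powr (- 1))"
      by (intro summable_of_abscissa_less) simp
    then have "summable (\<lambda>n. real (Suc n) powr (- 1))"
    proof (rule summable_comparison_test')
      show "norm (real (Suc n) powr (- 1)) \<le> norm (a (Suc n)) * real (Suc n) powr (- 1)" for n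
        using mult_right_mono[OF a_norm(1), of "real (Suc n) powr (- 1)" n] by simp
    qed
    then show False by (simp only: summable_Suc_powr_iff)
  qed
  have "ereal 1 - ereal 0 \<le> abscissa_abs_conv a - weak_abscissa_abs_conv a"
    using strong weak by (rule ereal_minus_mono)
  \<comment> \<open>\<open>strong\<close> rules out the case where both abscissas are
    \<open>- \<infinity>\<close>.\<close>
  also have "\<dots> = abs_conv_gap_of a" using strong by (auto simp: abs_conv_gap_of_def)
  also have "\<dots> \<le> abs_conv_gap TYPE('a)"
    unfolding abs_conv_gap_def using conv by (intro SUP_upper) simp
  finally show ?thesis by (simp add: one_ereal_def)
qed

section \<open>Assembly of the equivalences\<close>

theorem theorem3p8:
  assumes infinite_dim: "\<not> fin_dim_subspace (UNIV :: 'a::complex_banach set)"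
  shows "(abs_conv_gap TYPE('a) = 1 \<longleftrightarrow> (\<forall>p\<ge>2. \<not> has_cotype p TYPE('a)))
       \<and> ((\<forall>p\<ge>2. \<not> has_cotype p TYPE('a)) \<longleftrightarrow> (\<exists>K>1. contains_linfty_n_uniformly K TYPE('a)))
       \<and> ((\<exists>K>1. contains_linfty_n_uniformly K TYPE('a)) \<longleftrightarrow>
          (\<forall>K>1. contains_linfty_n_uniformly K TYPE('a)))
       \<and> ((\<forall>K>1. contains_linfty_n_uniformly K TYPE('a)) \<longleftrightarrow>
          (\<forall>p\<ge>2. \<not> p1_summing p (id :: 'a \<Rightarrow> 'a)))
       \<and> ((\<forall>p\<ge>2. \<not> p1_summing p (id :: 'a \<Rightarrow> 'a)) \<longleftrightarrow>
          finitely_representable TYPE(linfty) TYPE('a))"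
proof -
  let ?no_cotype = "\<forall>p\<ge>2. \<not> has_cotype p TYPE('a)"
  let ?not_summing = "\<forall>p\<ge>2. \<not> p1_summing p (id :: 'a \<Rightarrow> 'a)"
  let ?contains = "\<lambda>K. contains_linfty_n_uniformly K TYPE('a)"
  let ?fr = "finitely_representable TYPE(linfty) TYPE('a)"
  \<comment> \<open>The implications close two cycles: absence of cotype gives uniform copies and
    finite representability, either of these prevents the identity from being summing, and that
    returns to absence of cotype. The gap is tied to absence of cotype directly.\<close>
  have fam: "\<exists>y::nat \<Rightarrow> 'a. linf_family K n y" if ?no_cotype "K > 1" for K n
    using exists_linf_family[OF that] .
  have 1: "\<forall>K>1. ?contains K" if ?no_cotype
    using contains_linfty_n_of_families fam[OF that] by blast
  have 2: ?fr if ?no_cotype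
    using finitely_representable_of_families fam[OF that] by blast
  have 3: "\<exists>K>1. ?contains K" if "\<forall>K>1. ?contains K"
    using that by (intro exI[of _ 2]) simp
  have 4: ?not_summing if ex: "\<exists>K>1. ?contains K"
  proof (intro allI impI)
    fix p :: real assume "p \<ge> 2"
    obtain K where K: "?contains K" using ex by blast
    show "\<not> p1_summing p (id :: 'a \<Rightarrow> 'a)"
    proof (rule not_p1_summing_of_families)
      fix n :: nat assume "n > 0"
      moreover obtain E :: "'a set" and v where
        "lin_iso_on (linfty_n n) E v" "distortion_on (linfty_n n) E v \<le> K"
        using K unfolding contains_linfty_n_uniformly_def by blast
      ultimately show "\<exists>y::nat \<Rightarrow> 'a. (\<forall>i<n. norm (y i) \<ge> 1) \<and>
          (\<forall>z. (\<forall>i<n. cmod (z i) \<le> 1) \<longrightarrow> norm (\<Sum>i<n. z i *\<^sub>C y i) \<le> K)"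
        by (intro unconditional_family_of_lin_iso)
    qed (use \<open>p \<ge> 2\<close> in simp)
  qed
  have 5: ?not_summing if fr: ?fr
  proof (intro allI impI)
    fix p :: real assume "p \<ge> 2"
    show "\<not> p1_summing p (id :: 'a \<Rightarrow> 'a)"
    proof (rule not_p1_summing_of_families)
      fix n :: nat assume "n > 0"
      \<comment> \<open>Any fixed \<open>\<epsilon>\<close> serves, here 1, since only a uniform
        bound on the distortion is wanted.\<close>
      moreover obtain F :: "'a set" and v where
        "lin_iso_on (linfty_n n) F v" "distortion_on (linfty_n n) F v < 1 + 1"
        using fr fin_dim_linfty_n[of n] unfolding finitely_representable_def
        by (meson zero_less_one)
      ultimately show "\<exists>y::nat \<Rightarrow> 'a. (\<forall>i<n. norm (y i) \<ge> 1) \<and>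
          (\<forall>z. (\<forall>i<n. cmod (z i) \<le> 1) \<longrightarrow> norm (\<Sum>i<n. z i *\<^sub>C y i) \<le> 1 + 1)"
        by (intro unconditional_family_of_lin_iso) auto
    qed (use \<open>p \<ge> 2\<close> in simp)
  qed
  have 6: ?no_cotype if ?not_summing
    using that p1_summing_of_cotype by blast
  have 7: "abs_conv_gap TYPE('a) = 1" if ?no_cotype
    using abs_conv_gap_le_one[where 'a = 'a] abs_conv_gap_ge_one[OF fam[OF that, of 2]] by (intro antisym) auto
  have 8: ?no_cotype if gap: "abs_conv_gap TYPE('a) = 1"
  proof (intro allI impI notI)
    fix p :: real assume p: "p \<ge> 2" and "has_cotype p TYPE('a)"
    then have "abs_conv_gap TYPE('a) \<le> ereal (1 - 1 / p)"
      by (intro abs_conv_gap_le_p1_summing p1_summing_of_cotype) auto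
    then show False using gap p by (simp add: one_ereal_def)
  qed
  show ?thesis using 1 2 3 4 5 6 7 8 by blast
qed

end
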